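(* Let $g:\mathbb{R}\to\mathbb{R}$ be a Schwartz function and let $(L_n)_{n\ge 1}$ be positive real numbers with $L_n\to+\infty$ and $\frac{L_n}{n}\to 0$ as $n\to\infty$. For each $n$ let $M$ be a random unitary matrix distributed according to the normalized Haar measure on $U(n)$, with eigenvalues $e^{i\theta_1},\dots,e^{i\theta_n}$, $-\pi\le\theta_1,\dots,\theta_n<\pi$. Then $$E_n\sum_{j=1}^n g(L_n\theta_j)=\frac{n}{2\pi L_n}\int_{-\infty}^{\infty} g(x)\,dx,$$ and the centralized random variable $$\sum_{j=1}^n g(L_n\theta_j)-E_n\sum_{j=1}^n g(L_n\theta_j)$$ converges in distribution, as $n\to\infty$, to the normal law $N\Bigl(0,\frac{1}{2\pi}\int_{-\infty}^{+\infty}|\hat g(t)|^2\,|t|\,dt\Bigr)$.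
   Context: $E_n$ denotes the mathematical expectation with respect to the normalized Haar measure on $U(n)$. The Fourier transform $\hat g$ is normalized by $g(x)=\frac{1}{\sqrt{2\pi}}\int_{-\infty}^{\infty}\hat g(t)e^{itx}\,dt$. $N(\mu,\sigma^2)$ is the normal law with mean $\mu$ and variance $\sigma^2$.
   Formalization: As stated this fails (mean: g=exp(-x²)). Proved: both claims with g(L_n·) summed over 2π-periods; for the literal sum, the mean with ∫g minus its integral over |x|>πL_n, and the CLT if (g(πL_n)-g(-πL_n))² log n→0. *)

theory Defs
  imports "HOL-Probability.Probability" "Jordan_Normal_Form.Schur_Decomposition"
begin

definition schwartz :: "(real \<Rightarrow> real) \<Rightarrow> bool" where
  "schwartz g \<longleftrightarrow>
     (\<forall>k x. (deriv ^^ k) g field_differentiable at x) \<and>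
     (\<forall>j k. bounded (range (\<lambda>x. x ^ j * (deriv ^^ k) g x)))"

text \<open>For Schwartz functions this is the transform normalised by
  \<open>g x = 1 / sqrt (2 * pi) * (\<integral> \<hat>g t * exp (\<i> * t * x) dt)\<close>.\<close>

definition fourier :: "(real \<Rightarrow> real) \<Rightarrow> real \<Rightarrow> complex" where
  "fourier g t = complex_of_real (1 / sqrt (2 * pi)) *
     (LINT x|lborel. complex_of_real (g x) * cis (- (t * x)))"

definition unitary_group :: "nat \<Rightarrow> complex mat set" where
  "unitary_group n = {A \<in> carrier_mat n n. mat_adjoint A * A = 1\<^sub>m n}"

text \<open>The type of matrices carries no topology. The Borel sets of the unitary group, as a
  subspace of the \<open>n * n\<close>-dimensional complex space, are those generated by the matrix entries.\<close>

definition unitary_borel :: "nat \<Rightarrow> complex mat measure" where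
  "unitary_borel n =
     vimage_algebra (unitary_group n) (\<lambda>A. \<lambda>(i, j)\<in>{..<n} \<times> {..<n}. A $$ (i, j))
       (\<Pi>\<^sub>M ij\<in>{..<n} \<times> {..<n}. (borel :: complex measure))"

text \<open>These conditions determine the measure uniquely.\<close>

definition normalized_haar :: "nat \<Rightarrow> complex mat measure \<Rightarrow> bool" where
  "normalized_haar n H \<longleftrightarrow>
     prob_space H \<and> space H = unitary_group n \<and> sets H = sets (unitary_borel n) \<and>
     (\<forall>U \<in> unitary_group n. distr H H (\<lambda>A. U * A) = H)"

definition eigenangles :: "nat \<Rightarrow> complex mat \<Rightarrow> (nat \<Rightarrow> real) \<Rightarrow> bool" where
  "eigenangles n A \<phi> \<longleftrightarrow>
     (\<forall>j<n. - pi \<le> \<phi> j \<and> \<phi> j < pi) \<and> char_poly A = (\<Prod>j<n. [:- cis (\<phi> j), 1:])"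

text \<open>The function \<open>\<lambda>x. g (L * x)\<close> transported to the circle by summing over the period
  \<open>2 * pi\<close>. For \<open>- pi \<le> x < pi\<close> it is just \<open>g (L * x)\<close> if \<open>g y = 0\<close> whenever \<open>\<bar>y\<bar> \<ge> pi * L\<close>.
  Its integral over the circle is the integral of \<open>g (L * x)\<close> over the whole line.\<close>

definition dilate_circle :: "real \<Rightarrow> (real \<Rightarrow> real) \<Rightarrow> real \<Rightarrow> real" where
  "dilate_circle L g x = (\<Sum>\<^sub>\<infinity>k::int. g (L * (x + 2 * pi * of_int k)))"

text \<open>The normal law with the given mean and variance; the library density is zero when the
  standard deviation is zero, where the law is a point mass.\<close>

definition normal_law :: "real \<Rightarrow> real \<Rightarrow> real measure" where
  "normal_law \<mu> v =
     (if v = 0 then return borel \<mu> else density lborel (normal_density \<mu> (sqrt v)))"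

definition limit_variance :: "(real \<Rightarrow> real) \<Rightarrow> real" where
  "limit_variance g = 1 / (2 * pi) * (LINT t|lborel. (cmod (fourier g t))\<^sup>2 * \<bar>t\<bar>)"

text \<open>Convergence in distribution of the centred variables. The \<open>n\<close>-th variable lives on the
  \<open>n\<close>-th probability space.\<close>

definition centred_tends_to_law ::
    "(nat \<Rightarrow> 'a measure) \<Rightarrow> (nat \<Rightarrow> 'a \<Rightarrow> real) \<Rightarrow> real measure \<Rightarrow> bool" where
  "centred_tends_to_law P X \<nu> \<longleftrightarrow>
     weak_conv_m (\<lambda>n. distr (P n) borel (\<lambda>\<omega>. X n \<omega> - (LINT \<omega>'|P n. X n \<omega>'))) \<nu>"

end

theory Submission
  imports Defs "HOL-Real_Asymp.Real_Asymp"
begin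

text \<open>
  Differentiating along the rank-one one-parameter subgroups, Haar invariance says that the gradient of any
  regular function has expectation zero. For the vector field \<open>M ^ k\<close> this is the loop equation
  \<open>E [(n * p_k + Q_k) * G + tr (M ^ k * grad G)] = 0\<close>, where \<open>p_k = tr (M ^ k)\<close> and \<open>Q_k = (\<Sum>l=1..<k. p_l * p_{k-l})\<close>.

  Its solution through the one-row Hall-Littlewood polynomials, whose generating function satisfies a second-order
  identity, gives \<open>E \<bar>p_k\<bar>\<^sup>2 = min k n\<close>. This in turn bounds \<open>E \<bar>Q_k\<bar>\<^sup>2\<close>, and for a trigonometric sum
  \<open>X = (\<Sum>k\<noteq>0. c_k * p_k)\<close> the loop equations show that its characteristic function \<open>\<psi>\<close> nearly solves
  \<open>\<psi>' = - s * \<sigma>\<^sup>2 * \<psi>\<close> with \<open>\<sigma>\<^sup>2 = 2 * (\<Sum>k>0. k * \<bar>c_k\<bar>\<^sup>2)\<close>.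

  The Fourier coefficients of the periodised dilation of \<open>g\<close> are values of the Fourier transform of \<open>g\<close> at \<open>k / L\<close>,
  so \<open>\<sigma>\<^sup>2\<close> is a Riemann sum for the limit variance and the error is of order \<open>L / n\<close>. Without periodisation
  the coefficients change by \<open>O (\<bar>jump\<bar> / k + 1 / (L * k\<^sup>2))\<close>, and the variance bound
  \<open>\<Sum>k. \<bar>c_k\<bar>\<^sup>2 * min \<bar>k\<bar> n\<close> makes the difference negligible when \<open>jump\<^sup>2 * ln n\<close> tends to zero.
\<close>

section \<open>Integer powers of unitary matrices\<close>

lemma mat_adjoint_carrier: "A \<in> carrier_mat n n \<Longrightarrow> mat_adjoint A \<in> carrier_mat n n"
  unfolding mat_adjoint_def by auto

lemma mat_adjoint_index:
  assumes "A \<in> carrier_mat n n" "i < n" "j < n"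
  shows "mat_adjoint A $$ (i, j) = cnj (A $$ (j, i))"
  using assms unfolding mat_adjoint_def by (simp add: mat_of_rows_index cols_nth)

lemma mult_index_sum:
  assumes "A \<in> carrier_mat n n" "B \<in> carrier_mat n n" "i < n" "j < n"
  shows "(A * B) $$ (i, j) = (\<Sum>k<n. A $$ (i, k) * B $$ (k, j))"
  using assms by (auto simp: scalar_prod_def atLeast0LessThan intro!: sum.cong)

lemma mat_adjoint_mult:
  fixes A B :: "complex mat"
  assumes "A \<in> carrier_mat n n" "B \<in> carrier_mat n n"
  shows "mat_adjoint (A * B) = mat_adjoint B * mat_adjoint A"
proof (rule eq_matI)
  fix i j assume *: "i < dim_row (mat_adjoint B * mat_adjoint A)" "j < dim_col (mat_adjoint B * mat_adjoint A)"
  hence ij: "i < n" "j < n" using assms mat_adjoint_carrier by (metis carrier_matD index_mult_mat(2,3))+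
  show "mat_adjoint (A * B) $$ (i, j) = (mat_adjoint B * mat_adjoint A) $$ (i, j)"
    using assms ij mat_adjoint_carrier
    by (simp add: mat_adjoint_index[of _ n] mult_index_sum[of _ n] mat_adjoint_carrier mult.commute
        del: index_mult_mat)
qed (use assms mat_adjoint_carrier[of A n] mat_adjoint_carrier[of B n] mat_adjoint_carrier[of "A*B" n] in auto)

lemma unitary_groupD:
  assumes "A \<in> unitary_group n"
  shows "A \<in> carrier_mat n n" "mat_adjoint A * A = 1\<^sub>m n" "A * mat_adjoint A = 1\<^sub>m n"
  using assms mat_mult_left_right_inverse[OF mat_adjoint_carrier, of A n A]
  by (auto simp: unitary_group_def)

lemma unitary_group_mult:
  assumes "A \<in> unitary_group n" "B \<in> unitary_group n"
  shows "A * B \<in> unitary_group n"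
proof -
  note A = unitary_groupD[OF assms(1)] and B = unitary_groupD[OF assms(2)]
  note c = mat_adjoint_carrier[OF A(1)] mat_adjoint_carrier[OF B(1)]
  have "mat_adjoint (A * B) * (A * B) = mat_adjoint B * (mat_adjoint A * (A * B))"
    using A B c by (simp add: mat_adjoint_mult[of _ n] assoc_mult_mat[of _ n n _ n _ n])
  also have "mat_adjoint A * (A * B) = B"
    using A B c by (simp flip: assoc_mult_mat[of _ n n _ n _ n])
  finally show ?thesis using A B by (simp add: unitary_group_def)
qed

lemma mat_adjoint_one: "mat_adjoint (1\<^sub>m n) = (1\<^sub>m n :: complex mat)"
proof (rule eq_matI)
  show "mat_adjoint (1\<^sub>m n) $$ (i, j) = (1\<^sub>m n :: complex mat) $$ (i, j)"
    if "i < dim_row (1\<^sub>m n :: complex mat)" "j < dim_col (1\<^sub>m n :: complex mat)" for i j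
    using that by (subst mat_adjoint_index[of _ n]) auto
qed (auto simp: mat_adjoint_def)

lemma unitary_group_one: "1\<^sub>m n \<in> unitary_group n"
  by (simp add: unitary_group_def mat_adjoint_one)

lemma unitary_group_pow: "A \<in> unitary_group n \<Longrightarrow> A ^\<^sub>m k \<in> unitary_group n"
  by (induction k) (auto simp: unitary_group_one unitary_group_mult dest: unitary_groupD(1))

lemma unitary_entry_bound:
  assumes "A \<in> unitary_group n" "i < n" "j < n"
  shows "cmod (A $$ (i, j)) \<le> 1"
proof -
  note A = unitary_groupD[OF assms(1)]
  have "1 = (mat_adjoint A * A) $$ (j, j)" using A assms by simp
  also have "\<dots> = (\<Sum>k<n. cnj (A $$ (k, j)) * A $$ (k, j))"
    using assms by (subst mult_index_sum[OF mat_adjoint_carrier[OF A(1)] A(1)])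
      (auto simp: mat_adjoint_index[OF A(1)])
  also have "\<dots> = of_real (\<Sum>k<n. (cmod (A $$ (k, j)))\<^sup>2)"
    unfolding of_real_sum by (intro sum.cong) (simp_all only: complex_norm_square mult.commute)
  finally have "(\<Sum>k<n. (cmod (A $$ (k, j)))\<^sup>2) = 1" by (metis of_real_eq_1_iff)
  moreover have "(cmod (A $$ (i, j)))\<^sup>2 \<le> (\<Sum>k<n. (cmod (A $$ (k, j)))\<^sup>2)"
    using assms by (intro member_le_sum) auto
  ultimately show ?thesis by (simp add: power_le_one_iff abs_square_le_1)
qed

definition int_pow_mat :: "complex mat \<Rightarrow> int \<Rightarrow> complex mat" where
  "int_pow_mat M k = (if 0 \<le> k then M ^\<^sub>m nat k else mat_adjoint (M ^\<^sub>m nat (- k)))"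

lemma int_pow_mat_carrier: "M \<in> carrier_mat n n \<Longrightarrow> int_pow_mat M k \<in> carrier_mat n n"
  by (simp add: int_pow_mat_def mat_adjoint_carrier)

lemma pow_mat_Suc_left: "A \<in> carrier_mat n n \<Longrightarrow> A ^\<^sub>m Suc k = A * A ^\<^sub>m k"
  by (induction k) (auto simp: assoc_mult_mat[of _ n n _ n _ n])

lemma int_pow_mat_step:
  assumes "M \<in> unitary_group n"
  shows "int_pow_mat M k * M = int_pow_mat M (k + 1)"
    and "int_pow_mat M k * mat_adjoint M = int_pow_mat M (k - 1)"
proof -
  note M = unitary_groupD[OF assms]
  note c = M(1) mat_adjoint_carrier[OF M(1)]
  show "int_pow_mat M k * M = int_pow_mat M (k + 1)"
  proof (cases "0 \<le> k")
    case True
    then show ?thesis by (simp add: int_pow_mat_def nat_add_distrib)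
  next
    case False
    then obtain m where m: "k = - int (Suc m)" by (metis int_cases linorder_not_le of_nat_0_le_iff)
    have "mat_adjoint (M ^\<^sub>m Suc m) * M = (mat_adjoint (M ^\<^sub>m m) * mat_adjoint M) * M"
      unfolding pow_mat_Suc_left[OF M(1)] using M by (subst mat_adjoint_mult[of _ n]) auto
    also have "\<dots> = mat_adjoint (M ^\<^sub>m m) * (mat_adjoint M * M)"
      by (rule assoc_mult_mat[of _ n n _ n _ n]) (use M c in \<open>auto intro: mat_adjoint_carrier\<close>)
    also have "\<dots> = mat_adjoint (M ^\<^sub>m m)"
      using M c by (simp add: mat_adjoint_carrier right_mult_one_mat[of _ n n])
    finally have *: "mat_adjoint (M ^\<^sub>m Suc m) * M = mat_adjoint (M ^\<^sub>m m)" .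
    have "int_pow_mat M (- int m) = mat_adjoint (M ^\<^sub>m m)"
      using M mat_adjoint_one by (auto simp: int_pow_mat_def)
    moreover have "k + 1 = - int m" "\<not> 0 \<le> k" "nat (- k) = Suc m" using m by auto
    ultimately show ?thesis using * by (simp add: int_pow_mat_def del: pow_mat.simps)
  qed
  show "int_pow_mat M k * mat_adjoint M = int_pow_mat M (k - 1)"
  proof (cases "0 < k")
    case True
    then obtain m where m: "k = int (Suc m)" by (metis zero_less_imp_eq_int gr0_conv_Suc)
    have "M ^\<^sub>m Suc m * mat_adjoint M = M ^\<^sub>m m * (M * mat_adjoint M)"
      using M c by (simp add: assoc_mult_mat[of _ n n _ n _ n])
    also have "\<dots> = M ^\<^sub>m m" using M by simp
    finally show ?thesis using m by (simp add: int_pow_mat_def nat_add_distrib)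
  next
    case False
    hence m: "k = - int (nat (- k))" by simp
    define m where "m = nat (- k)"
    note m = m[folded m_def]
    have "int_pow_mat M k = mat_adjoint (M ^\<^sub>m m)" using M m mat_adjoint_one by (auto simp: int_pow_mat_def)
    moreover have "mat_adjoint (M ^\<^sub>m m) * mat_adjoint M = mat_adjoint (M ^\<^sub>m Suc m)"
      unfolding pow_mat_Suc_left[OF M(1)] using M by (subst mat_adjoint_mult[of _ n]) auto
    moreover have "k - 1 < 0" "nat (-(k - 1)) = Suc m" using m by auto
    ultimately show ?thesis by (simp add: int_pow_mat_def del: pow_mat.simps)
  qed
qed

lemma int_pow_mat_add:
  assumes "M \<in> unitary_group n"
  shows "int_pow_mat M k * int_pow_mat M l = int_pow_mat M (k + l)"
proof -
  note M = unitary_groupD[OF assms]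
  note c = M(1) mat_adjoint_carrier[OF M(1)] int_pow_mat_carrier[OF M(1)]
  note st = int_pow_mat_step[OF assms]
  show ?thesis
  proof (induction l rule: int_induct[where k = 0])
    case base
    have "int_pow_mat M 0 = 1\<^sub>m n" using M by (simp add: int_pow_mat_def)
    then show ?case using c by (simp add: right_mult_one_mat[of _ n n])
  next
    case (step1 i)
    have "int_pow_mat M k * int_pow_mat M (i + 1) = (int_pow_mat M k * int_pow_mat M i) * M"
      unfolding st(1)[symmetric] using c by (simp add: assoc_mult_mat[of _ n n _ n _ n])
    then show ?case using step1 st(1)[of "k + i"] by (simp add: add.assoc)
  next
    case (step2 i)
    have "int_pow_mat M k * int_pow_mat M (i - 1) = (int_pow_mat M k * int_pow_mat M i) * mat_adjoint M"
      unfolding st(2)[symmetric] using c by (simp add: assoc_mult_mat[of _ n n _ n _ n])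
    then show ?case using step2 st(2)[of "k + i"] by (simp add: algebra_simps)
  qed
qed

definition mpow :: "complex mat \<Rightarrow> int \<Rightarrow> nat \<Rightarrow> nat \<Rightarrow> complex" where
  "mpow M k i j = int_pow_mat M k $$ (i, j)"

definition ptrace :: "nat \<Rightarrow> int \<Rightarrow> complex mat \<Rightarrow> complex" where
  "ptrace n k M = (\<Sum>i<n. mpow M k i i)"

context
  fixes n :: nat and M :: "complex mat"
  assumes M: "M \<in> unitary_group n"
begin

lemma mpow_mult:
  "i < n \<Longrightarrow> j < n \<Longrightarrow> (\<Sum>c<n. mpow M k i c * mpow M l c j) = mpow M (k + l) i j"
  using int_pow_mat_carrier[OF unitary_groupD(1)[OF M]]
  unfolding mpow_def int_pow_mat_add[OF M, symmetric] by (subst mult_index_sum[of _ n]) auto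

lemma mpow_0: "i < n \<Longrightarrow> j < n \<Longrightarrow> mpow M 0 i j = (if i = j then 1 else 0)"
  using unitary_groupD(1)[OF M] by (auto simp: mpow_def int_pow_mat_def)

lemma mpow_1: "mpow M 1 i j = M $$ (i, j)"
  using unitary_groupD(1)[OF M] by (auto simp: mpow_def int_pow_mat_def)

lemma mpow_minus: "i < n \<Longrightarrow> j < n \<Longrightarrow> mpow M (- k) i j = cnj (mpow M k j i)"
  using unitary_groupD(1)[OF M] mpow_0[of i j] mpow_0[of j i]
  by (auto simp: mpow_def int_pow_mat_def mat_adjoint_index[of _ n])

lemma mpow_bound: "i < n \<Longrightarrow> j < n \<Longrightarrow> cmod (mpow M k i j) \<le> 1"
  using unitary_entry_bound[OF unitary_group_pow[OF M]] unitary_groupD(1)[OF M]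
  by (auto simp: mpow_def int_pow_mat_def mat_adjoint_index[of _ n])

lemma ptrace_0: "ptrace n 0 M = of_nat n"
  by (simp add: ptrace_def mpow_0)

lemma ptrace_minus: "ptrace n (- k) M = cnj (ptrace n k M)"
  by (simp add: ptrace_def mpow_minus)

lemma mpow_trace_mult: "(\<Sum>i<n. \<Sum>j<n. mpow M k i j * mpow M l j i) = ptrace n (k + l) M"
  by (simp add: ptrace_def mpow_mult)

end

definition flow :: "nat \<Rightarrow> (nat \<Rightarrow> complex) \<Rightarrow> real \<Rightarrow> complex mat" where
  "flow n v t = mat n n (\<lambda>(i, j). (if i = j then 1 else 0) + (cis t - 1) * (v i * cnj (v j)))"

lemma flow_carrier [simp]: "flow n v t \<in> carrier_mat n n"
  by (simp add: flow_def)

lemma flow_0: "flow n v 0 = 1\<^sub>m n"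
  by (rule eq_matI) (auto simp: flow_def)

context
  fixes n :: nat and v :: "nat \<Rightarrow> complex"
  assumes v: "(\<Sum>i<n. v i * cnj (v i)) = 1"
begin

lemma flow_add: "flow n v (s + t) = flow n v s * flow n v t"
proof (rule eq_matI)
  fix i j assume "i < dim_row (flow n v s * flow n v t)" "j < dim_col (flow n v s * flow n v t)"
  hence ij: "i < n" "j < n" by (auto simp: flow_def)
  let ?a = "cis s - 1" and ?b = "cis t - 1" and ?d = "\<lambda>i j. if i = j then 1 else (0::complex)"
  have "(flow n v s * flow n v t) $$ (i, j) =
      (\<Sum>k<n. (?d i k + ?a * (v i * cnj (v k))) * (?d k j + ?b * (v k * cnj (v j))))"
    using ij by (subst mult_index_sum[of _ n]) (auto simp: flow_def)
  also have "\<dots> = (\<Sum>k<n. ?d i k * ?d k j + ?d i k * (?b * (v k * cnj (v j))) + ?d k j * (?a * (v i * cnj (v k)))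
      + ?a * ?b * v i * cnj (v j) * (v k * cnj (v k)))"
    by (intro sum.cong) (auto simp: algebra_simps)
  also have "\<dots> = ?d i j + ?b * (v i * cnj (v j)) + ?a * (v i * cnj (v j)) + ?a * ?b * v i * cnj (v j)"
    using ij v by (simp add: sum.distrib if_distrib[of "\<lambda>x. x * _"] cong: if_cong flip: sum_distrib_left)
  also have "\<dots> = flow n v (s + t) $$ (i, j)"
    using ij by (simp add: flow_def algebra_simps flip: cis_mult)
  finally show "flow n v (s + t) $$ (i, j) = (flow n v s * flow n v t) $$ (i, j)" by simp
qed (auto simp: flow_def)

lemma flow_unitary: "flow n v t \<in> unitary_group n"
proof -
  have "mat_adjoint (flow n v t) = flow n v (- t)"
  proof (rule eq_matI)
    show "mat_adjoint (flow n v t) $$ (i, j) = flow n v (- t) $$ (i, j)"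
      if "i < dim_row (flow n v (- t))" "j < dim_col (flow n v (- t))" for i j
      using that by (subst mat_adjoint_index[of _ n]) (auto simp: flow_def cis_cnj mult.commute)
  qed (auto simp: flow_def mat_adjoint_def)
  thus ?thesis using flow_add[of "-t" t] by (simp add: unitary_group_def flow_0)
qed

end

section \<open>The loop equation for Haar measure\<close>

lemma borel_measurable_cnj: "f \<in> borel_measurable N \<Longrightarrow> (\<lambda>x. cnj (f x)) \<in> borel_measurable N"
  by (rule borel_measurable_continuous_on[where f = cnj]) (auto intro!: continuous_intros)

locale haar_unitary =
  fixes n :: nat and H :: "complex mat measure"
  assumes haar: "normalized_haar n H" and n_pos: "0 < n"
begin

sublocale prob_space H
  using haar by (simp add: normalized_haar_def)

lemma space_H: "space H = unitary_group n"
  using haar by (simp add: normalized_haar_def)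

lemma sets_H: "sets H = sets (unitary_borel n)"
  using haar by (simp add: normalized_haar_def)

lemma entry_measurable:
  assumes "i < n" "j < n"
  shows "(\<lambda>M. M $$ (i, j)) \<in> borel_measurable H"
proof -
  let ?I = "{..<n} \<times> {..<n}" and ?f = "\<lambda>A::complex mat. \<lambda>(i, j)\<in>{..<n} \<times> {..<n}. A $$ (i, j)"
  have "?f \<in> unitary_borel n \<rightarrow>\<^sub>M (\<Pi>\<^sub>M ij\<in>?I. (borel :: complex measure))"
    unfolding unitary_borel_def by (rule measurable_vimage_algebra1) (auto simp: space_PiM)
  hence "(\<lambda>M. ?f M (i, j)) \<in> borel_measurable (unitary_borel n)"
    by (rule measurable_compose[OF _ measurable_component_singleton]) (use assms in auto)
  thus ?thesis using assms by (simp add: measurable_cong_sets[OF sets_H refl])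
qed

lemma measurable_H_I:
  assumes "\<And>M. M \<in> unitary_group n \<Longrightarrow> F M \<in> unitary_group n"
    and "\<And>i j. i < n \<Longrightarrow> j < n \<Longrightarrow> (\<lambda>M. F M $$ (i, j)) \<in> borel_measurable H"
  shows "F \<in> H \<rightarrow>\<^sub>M H"
proof -
  let ?I = "{..<n} \<times> {..<n}" and ?f = "\<lambda>A::complex mat. \<lambda>(i, j)\<in>{..<n} \<times> {..<n}. A $$ (i, j)"
  have "F \<in> H \<rightarrow>\<^sub>M unitary_borel n"
    unfolding unitary_borel_def
  proof (rule measurable_vimage_algebra2)
    show "F \<in> space H \<rightarrow> unitary_group n" using assms(1) by (auto simp: space_H)
    show "(\<lambda>x. ?f (F x)) \<in> H \<rightarrow>\<^sub>M (\<Pi>\<^sub>M ij\<in>?I. (borel :: complex measure))"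
      by (rule measurable_restrict) (auto intro: assms(2))
  qed
  thus ?thesis by (simp add: measurable_cong_sets[OF refl sets_H])
qed

lemma mult_left_measurable:
  assumes "U \<in> unitary_group n"
  shows "(\<lambda>M. U * M) \<in> H \<rightarrow>\<^sub>M H"
proof (rule measurable_H_I)
  fix i j assume ij: "i < n" "j < n"
  have "(\<lambda>M. \<Sum>k<n. U $$ (i, k) * M $$ (k, j)) \<in> borel_measurable H"
    using ij by (intro borel_measurable_sum borel_measurable_times entry_measurable) auto
  thus "(\<lambda>M. (U * M) $$ (i, j)) \<in> borel_measurable H"
    by (subst measurable_cong[where g = "\<lambda>M. \<Sum>k<n. U $$ (i, k) * M $$ (k, j)"])
      (use ij assms mult_index_sum[of U n] in \<open>auto simp: space_H dest!: unitary_groupD(1)\<close>)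
qed (use assms unitary_group_mult in auto)

lemma integral_mult_left:
  fixes f :: "complex mat \<Rightarrow> complex"
  assumes "U \<in> unitary_group n" "f \<in> borel_measurable H"
  shows "(LINT M|H. f (U * M)) = (LINT M|H. f M)"
proof -
  have "(LINT M|H. f M) = (LINT M|distr H H (\<lambda>M. U * M). f M)"
    using haar assms(1) by (simp add: normalized_haar_def)
  also have "\<dots> = (LINT M|H. f (U * M))"
    using assms by (intro integral_distr mult_left_measurable)
  finally show ?thesis by simp
qed

definition regular :: "(complex mat \<Rightarrow> complex) \<Rightarrow> bool" where
  "regular f \<longleftrightarrow> f \<in> borel_measurable H \<and> (\<exists>C. \<forall>M\<in>unitary_group n. cmod (f M) \<le> C)"

lemma regularI: "f \<in> borel_measurable H \<Longrightarrow> (\<And>M. M \<in> unitary_group n \<Longrightarrow> cmod (f M) \<le> C) \<Longrightarrow> regular f"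
  unfolding regular_def by blast

lemma regular_const [simp, intro]: "regular (\<lambda>M. c)"
  by (rule regularI[of _ "cmod c"]) auto

lemma regular_add [intro]: assumes "regular f" "regular g" shows "regular (\<lambda>M. f M + g M)"
proof -
  from assms obtain A B where "\<forall>M\<in>unitary_group n. cmod (f M) \<le> A" "\<forall>M\<in>unitary_group n. cmod (g M) \<le> B"
    unfolding regular_def by blast
  thus ?thesis using assms
    by (intro regularI[of _ "A + B"]) (auto simp: regular_def intro: norm_triangle_le add_mono)
qed

lemma regular_mult [intro]: assumes "regular f" "regular g" shows "regular (\<lambda>M. f M * g M)"
proof -
  from assms obtain A B where *: "\<forall>M\<in>unitary_group n. cmod (f M) \<le> A" "\<forall>M\<in>unitary_group n. cmod (g M) \<le> B"
    unfolding regular_def by blast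
  show ?thesis
  proof (rule regularI[of _ "A * B"])
    show "cmod (f M * g M) \<le> A * B" if "M \<in> unitary_group n" for M
      unfolding norm_mult by (rule mult_mono) (use * that in \<open>auto intro: order_trans[OF norm_ge_zero]\<close>)
  qed (use assms in \<open>auto simp: regular_def\<close>)
qed

lemma regular_sum [intro]: "(\<And>i. i \<in> I \<Longrightarrow> regular (f i)) \<Longrightarrow> regular (\<lambda>M. \<Sum>i\<in>I. f i M)"
  by (induction I rule: infinite_finite_induct) auto

lemma regular_uminus [intro]: "regular f \<Longrightarrow> regular (\<lambda>M. - f M)"
  unfolding regular_def by auto

lemma regular_diff [intro]: "regular f \<Longrightarrow> regular g \<Longrightarrow> regular (\<lambda>M. f M - g M)"
  using regular_add[OF _ regular_uminus] by auto

lemma regular_cnj [intro]: "regular f \<Longrightarrow> regular (\<lambda>M. cnj (f M))"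
  unfolding regular_def by (auto intro: borel_measurable_cnj)

lemma regular_exp [intro]: assumes "regular f" shows "regular (\<lambda>M. exp (f M))"
proof -
  from assms obtain A where *: "\<forall>M\<in>unitary_group n. cmod (f M) \<le> A" unfolding regular_def by blast
  show ?thesis
  proof (rule regularI[of _ "exp A"])
    show "cmod (exp (f M)) \<le> exp A" if "M \<in> unitary_group n" for M
      using * that by (simp add: norm_exp_eq_Re) (meson complex_Re_le_cmod order_trans)
  qed (use assms in \<open>auto simp: regular_def\<close>)
qed

lemma regular_integrable: assumes "regular f" shows "integrable H f"
proof -
  from assms obtain C where "\<forall>M\<in>unitary_group n. cmod (f M) \<le> C" "f \<in> borel_measurable H"
    unfolding regular_def by blast
  thus ?thesis by (intro integrable_const_bound[of _ C]) (auto simp: space_H)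
qed

lemma expectation_sum:
  "(\<And>i. i \<in> I \<Longrightarrow> regular (f i)) \<Longrightarrow> (LINT M|H. (\<Sum>i\<in>I. f i M)) = (\<Sum>i\<in>I. LINT M|H. f i M)"
  by (intro Bochner_Integration.integral_sum regular_integrable)

lemma regular_cong: "(\<And>M. M \<in> unitary_group n \<Longrightarrow> f M = g M) \<Longrightarrow> regular f \<longleftrightarrow> regular g"
  using measurable_cong[of H f g borel] unfolding regular_def by (auto simp: space_H)

lemma regular_mpow: assumes "i < n" "j < n" shows "regular (\<lambda>M. mpow M k i j)"
proof (rule regularI[of _ 1])
  have nat: "(\<lambda>M. mpow M (int m) i j) \<in> borel_measurable H" if "i < n" "j < n" for m i j
    using that
  proof (induction m arbitrary: i j)
    case 0
    then show ?case by (subst measurable_cong[where g = "\<lambda>M. if i = j then 1 else 0"]) (auto simp: space_H mpow_0)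
  next
    case (Suc m)
    have "(\<lambda>M. \<Sum>c<n. mpow M (int m) i c * M $$ (c, j)) \<in> borel_measurable H"
      using Suc by (intro borel_measurable_sum borel_measurable_times entry_measurable Suc.IH) auto
    thus ?case
      using mpow_mult[of _ n i j "int m" 1] Suc.prems
      by (subst measurable_cong[where g = "\<lambda>M. \<Sum>c<n. mpow M (int m) i c * M $$ (c, j)"])
        (auto simp: space_H mpow_1 algebra_simps)
  qed
  show "(\<lambda>M. mpow M k i j) \<in> borel_measurable H"
  proof (cases "0 \<le> k")
    case True
    then show ?thesis using nat[OF assms, of "nat k"] by simp
  next
    case False
    have "(\<lambda>M. cnj (mpow M (int (nat (- k))) j i)) \<in> borel_measurable H"
      by (rule borel_measurable_cnj nat assms)+
    then show ?thesis using False assms mpow_minus[of _ n i j "- k"]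
      by (subst measurable_cong[where g = "\<lambda>M. cnj (mpow M (int (nat (- k))) j i)"]) (auto simp: space_H)
  qed
qed (use assms in \<open>auto intro: mpow_bound\<close>)

lemma regular_ptrace [intro]: "regular (ptrace n k)"
  unfolding ptrace_def[abs_def] by (intro regular_sum regular_mpow) auto

text \<open>\<open>K\<close> represents the derivative of \<open>f\<close> along the left action of \<open>exp (\<i> * t * v * v\<^sup>*)\<close>; the rank-one
  Hermitian matrices span all matrices, so \<open>K\<close> is the complexified gradient.\<close>

definition has_gradient :: "(complex mat \<Rightarrow> complex) \<Rightarrow> (complex mat \<Rightarrow> nat \<Rightarrow> nat \<Rightarrow> complex) \<Rightarrow> bool" where
  "has_gradient f K \<longleftrightarrow> regular f \<and> (\<forall>a<n. \<forall>b<n. regular (\<lambda>M. K M a b)) \<and>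
     (\<forall>M\<in>unitary_group n. \<forall>v. (\<Sum>i<n. v i * cnj (v i)) = 1 \<longrightarrow>
        ((\<lambda>t. f (flow n v t * M)) has_vector_derivative
          \<i> * (\<Sum>a<n. \<Sum>b<n. cnj (v a) * K M a b * v b)) (at 0))"

lemma has_gradientI:
  assumes "regular f" "\<And>a b. a < n \<Longrightarrow> b < n \<Longrightarrow> regular (\<lambda>M. K M a b)"
    and "\<And>M v. M \<in> unitary_group n \<Longrightarrow> (\<Sum>i<n. v i * cnj (v i)) = 1 \<Longrightarrow>
        ((\<lambda>t. f (flow n v t * M)) has_vector_derivative
          \<i> * (\<Sum>a<n. \<Sum>b<n. cnj (v a) * K M a b * v b)) (at 0)"
  shows "has_gradient f K"
  using assms unfolding has_gradient_def by blast

lemma has_gradientD: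
  assumes "has_gradient f K"
  shows "regular f" "\<And>a b. a < n \<Longrightarrow> b < n \<Longrightarrow> regular (\<lambda>M. K M a b)"
    and "\<And>M v. M \<in> unitary_group n \<Longrightarrow> (\<Sum>i<n. v i * cnj (v i)) = 1 \<Longrightarrow>
        ((\<lambda>t. f (flow n v t * M)) has_vector_derivative
          \<i> * (\<Sum>a<n. \<Sum>b<n. cnj (v a) * K M a b * v b)) (at 0)"
  using assms unfolding has_gradient_def by blast+

lemma has_gradient_const: "has_gradient (\<lambda>M. c) (\<lambda>M a b. 0)"
  by (rule has_gradientI) auto

lemma flow_0_mult: "M \<in> unitary_group n \<Longrightarrow> flow n v 0 * M = M"
  by (auto simp: flow_0 dest: unitary_groupD(1))

lemma has_gradient_add:
  assumes "has_gradient f K" "has_gradient g L"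
  shows "has_gradient (\<lambda>M. f M + g M) (\<lambda>M a b. K M a b + L M a b)"
proof (rule has_gradientI)
  fix M v assume *: "M \<in> unitary_group n" "(\<Sum>i<n. v i * cnj (v i)) = 1"
  show "((\<lambda>t. f (flow n v t * M) + g (flow n v t * M)) has_vector_derivative
      \<i> * (\<Sum>a<n. \<Sum>b<n. cnj (v a) * (K M a b + L M a b) * v b)) (at 0)"
    using has_vector_derivative_add[OF has_gradientD(3)[OF assms(1) *] has_gradientD(3)[OF assms(2) *]]
    by (simp add: algebra_simps sum.distrib sum_distrib_left)
qed (use assms in \<open>auto dest: has_gradientD\<close>)

lemma has_gradient_mult:
  assumes "has_gradient f K" "has_gradient g L"
  shows "has_gradient (\<lambda>M. f M * g M) (\<lambda>M a b. K M a b * g M + f M * L M a b)"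
proof (rule has_gradientI)
  fix M v assume *: "M \<in> unitary_group n" "(\<Sum>i<n. v i * cnj (v i)) = 1"
  show "((\<lambda>t. f (flow n v t * M) * g (flow n v t * M)) has_vector_derivative
      \<i> * (\<Sum>a<n. \<Sum>b<n. cnj (v a) * (K M a b * g M + f M * L M a b) * v b)) (at 0)"
    using has_vector_derivative_mult[OF has_gradientD(3)[OF assms(1) *] has_gradientD(3)[OF assms(2) *]] *
    by (simp add: flow_0_mult algebra_simps sum.distrib sum_distrib_left sum_distrib_right)
qed (use assms in \<open>auto dest: has_gradientD intro!: regular_add regular_mult\<close>)

lemma has_gradient_sum:
  "(\<And>i. i \<in> I \<Longrightarrow> has_gradient (f i) (K i)) \<Longrightarrow>
    has_gradient (\<lambda>M. \<Sum>i\<in>I. f i M) (\<lambda>M a b. \<Sum>i\<in>I. K i M a b)"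
proof (induction I rule: infinite_finite_induct)
  case (insert x F)
  then show ?case using has_gradient_add[of "f x" "K x"] by simp
qed (use has_gradient_const in auto)

lemma has_gradient_cmult: "has_gradient f K \<Longrightarrow> has_gradient (\<lambda>M. c * f M) (\<lambda>M a b. c * K M a b)"
  using has_gradient_mult[OF has_gradient_const] by simp

lemma has_gradient_cnj:
  assumes "has_gradient f K"
  shows "has_gradient (\<lambda>M. cnj (f M)) (\<lambda>M a b. - cnj (K M b a))"
proof (rule has_gradientI)
  fix M v assume *: "M \<in> unitary_group n" "(\<Sum>i<n. v i * cnj (v i)) = 1"
  have "cnj (\<i> * (\<Sum>a<n. \<Sum>b<n. cnj (v a) * K M a b * v b)) =
      \<i> * (\<Sum>b<n. \<Sum>a<n. cnj (v b) * - cnj (K M a b) * v a)"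
    by (subst sum.swap) (simp add: sum_distrib_left algebra_simps flip: sum_negf)
  thus "((\<lambda>t. cnj (f (flow n v t * M))) has_vector_derivative
      \<i> * (\<Sum>a<n. \<Sum>b<n. cnj (v a) * (- cnj (K M b a)) * v b)) (at 0)"
    using has_vector_derivative_cnj[OF has_gradientD(3)[OF assms(1) *]] by simp
qed (use assms in \<open>auto dest: has_gradientD intro!: regular_uminus regular_cnj\<close>)

lemma has_gradient_exp:
  assumes "has_gradient f K"
  shows "has_gradient (\<lambda>M. exp (f M)) (\<lambda>M a b. exp (f M) * K M a b)"
proof (rule has_gradientI)
  fix M v assume *: "M \<in> unitary_group n" "(\<Sum>i<n. v i * cnj (v i)) = 1"
  have "(exp \<circ> (\<lambda>t. f (flow n v t * M)) has_vector_derivative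
      (\<i> * (\<Sum>a<n. \<Sum>b<n. cnj (v a) * K M a b * v b)) * exp (f (flow n v 0 * M))) (at 0)"
    by (rule field_vector_diff_chain_at[OF has_gradientD(3)[OF assms(1) *]]) (rule DERIV_exp)
  thus "((\<lambda>t. exp (f (flow n v t * M))) has_vector_derivative
      \<i> * (\<Sum>a<n. \<Sum>b<n. cnj (v a) * (exp (f M) * K M a b) * v b)) (at 0)"
    using * by (simp add: o_def flow_0_mult sum_distrib_left sum_distrib_right algebra_simps)
qed (use assms in \<open>auto dest: has_gradientD intro!: regular_mult\<close>)

lemma has_gradient_cong:
  assumes "has_gradient f K" and "\<And>M. M \<in> unitary_group n \<Longrightarrow> f M = g M"
    and "\<And>M a b. M \<in> unitary_group n \<Longrightarrow> a < n \<Longrightarrow> b < n \<Longrightarrow> K M a b = L M a b"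
  shows "has_gradient g L"
proof (rule has_gradientI)
  show "regular g" using has_gradientD(1)[OF assms(1)] assms(2) regular_cong by blast
  show "regular (\<lambda>M. L M a b)" if "a < n" "b < n" for a b
    using has_gradientD(2)[OF assms(1) that] assms(3) that by (subst (asm) regular_cong) auto
  fix M v assume *: "M \<in> unitary_group n" "(\<Sum>i<n. v i * cnj (v i)) = 1"
  have "f (flow n v t * M) = g (flow n v t * M)" for t
    using * by (intro assms(2) unitary_group_mult flow_unitary) auto
  thus "((\<lambda>t. g (flow n v t * M)) has_vector_derivative
      \<i> * (\<Sum>a<n. \<Sum>b<n. cnj (v a) * L M a b * v b)) (at 0)"
    using has_gradientD(3)[OF assms(1) *] assms(3)[OF *(1)] by simp
qed

lemma has_gradient_entry:
  assumes "i < n" "j < n"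
  shows "has_gradient (\<lambda>M. mpow M 1 i j) (\<lambda>M a b. if b = i then mpow M 1 a j else 0)"
proof (rule has_gradientI)
  fix M v assume *: "M \<in> unitary_group n" "(\<Sum>i<n. v i * cnj (v i)) = 1"
  note M = unitary_groupD(1)[OF *(1)]
  have eq: "mpow (flow n v t * M) 1 i j = M $$ (i, j) + (cis t - 1) * (v i * (\<Sum>k<n. cnj (v k) * M $$ (k, j)))" for t
  proof -
    have "mpow (flow n v t * M) 1 i j = (\<Sum>k<n. flow n v t $$ (i, k) * M $$ (k, j))"
      using assms M by (simp add: mpow_1[OF unitary_group_mult[OF flow_unitary]] * mult_index_sum[of _ n] del: index_mult_mat)
    also have "\<dots> = (\<Sum>k<n. (if i = k then M $$ (k, j) else 0) + (cis t - 1) * (v i * (cnj (v k) * M $$ (k, j))))"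
      using assms by (intro sum.cong) (auto simp: flow_def algebra_simps)
    also have "\<dots> = M $$ (i, j) + (cis t - 1) * (v i * (\<Sum>k<n. cnj (v k) * M $$ (k, j)))"
      using assms by (simp add: sum.distrib sum_distrib_left)
    finally show ?thesis .
  qed
  have "((\<lambda>t. M $$ (i, j) + (cis t - 1) * (v i * (\<Sum>k<n. cnj (v k) * M $$ (k, j)))) has_vector_derivative
      \<i> * (v i * (\<Sum>k<n. cnj (v k) * M $$ (k, j)))) (at 0)"
    unfolding cis_conv_exp
    by (auto intro!: derivative_eq_intros has_vector_derivative_real_field simp: field_simps)
  moreover have "(\<Sum>a<n. \<Sum>b<n. cnj (v a) * (if b = i then mpow M 1 a j else 0) * v b) =
      (\<Sum>a<n. \<Sum>b<n. if b = i then cnj (v a) * mpow M 1 a j * v b else 0)"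
    by (intro sum.cong) auto
  moreover have "\<dots> = v i * (\<Sum>k<n. cnj (v k) * M $$ (k, j))"
    using assms by (simp add: mpow_1[OF *(1)] sum_distrib_left algebra_simps)
  ultimately show "((\<lambda>t. mpow (flow n v t * M) 1 i j) has_vector_derivative
      \<i> * (\<Sum>a<n. \<Sum>b<n. cnj (v a) * (if b = i then mpow M 1 a j else 0) * v b)) (at 0)"
    unfolding eq by simp
next
  show "regular (\<lambda>M. if b = i then mpow M 1 a j else 0)" if "a < n" "b < n" for a b
    using assms that by (cases "b = i") (auto intro!: regular_mpow)
qed (use assms in \<open>auto intro!: regular_mpow\<close>)

lemma has_gradient_mpow:
  assumes "i < n" "j < n"
  shows "has_gradient (\<lambda>M. mpow M (int k) i j)
    (\<lambda>M a b. \<Sum>l<k. mpow M (int l) i b * mpow M (int k - int l) a j)"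
  using assms
proof (induction k arbitrary: i j)
  case 0
  show ?case by (rule has_gradient_cong[OF has_gradient_const[of "if i = j then 1 else 0"]]) (use 0 in \<open>auto simp: mpow_0\<close>)
next
  case (Suc k)
  have "has_gradient (\<lambda>M. \<Sum>c<n. mpow M (int k) i c * mpow M 1 c j)
      (\<lambda>M a b. \<Sum>c<n. (\<Sum>l<k. mpow M (int l) i b * mpow M (int k - int l) a c) * mpow M 1 c j
        + mpow M (int k) i c * (if b = c then mpow M 1 a j else 0))"
    by (intro has_gradient_sum has_gradient_mult Suc.IH has_gradient_entry) (use Suc.prems in auto)
  thus ?case
  proof (rule has_gradient_cong)
    fix M assume M: "M \<in> unitary_group n"
    show "(\<Sum>c<n. mpow M (int k) i c * mpow M 1 c j) = mpow M (int (Suc k)) i j"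
      using Suc.prems by (simp add: mpow_mult[OF M] add.commute)
    fix a b assume ab: "a < n" "b < n"
    have "(\<Sum>c<n. (\<Sum>l<k. mpow M (int l) i b * mpow M (int k - int l) a c) * mpow M 1 c j
        + mpow M (int k) i c * (if b = c then mpow M 1 a j else 0)) =
      (\<Sum>l<k. mpow M (int l) i b * (\<Sum>c<n. mpow M (int k - int l) a c * mpow M 1 c j))
        + mpow M (int k) i b * mpow M 1 a j"
      using ab by (simp add: sum.distrib sum_distrib_left sum_distrib_right sum.swap[of _ "{..<k}"] mult.assoc
          if_distrib[of "\<lambda>x. _ * x"] cong: if_cong)
    also have "\<dots> = (\<Sum>l<Suc k. mpow M (int l) i b * mpow M (int (Suc k) - int l) a j)"
      using ab Suc.prems by (simp add: mpow_mult[OF M]) (simp add: algebra_simps)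
    finally show "(\<Sum>c<n. (\<Sum>l<k. mpow M (int l) i b * mpow M (int k - int l) a c) * mpow M 1 c j
        + mpow M (int k) i c * (if b = c then mpow M 1 a j else 0)) =
        (\<Sum>l<Suc k. mpow M (int l) i b * mpow M (int (Suc k) - int l) a j)" .
  qed
qed

lemma has_gradient_ptrace_nat:
  "has_gradient (ptrace n (int k)) (\<lambda>M a b. of_nat k * mpow M (int k) a b)"
proof -
  have "has_gradient (\<lambda>M. \<Sum>i<n. mpow M (int k) i i)
     (\<lambda>M a b. \<Sum>i<n. \<Sum>l<k. mpow M (int l) i b * mpow M (int k - int l) a i)"
    by (intro has_gradient_sum has_gradient_mpow) auto
  thus ?thesis
  proof (rule has_gradient_cong)
    fix M a b assume M: "M \<in> unitary_group n" and ab: "a < n" "b < n"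
    have "(\<Sum>i<n. \<Sum>l<k. mpow M (int l) i b * mpow M (int k - int l) a i) =
       (\<Sum>l<k. \<Sum>i<n. mpow M (int k - int l) a i * mpow M (int l) i b)"
      by (subst sum.swap) (simp add: mult.commute)
    also have "\<dots> = of_nat k * mpow M (int k) a b"
      using ab by (simp add: mpow_mult[OF M])
    finally show "(\<Sum>i<n. \<Sum>l<k. mpow M (int l) i b * mpow M (int k - int l) a i) = of_nat k * mpow M (int k) a b" .
  qed (auto simp: ptrace_def)
qed

lemma has_gradient_ptrace:
  "has_gradient (ptrace n k) (\<lambda>M a b. of_int k * mpow M k a b)"
proof (cases "0 \<le> k")
  case True
  then show ?thesis using has_gradient_ptrace_nat[of "nat k"] by simp
next
  case False
  show ?thesis
    by (rule has_gradient_cong[OF has_gradient_cnj[OF has_gradient_ptrace_nat[of "nat (- k)"]]])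
      (use False in \<open>auto simp: ptrace_minus[symmetric] mpow_minus[symmetric]\<close>)
qed

lemma expectation_gradient_quadratic:
  assumes f: "has_gradient f K" and v: "(\<Sum>i<n. v i * cnj (v i)) = 1"
  shows "(LINT M|H. (\<Sum>a<n. \<Sum>b<n. cnj (v a) * K M a b * v b)) = 0"
proof -
  define D where "D = (\<lambda>M. \<i> * (\<Sum>a<n. \<Sum>b<n. cnj (v a) * K M a b * v b))"
  have regD: "regular D"
    unfolding D_def using has_gradientD(2)[OF f] by (auto intro!: regular_mult regular_sum)
  then obtain C where C: "\<And>M. M \<in> unitary_group n \<Longrightarrow> cmod (D M) \<le> C" unfolding regular_def by blast
  note fl = flow_unitary[OF v]
  have deriv: "((\<lambda>t. f (flow n v t * M)) has_vector_derivative D (flow n v t * M)) (at t)"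
    if M: "M \<in> unitary_group n" for M t
  proof -
    have "((\<lambda>s. f (flow n v s * (flow n v t * M))) has_vector_derivative D (flow n v t * M)) (at 0)"
      unfolding D_def by (rule has_gradientD(3)[OF f _ v]) (auto intro: unitary_group_mult fl M)
    moreover have "flow n v s * (flow n v t * M) = flow n v (s + t) * M" for s
      using unitary_groupD(1)[OF M] by (simp add: flow_add[OF v] assoc_mult_mat[of _ n n _ n _ n])
    ultimately have "((\<lambda>s. f (flow n v (s + t) * M)) has_vector_derivative D (flow n v t * M)) (at 0)" by simp
    hence "((\<lambda>s. f (flow n v s * M)) \<circ> (\<lambda>s. s + t) has_vector_derivative D (flow n v t * M)) (at (t - t))"
      by (simp add: o_def)
    hence "((\<lambda>s. f (flow n v s * M)) \<circ> (\<lambda>s. s + t) \<circ> (\<lambda>s. s - t) has_vector_derivative 1 *\<^sub>R D (flow n v t * M)) (at t)"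
      by (intro vector_diff_chain_at) (auto intro!: derivative_eq_intros)
    thus ?thesis by (simp add: o_def)
  qed
  have lip: "cmod (f (flow n v t * M) - f M) \<le> C * \<bar>t\<bar>" if M: "M \<in> unitary_group n" for M t
  proof -
    have "norm (f (flow n v t * M) - f (flow n v 0 * M)) \<le> C * norm (t - 0)"
    proof (rule differentiable_bound[of UNIV])
      fix s :: real
      show "((\<lambda>t. f (flow n v t * M)) has_derivative (\<lambda>x. x *\<^sub>R D (flow n v s * M))) (at s within UNIV)"
        using deriv[OF M, of s] by (simp add: has_vector_derivative_def)
      show "onorm (\<lambda>x. x *\<^sub>R D (flow n v s * M)) \<le> C"
        by (rule onorm_le) (use C[OF unitary_group_mult[OF fl[of s] M]] in \<open>auto simp: mult.commute[of C] intro: mult_left_mono\<close>)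
    qed auto
    thus ?thesis using M by (simp add: flow_0_mult)
  qed
  define t where "t = (\<lambda>k. 1 / real (Suc k))"
  define q where "q = (\<lambda>k M. (f (flow n v (t k) * M) - f M) / of_real (t k))"
  have fm: "f \<in> borel_measurable H" using has_gradientD(1)[OF f] by (simp add: regular_def)
  have fm2: "(\<lambda>M. f (flow n v s * M)) \<in> borel_measurable H" for s
    using measurable_compose[OF mult_left_measurable[OF fl] fm] .
  have "(\<lambda>k. LINT M|H. q k M) \<longlonglongrightarrow> (LINT M|H. D M)"
  proof (rule integral_dominated_convergence[where w = "\<lambda>_. C"])
    show "D \<in> borel_measurable H" using regD by (simp add: regular_def)
    show "q k \<in> borel_measurable H" for k unfolding q_def using fm fm2 by measurable
    show "AE M in H. (\<lambda>k. q k M) \<longlonglongrightarrow> D M"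
    proof (rule AE_I2)
      fix M assume "M \<in> space H"
      hence M: "M \<in> unitary_group n" by (simp add: space_H)
      have "((\<lambda>h. norm (f (flow n v (0 + h) * M) - f (flow n v 0 * M) - h *\<^sub>R D (flow n v 0 * M)) / norm h) \<longlongrightarrow> 0) (at 0)"
        using deriv[OF M, of 0] by (simp add: has_vector_derivative_def has_derivative_at)
      hence *: "((\<lambda>h. norm (f (flow n v h * M) - f M - h *\<^sub>R D M) / norm h) \<longlongrightarrow> 0) (at 0)"
        using M by (simp add: flow_0_mult)
      have "t \<longlonglongrightarrow> 0" unfolding t_def by real_asymp
      hence "filterlim t (at 0) sequentially" by (auto simp: filterlim_at t_def)
      from filterlim_compose[OF * this]
      have "(\<lambda>k. norm (f (flow n v (t k) * M) - f M - t k *\<^sub>R D M) / norm (t k)) \<longlonglongrightarrow> 0" .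
      moreover have "norm (f (flow n v (t k) * M) - f M - t k *\<^sub>R D M) / norm (t k) = norm (q k M - D M)" for k
      proof -
        have "t k \<noteq> 0" by (simp add: t_def)
        hence "q k M - D M = (f (flow n v (t k) * M) - f M - t k *\<^sub>R D M) / of_real (t k)"
          by (simp add: q_def scaleR_conv_of_real field_simps)
        thus ?thesis by (simp add: norm_divide)
      qed
      ultimately show "(\<lambda>k. q k M) \<longlonglongrightarrow> D M"
        by (simp add: LIM_zero_cancel tendsto_norm_zero_iff)
    qed
    show "AE M in H. norm (q k M) \<le> C" for k
    proof (rule AE_I2)
      fix M assume "M \<in> space H"
      from lip[OF this[unfolded space_H], of "t k"]
      have "cmod (f (flow n v (t k) * M) - f M) / t k \<le> C" by (simp add: t_def field_simps)
      thus "norm (q k M) \<le> C" by (simp add: q_def norm_divide norm_mult t_def del: of_nat_Suc)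
    qed
  qed auto
  moreover have "(LINT M|H. q k M) = 0" for k
  proof -
    have "regular (\<lambda>M. f (flow n v (t k) * M))"
      using fm2 has_gradientD(1)[OF f] unitary_group_mult[OF fl] unfolding regular_def by blast
    thus ?thesis unfolding q_def
      using has_gradientD(1)[OF f] integral_mult_left[OF fl fm] by (simp add: regular_integrable)
  qed
  ultimately have "(LINT M|H. D M) = 0" by (simp add: LIMSEQ_const_iff)
  thus ?thesis by (simp add: D_def)
qed

lemma expectation_gradient:
  assumes f: "has_gradient f K" and ab: "a < n" "b < n"
  shows "(LINT M|H. K M a b) = 0"
proof -
  define E where "E = (\<lambda>a b. LINT M|H. K M a b)"
  have quad: "(\<Sum>a<n. \<Sum>b<n. cnj (v a) * E a b * v b) = 0" if "(\<Sum>i<n. v i * cnj (v i)) = 1" for v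
  proof -
    have "(LINT M|H. (\<Sum>a<n. \<Sum>b<n. cnj (v a) * K M a b * v b)) =
       (\<Sum>a<n. \<Sum>b<n. cnj (v a) * E a b * v b)"
      unfolding E_def
      by (subst expectation_sum, fastforce intro: has_gradientD(2)[OF f],
        intro sum.cong refl, subst expectation_sum, fastforce intro: has_gradientD(2)[OF f]) simp
    thus ?thesis using expectation_gradient_quadratic[OF f that] by simp
  qed
  have diag: "E c c = 0" if "c < n" for c
    using quad[of "\<lambda>i. if i = c then 1 else 0"] that
    by (simp add: if_distrib[of cnj] if_distrib[of "\<lambda>x. _ * x"] if_distrib[of "\<lambda>x. x * _"] cong: if_cong)
  show ?thesis
  proof (cases "a = b")
    case True
    then show ?thesis using diag ab by (simp add: E_def)
  next
    case False
    have pol: "w * E a b + cnj w * E b a = 0" if w: "w * cnj w = 1" for w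
    proof -
      define r where "r = complex_of_real (1 / sqrt 2)"
      have r: "r * r = 1 / 2" "cnj r = r" by (simp_all add: r_def flip: of_real_mult)
      define v where "v = (\<lambda>i. if i = a then r else if i = b then r * w else 0)"
      have two: "(\<Sum>i<n. g i) = g a + g b" if "\<And>i. i \<noteq> a \<Longrightarrow> i \<noteq> b \<Longrightarrow> g i = 0" for g :: "nat \<Rightarrow> complex"
      proof -
        have "(\<Sum>i<n. g i) = (\<Sum>i\<in>{a, b}. g i)"
          using ab that by (intro sum.mono_neutral_right) auto
        thus ?thesis using False by simp
      qed
      have "(\<Sum>i<n. v i * cnj (v i)) = 1"
        using False w r by (subst two) (auto simp: v_def algebra_simps)
      from quad[OF this] have "r * r * (E a a + E b b * (w * cnj w) + w * E a b + cnj w * E b a) = 0"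
        using False r by (simp add: two v_def algebra_simps)
      thus ?thesis using diag ab r by simp
    qed
    from pol[of 1] pol[of \<i>] have "E a b + E b a = 0" "E a b - E b a = 0"
      by (auto simp: algebra_simps)
    hence "E a b = 0" by (simp add: eq_neg_iff_add_eq_0[symmetric])
    thus ?thesis by (simp add: E_def)
  qed
qed

lemma expectation_divergence:
  assumes "\<And>i j. i < n \<Longrightarrow> j < n \<Longrightarrow> has_gradient (V i j) (K i j)"
  shows "(LINT M|H. (\<Sum>i<n. \<Sum>j<n. K i j M j i)) = 0"
proof -
  have "(LINT M|H. (\<Sum>i<n. \<Sum>j<n. K i j M j i)) = (\<Sum>i<n. \<Sum>j<n. LINT M|H. K i j M j i)"
    by (subst expectation_sum, fastforce intro: has_gradientD(2)[OF assms],
        intro sum.cong refl, subst expectation_sum, fastforce intro: has_gradientD(2)[OF assms]) simp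
  also have "\<dots> = 0"
    by (intro sum.neutral ballI expectation_gradient[OF assms]) auto
  finally show ?thesis .
qed

text \<open>The trace of the gradient is the derivative along the centre of the group.\<close>

lemma expectation_homogeneous:
  assumes "has_gradient f K" "d \<noteq> 0"
    and "\<And>M. M \<in> unitary_group n \<Longrightarrow> (\<Sum>c<n. K M c c) = d * f M"
  shows "(LINT M|H. f M) = 0"
proof -
  have "d * (LINT M|H. f M) = (LINT M|H. (\<Sum>c<n. K M c c))"
    unfolding integral_mult_right_zero[symmetric]
    by (intro Bochner_Integration.integral_cong) (auto simp: space_H assms(3))
  also have "\<dots> = (\<Sum>c<n. LINT M|H. K M c c)"
    using has_gradientD(2)[OF assms(1)] by (intro Bochner_Integration.integral_sum regular_integrable) auto
  also have "\<dots> = 0" by (intro sum.neutral ballI expectation_gradient[OF assms(1)]) auto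
  finally show ?thesis using assms(2) by simp
qed

definition qtrace :: "nat \<Rightarrow> complex mat \<Rightarrow> complex" where
  "qtrace k M = (\<Sum>l=1..<k. ptrace n (int l) M * ptrace n (int k - int l) M)"

lemma regular_qtrace [intro]: "regular (qtrace k)"
  unfolding qtrace_def[abs_def] by (intro regular_sum regular_mult regular_ptrace)

lemma mpow_divergence:
  assumes M: "M \<in> unitary_group n" and "0 < k"
  shows "(\<Sum>i<n. \<Sum>j<n. \<Sum>l<k. mpow M (int l) i i * mpow M (int k - int l) j j) =
    of_nat n * ptrace n (int k) M + qtrace k M"
proof -
  have "(\<Sum>i<n. \<Sum>j<n. \<Sum>l<k. mpow M (int l) i i * mpow M (int k - int l) j j) =
      (\<Sum>i<n. \<Sum>l<k. \<Sum>j<n. mpow M (int l) i i * mpow M (int k - int l) j j)"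
    by (intro sum.cong refl sum.swap)
  also have "\<dots> = (\<Sum>l<k. \<Sum>i<n. \<Sum>j<n. mpow M (int l) i i * mpow M (int k - int l) j j)"
    by (rule sum.swap)
  also have "\<dots> = (\<Sum>l<k. ptrace n (int l) M * ptrace n (int k - int l) M)"
    unfolding ptrace_def sum_product ..
  also have "\<dots> = (\<Sum>l\<in>insert 0 {1..<k}. ptrace n (int l) M * ptrace n (int k - int l) M)"
    by (rule sum.cong) (use assms(2) in auto)
  also have "\<dots> = of_nat n * ptrace n (int k) M + qtrace k M"
    by (simp add: ptrace_0[OF M] qtrace_def)
  finally show ?thesis .
qed

lemma loop_equation:
  assumes G: "has_gradient G K" and k: "0 < k"
  shows "(LINT M|H. (of_nat n * ptrace n (int k) M + qtrace k M) * G M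
    + (\<Sum>i<n. \<Sum>j<n. mpow M (int k) i j * K M j i)) = 0"
proof -
  have "0 = (LINT M|H. (\<Sum>i<n. \<Sum>j<n. (\<Sum>l<k. mpow M (int l) i i * mpow M (int k - int l) j j) * G M
      + mpow M (int k) i j * K M j i))"
    by (rule expectation_divergence[symmetric, OF has_gradient_mult[OF has_gradient_mpow G]])
  also have "\<dots> = (LINT M|H. (of_nat n * ptrace n (int k) M + qtrace k M) * G M
    + (\<Sum>i<n. \<Sum>j<n. mpow M (int k) i j * K M j i))"
    by (intro Bochner_Integration.integral_cong)
      (auto simp: space_H sum.distrib mpow_divergence[OF _ k] simp flip: sum_distrib_right)
  finally show ?thesis by simp
qed

end

section \<open>Hall-Littlewood polynomials and the variance of the power traces\<close>

hide_const (open) Module.smult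
unbundle fps_syntax
no_notation vec_index (infixl "$" 100)
no_notation vec_nth (infixl "$" 90)

lemma char_poly_factors:
  assumes "(A :: complex mat) \<in> carrier_mat n n"
  obtains z where "char_poly A = (\<Prod>j<n. [:- z j, 1:])"
proof -
  obtain es where es: "char_poly A = (\<Prod>a\<leftarrow>es. [:- a, 1:])" "length es = n"
    using char_poly_factorized[OF assms] by blast
  have "(\<Prod>a\<leftarrow>es. [:- a, 1:]) = (\<Prod>j<n. [:- (es ! j), 1:])"
    using es(2) by (simp add: prod.list_conv_set_nth atLeast0LessThan)
  thus ?thesis using es that by metis
qed

lemma upper_triangular_pow:
  fixes B :: "complex mat"
  assumes B: "B \<in> carrier_mat n n" "upper_triangular B"
  shows "upper_triangular (B ^\<^sub>m k) \<and> (\<forall>i<n. (B ^\<^sub>m k) $$ (i, i) = (B $$ (i, i)) ^ k)"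
proof (induction k)
  case 0
  then show ?case using B by auto
next
  case (Suc k)
  have c: "B ^\<^sub>m k \<in> carrier_mat n n" using B by simp
  have e: "(B ^\<^sub>m k * B) $$ (i, j) = (\<Sum>l<n. (B ^\<^sub>m k) $$ (i, l) * B $$ (l, j))" if "i < n" "j < n" for i j
    by (rule mult_index_sum[OF c B(1) that])
  have z: "(B ^\<^sub>m k) $$ (i, l) = 0" "B $$ (i, l) = 0" if "l < i" "i < n" for i l
    using that Suc B c by auto
  have "(B ^\<^sub>m k * B) $$ (i, j) = 0" if "j < i" "i < n" for i j
    using that by (subst e) (auto intro!: sum.neutral, metis linorder_neqE_nat z(1) z(2) order.strict_trans)
  moreover have "(B ^\<^sub>m k * B) $$ (i, i) = (B $$ (i, i)) ^ Suc k" if "i < n" for i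
  proof -
    have "(B ^\<^sub>m k * B) $$ (i, i) = (\<Sum>l\<in>{i}. (B ^\<^sub>m k) $$ (i, l) * B $$ (l, i))"
      unfolding e[OF that that]
      by (rule sum.mono_neutral_right) (use that z in \<open>auto, metis linorder_neqE_nat z\<close>)
    thus ?thesis using Suc that by (simp add: mult.commute)
  qed
  ultimately show ?case using B c by auto
qed

lemma trace_mult_comm:
  assumes "A \<in> carrier_mat n n" "(B :: complex mat) \<in> carrier_mat n n"
  shows "(\<Sum>i<n. (A * B) $$ (i, i)) = (\<Sum>i<n. (B * A) $$ (i, i))"
proof -
  have "(\<Sum>i<n. (A * B) $$ (i, i)) = (\<Sum>i<n. \<Sum>k<n. A $$ (i, k) * B $$ (k, i))"
    by (intro sum.cong refl mult_index_sum[OF assms]) auto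
  also have "\<dots> = (\<Sum>k<n. \<Sum>i<n. B $$ (k, i) * A $$ (i, k))"
    by (subst sum.swap) (simp add: mult.commute)
  also have "\<dots> = (\<Sum>i<n. (B * A) $$ (i, i))"
    by (intro sum.cong refl mult_index_sum[OF assms(2,1), symmetric]) auto
  finally show ?thesis .
qed

lemma trace_pow_eigenvalues:
  assumes A: "A \<in> carrier_mat n n" and cp: "char_poly A = (\<Prod>j<n. [:- z j, 1:])"
  shows "(\<Sum>i<n. (A ^\<^sub>m k) $$ (i, i)) = (\<Sum>j<n. z j ^ k :: complex)"
proof -
  define es where "es = map z [0..<n]"
  have "char_poly A = (\<Prod>e\<leftarrow>es. [:- e, 1:])"
    unfolding cp es_def by (simp add: prod.list_conv_set_nth atLeast0LessThan)
  moreover obtain B P Q where "schur_decomposition A es = (B, P, Q)" by (metis prod_cases3)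
  ultimately have w: "similar_mat_wit A B P Q" and u: "upper_triangular B" and d: "diag_mat B = es"
    using schur_decomposition[OF A] by blast+
  from similar_mat_witD2[OF A w] have
    PQ: "Q * P = 1\<^sub>m n" and c: "B \<in> carrier_mat n n" "P \<in> carrier_mat n n" "Q \<in> carrier_mat n n" by auto
  have Bk: "B ^\<^sub>m k \<in> carrier_mat n n" using c by simp
  have diag: "B $$ (j, j) = z j" if "j < n" for j
  proof -
    have "diag_mat B ! j = es ! j" using d by simp
    thus ?thesis using that c by (simp add: diag_mat_def es_def)
  qed
  have "(\<Sum>i<n. (A ^\<^sub>m k) $$ (i, i)) = (\<Sum>i<n. (P * (B ^\<^sub>m k * Q)) $$ (i, i))"
    using similar_mat_wit_pow_id[OF w, of k] c Bk by (simp add: assoc_mult_mat[of _ n n _ n _ n])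
  also have "\<dots> = (\<Sum>i<n. (B ^\<^sub>m k * Q * P) $$ (i, i))"
    using c Bk by (intro trace_mult_comm) auto
  also have "B ^\<^sub>m k * Q * P = B ^\<^sub>m k"
    using c Bk PQ by (simp add: assoc_mult_mat[of _ n n _ n _ n] right_mult_one_mat[of _ n n])
  also have "(\<Sum>i<n. (B ^\<^sub>m k) $$ (i, i)) = (\<Sum>j<n. z j ^ k)"
    using upper_triangular_pow[OF c(1) u, of k] diag by simp
  finally show ?thesis .
qed

lemma ptrace_eigenvalues:
  assumes "M \<in> unitary_group n" "char_poly M = (\<Prod>j<n. [:- z j, 1:])"
  shows "ptrace n (int k) M = (\<Sum>j<n. z j ^ k)"
  using trace_pow_eigenvalues[OF unitary_groupD(1)[OF assms(1)] assms(2), of k]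
  by (simp add: ptrace_def mpow_def int_pow_mat_def)

text \<open>With \<open>p\<close> the power sums of \<open>z\<close>, \<open>hl p k\<close> is the coefficient of \<open>x ^ k\<close> in
  \<open>\<Prod>\<^sub>j (1 - t * z\<^sub>j * x) / (1 - z\<^sub>j * x)\<close>, a polynomial in \<open>t\<close>: the one-row Hall-Littlewood polynomial.\<close>

fun hl :: "(nat \<Rightarrow> complex) \<Rightarrow> nat \<Rightarrow> complex poly" where
  "hl p k = (if k = 0 then 1 else
     smult (1 / of_nat k) (\<Sum>m\<in>{1..k}. smult (p m) (1 - monom 1 m) * hl p (k - m)))"

declare hl.simps [simp del]

lemma hl_0 [simp]: "hl p 0 = 1" by (subst hl.simps) simp

lemma hl_rec: "of_nat k * hl p k = (\<Sum>m\<in>{1..k}. smult (p m) (1 - monom 1 m) * hl p (k - m))"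
  if "0 < k"
proof -
  have e: "of_nat k * q = smult (of_nat k) q" for q :: "complex poly" by (simp add: of_nat_poly)
  have "hl p k = smult (1 / of_nat k) (\<Sum>m\<in>{1..k}. smult (p m) (1 - monom 1 m) * hl p (k - m))"
    using that by (subst hl.simps) simp
  thus ?thesis using that unfolding e by simp
qed

lemma degree_hl_le: "degree (hl p k) \<le> k"
proof (induction k rule: less_induct)
  case (less k)
  show ?case
  proof (cases "k = 0")
    case False
    have "degree (smult (p m) (1 - monom 1 m) * hl p (k - m)) \<le> k" if m: "m \<in> {1..k}" for m
    proof -
      have "degree (1 - monom (1::complex) m) \<le> m"
        by (rule degree_diff_le) (auto intro: degree_monom_le)
      hence "degree (smult (p m) (1 - monom 1 m)) \<le> m" using degree_smult_le order_trans by blast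
      moreover have "degree (hl p (k - m)) \<le> k - m" using m by (intro less) auto
      ultimately have "degree (smult (p m) (1 - monom 1 m) * hl p (k - m)) \<le> m + (k - m)"
        by (intro order_trans[OF degree_mult_le add_le_mono])
      thus ?thesis using m by simp
    qed
    hence "degree (\<Sum>m\<in>{1..k}. smult (p m) (1 - monom 1 m) * hl p (k - m)) \<le> k"
      by (intro degree_sum_le) auto
    thus ?thesis
      by (subst hl.simps, subst if_not_P[OF False]) (rule order_trans[OF degree_smult_le])
  qed simp
qed

lemma fps_ode_unique:
  fixes f g :: "complex poly fps"
  assumes "fps_X * fps_deriv f = A + W * f" "fps_X * fps_deriv g = A + W * g"
    and "W $ 0 = 0" "f $ 0 = g $ 0"
  shows "f = g"
proof -
  define h where "h = f - g"
  have h: "fps_X * fps_deriv h = W * h" "h $ 0 = 0"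
    using assms by (auto simp: h_def algebra_simps)
  have "h $ k = 0" for k
  proof (induction k rule: less_induct)
    case (less k)
    show ?case
    proof (cases k)
      case 0 thus ?thesis using h by simp
    next
      case (Suc m)
      have "(fps_X * fps_deriv h) $ k = of_nat k * h $ k" using Suc by simp
      moreover have "(W * h) $ k = (\<Sum>i=0..k. W $ i * h $ (k - i))" by (simp add: fps_mult_nth)
      moreover have "\<dots> = 0"
      proof (intro sum.neutral ballI)
        fix i assume "i \<in> {0..k}"
        show "W $ i * h $ (k - i) = 0"
          using assms(3) less[of "k - i"] Suc by (cases "i = 0") auto
      qed
      ultimately have "of_nat k * h $ k = 0" using h by simp
      moreover have "(of_nat k :: complex poly) \<noteq> 0" using Suc by (simp del: of_nat_Suc)
      ultimately show ?thesis by simp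
    qed
  qed
  hence "h = 0" by (simp add: fps_eq_iff)
  thus ?thesis by (simp add: h_def)
qed

definition hlW :: "(nat \<Rightarrow> complex) \<Rightarrow> complex poly fps" where
  "hlW p = Abs_fps (\<lambda>m. if m = 0 then 0 else smult (p m) (1 - monom 1 m))"

lemma hl_ode: "fps_X * fps_deriv (Abs_fps (hl p)) = hlW p * Abs_fps (hl p)"
proof (rule fps_ext)
  fix k
  show "(fps_X * fps_deriv (Abs_fps (hl p))) $ k = (hlW p * Abs_fps (hl p)) $ k"
  proof (cases "k = 0")
    case True
    then show ?thesis by (simp add: hlW_def)
  next
    case False
    have "(hlW p * Abs_fps (hl p)) $ k = (\<Sum>m=0..k. hlW p $ m * hl p (k - m))"
      by (simp add: fps_mult_nth)
    also have "\<dots> = (\<Sum>m\<in>{1..k}. hlW p $ m * hl p (k - m))"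
      by (rule sum.mono_neutral_right) (auto simp: hlW_def)
    also have "\<dots> = of_nat k * hl p k"
      unfolding hl_rec[OF False[unfolded neq0_conv]] by (intro sum.cong refl) (auto simp: hlW_def)
    finally show ?thesis using False by simp
  qed
qed

lemma sum_powers_upto: "(1 - x) * (\<Sum>m=1..<Suc N. x ^ m) = x - x ^ Suc N" for x :: "'a :: comm_ring_1"
proof (induction N)
  case (Suc N)
  have "(1 - x) * (\<Sum>m=1..<Suc (Suc N). x ^ m) = (1 - x) * (\<Sum>m=1..<Suc N. x ^ m) + (1 - x) * x ^ Suc N"
    unfolding distrib_left[symmetric] by (intro arg_cong[where f = "\<lambda>y. (1 - x) * y"] sum.atLeastLessThan_Suc) simp
  also have "\<dots> = x - x ^ Suc (Suc N)" unfolding Suc by (simp add: algebra_simps)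
  finally show ?case .
qed simp

lemma degree_hl_le_n:
  assumes p: "\<And>m. p m = (\<Sum>j<n. z j ^ m)"
  shows "degree (hl p k) \<le> n"
proof -
  define f :: "complex \<Rightarrow> complex poly fps" where
    "f = (\<lambda>z. Abs_fps (\<lambda>k. if k = 0 then 1 else smult (z ^ k) (1 - monom 1 1)))"
  define w :: "complex \<Rightarrow> complex poly fps" where
    "w = (\<lambda>z. Abs_fps (\<lambda>m. if m = 0 then 0 else smult (z ^ m) (1 - monom 1 m)))"
  have f: "fps_X * fps_deriv (f z) = w z * f z" for z
  proof (rule fps_ext)
    fix k
    show "(fps_X * fps_deriv (f z)) $ k = (w z * f z) $ k"
    proof (cases "k = 0")
      case True
      then show ?thesis by (simp add: w_def)
    next
      case False
      define t where "t = (monom 1 1 :: complex poly)"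
      have mt: "monom 1 m = t ^ m" for m by (simp add: t_def monom_power)
      have "(w z * f z) $ k = (\<Sum>m=0..k. w z $ m * f z $ (k - m))" by (simp add: fps_mult_nth)
      also have "\<dots> = (\<Sum>m\<in>insert k {1..<k}. w z $ m * f z $ (k - m))"
        by (rule sum.mono_neutral_right) (use False in \<open>auto simp: w_def\<close>)
      also have "\<dots> = smult (z ^ k) (1 - t ^ k) + (\<Sum>m=1..<k. smult (z ^ k) ((1 - t ^ m) * (1 - t)))"
      proof -
        have nth: "w z $ m = smult (z ^ m) (1 - t ^ m)" "f z $ m = smult (z ^ m) (1 - t)" if "0 < m" for m
          using that by (simp_all add: w_def f_def mt[of m]) (simp add: t_def)
        have "w z $ m * f z $ (k - m) = smult (z ^ k) ((1 - t ^ m) * (1 - t))" if m: "m \<in> {1..<k}" for m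
        proof -
          have "z ^ m * z ^ (k - m) = z ^ k" using m by (simp flip: power_add)
          thus ?thesis using m by (simp add: nth mult.commute[of "z ^ (k - m)"])
        qed
        moreover have "w z $ k * f z $ (k - k) = smult (z ^ k) (1 - t ^ k)"
          using False nth(1)[of k] by (simp add: f_def)
        ultimately show ?thesis
          by (subst sum.insert) (auto intro!: sum.cong)
      qed
      also have "\<dots> = smult (z ^ k) ((1 - t ^ k) + (1 - t) * (\<Sum>m=1..<k. 1 - t ^ m))"
        unfolding smult_add_right sum_distrib_left smult_sum2 by (simp only: mult.commute)
      also have "(1 - t) * (\<Sum>m=1..<k. 1 - t ^ m) = (1 - t) * (of_nat (k - 1)) - (t - t ^ k)"
        using False sum_powers_upto[of t "k - 1"] by (simp add: sum_subtractf right_diff_distrib)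
      also have "(1 - t ^ k) + ((1 - t) * (of_nat (k - 1)) - (t - t ^ k)) = of_nat k * (1 - t)"
      proof -
        define c where "c = (of_nat (k - 1) :: complex poly)"
        have "of_nat k = c + 1" using False unfolding c_def by (cases k) simp_all
        thus ?thesis unfolding c_def[symmetric] by (simp only:) (simp add: algebra_simps)
      qed
      finally show ?thesis using False by (simp add: f_def t_def)
    qed
  qed
  define F where "F = (\<lambda>r. \<Prod>j<r. f (z j))"
  have F: "fps_X * fps_deriv (F r) = (\<Sum>j<r. w (z j)) * F r" for r
  proof (induction r)
    case (Suc r)
    have "fps_X * fps_deriv (F (Suc r)) = (fps_X * fps_deriv (F r)) * f (z r) + F r * (fps_X * fps_deriv (f (z r)))"
      by (simp add: F_def algebra_simps)
    also have "\<dots> = (\<Sum>j<Suc r. w (z j)) * F (Suc r)"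
      unfolding Suc f by (simp add: F_def algebra_simps)
    finally show ?case .
  qed (simp add: F_def)
  have F0: "F r $ 0 = 1" for r by (induction r) (simp_all add: F_def f_def)
  have "(\<Sum>j<n. w (z j)) = hlW p"
  proof (rule fps_ext)
    fix m
    show "(\<Sum>j<n. w (z j)) $ m = hlW p $ m"
      unfolding fps_sum_nth w_def hlW_def p by (simp add: smult_sum)
  qed
  hence FW: "fps_X * fps_deriv (F n) = 0 + hlW p * F n" using F[of n] by (simp only: add_0)
  have "fps_X * fps_deriv (Abs_fps (hl p)) = 0 + hlW p * Abs_fps (hl p)" by (simp only: add_0 hl_ode)
  hence "Abs_fps (hl p) = F n"
    by (rule fps_ode_unique[OF _ FW]) (simp_all only: F0 hlW_def fps_nth_Abs_fps hl_0 if_True simp_thms)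
  moreover have "degree (F r $ k) \<le> r" for r k
  proof (induction r arbitrary: k)
    case 0
    then show ?case by (simp add: F_def)
  next
    case (Suc r)
    have "degree (f (z r) $ i) \<le> 1" for i
    proof -
      have "degree (1 - monom (1 :: complex) 1) \<le> 1"
        by (rule degree_diff_le) (simp_all add: degree_monom_le)
      hence "degree (smult (z r ^ i) (1 - monom 1 1)) \<le> 1"
        by (rule order_trans[OF degree_smult_le])
      thus ?thesis by (cases "i = 0") (simp_all add: f_def)
    qed
    hence "degree (F r $ i * f (z r) $ (k - i)) \<le> r + 1" for i
      by (intro order_trans[OF degree_mult_le add_le_mono] Suc)
    hence "degree (\<Sum>i=0..k. F r $ i * f (z r) $ (k - i)) \<le> r + 1"
      by (intro degree_sum_le) auto
    thus ?case by (simp add: F_def fps_mult_nth)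
  qed
  ultimately have "degree (Abs_fps (hl p) $ k) \<le> n" by simp
  thus ?thesis by simp
qed

definition coeff_deriv :: "complex poly fps \<Rightarrow> complex poly fps" where
  "coeff_deriv f = Abs_fps (\<lambda>k. pderiv (f $ k))"

lemma pderiv_of_nat_mult: "pderiv (of_nat k * p) = of_nat k * pderiv (p :: complex poly)"
  by (simp add: pderiv_mult)

lemma coeff_deriv_mult: "coeff_deriv (f * g) = coeff_deriv f * g + f * coeff_deriv g"
proof (rule fps_ext)
  fix k
  have "coeff_deriv (f * g) $ k = (\<Sum>i=0..k. pderiv (f $ i * g $ (k - i)))"
    by (simp add: coeff_deriv_def fps_mult_nth higher_pderiv_sum[of 1, simplified])
  also have "\<dots> = (\<Sum>i=0..k. pderiv (f $ i) * g $ (k - i) + f $ i * pderiv (g $ (k - i)))"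
    by (simp add: pderiv_mult add.commute mult.commute)
  also have "\<dots> = (coeff_deriv f * g + f * coeff_deriv g) $ k"
    by (simp add: coeff_deriv_def fps_mult_nth sum.distrib)
  finally show "coeff_deriv (f * g) $ k = (coeff_deriv f * g + f * coeff_deriv g) $ k" .
qed

lemma coeff_deriv_X_deriv: "coeff_deriv (fps_X * fps_deriv f) = fps_X * fps_deriv (coeff_deriv f)"
  by (rule fps_ext) (simp add: coeff_deriv_def pderiv_of_nat_mult pderiv_mult)

context
  fixes p :: "nat \<Rightarrow> complex"
begin

private abbreviation (input) "B \<equiv> Abs_fps (hl p)"
private abbreviation (input) "t \<equiv> fps_const (monom 1 1 :: complex poly)"
private definition "U = Abs_fps (\<lambda>m. if m = 0 then 0 else [:p m:])"
private definition "V = Abs_fps (\<lambda>m. if m = 0 then 0 else monom (p m) m)"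

private lemma W_eq: "hlW p = U - V"
  by (rule fps_ext) (auto simp: hlW_def U_def V_def smult_diff_right smult_monom one_pCons)

private lemma hl_deriv: "t * coeff_deriv B = - V * B"
proof (rule fps_ode_unique)
  have tV: "t * coeff_deriv V = fps_X * fps_deriv V"
  proof (rule fps_ext)
    fix m
    show "(t * coeff_deriv V) $ m = (fps_X * fps_deriv V) $ m"
    proof (cases m)
      case (Suc k)
      have "monom 1 1 * pderiv (monom (p m) m) = of_nat m * monom (p m) m"
        using Suc by (simp add: pderiv_monom mult_monom of_nat_poly smult_monom mult.commute)
      then show ?thesis using Suc by (simp add: V_def coeff_deriv_def)
    qed (simp add: V_def coeff_deriv_def)
  qed
  have U0: "coeff_deriv U = 0" by (rule fps_ext) (simp add: U_def coeff_deriv_def pderiv_pCons)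
  have dif: "coeff_deriv (f - g) = coeff_deriv f - coeff_deriv g" for f g
    by (rule fps_ext) (simp add: coeff_deriv_def pderiv_diff)
  have ode: "fps_X * fps_deriv B = (U - V) * B" using hl_ode[of p] by (simp add: W_eq)
  have "fps_X * fps_deriv (coeff_deriv B) = coeff_deriv ((U - V) * B)"
    using coeff_deriv_X_deriv[of B] ode by simp
  also have "\<dots> = - coeff_deriv V * B + (U - V) * coeff_deriv B"
    by (simp add: coeff_deriv_mult dif U0)
  finally have e: "fps_X * fps_deriv (coeff_deriv B) = - coeff_deriv V * B + (U - V) * coeff_deriv B" .
  have "fps_X * fps_deriv (t * coeff_deriv B) = t * (fps_X * fps_deriv (coeff_deriv B))"
    by (simp add: mult.left_commute)
  also have "\<dots> = - (t * coeff_deriv V) * B + (U - V) * (t * coeff_deriv B)"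
    unfolding e by (simp add: algebra_simps)
  finally show "fps_X * fps_deriv (t * coeff_deriv B) = - (fps_X * fps_deriv V) * B + (U - V) * (t * coeff_deriv B)"
    unfolding tV .
  have "fps_X * fps_deriv (- V * B) = - (fps_X * fps_deriv V) * B - V * (fps_X * fps_deriv B)"
    by (simp add: algebra_simps)
  also have "\<dots> = - (fps_X * fps_deriv V) * B + (U - V) * (- V * B)"
    unfolding ode by (simp add: algebra_simps)
  finally show "fps_X * fps_deriv (- V * B) = - (fps_X * fps_deriv V) * B + (U - V) * (- V * B)" .
qed (simp_all add: U_def V_def coeff_deriv_def)

private definition "cN = (\<lambda>N. \<Sum>m=1..<N. (1 - monom 1 m) * (1 - monom 1 (N - m)) :: complex poly)"

private lemma cN_eq: "(1 - monom 1 1) * cN (Suc N) =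
    (1 - monom 1 1) * (of_nat N * (1 + monom 1 (Suc N))) - 2 * (monom 1 1 - monom 1 (Suc N))"
proof -
  define t where "t = (monom 1 1 :: complex poly)"
  have mt: "monom 1 m = t ^ m" for m by (simp add: t_def monom_power)
  have "cN (Suc N) = (\<Sum>m=1..<Suc N. 1 + t ^ Suc N - t ^ m - t ^ (Suc N - m))"
    unfolding cN_def mt
  proof (intro sum.cong refl)
    fix m assume "m \<in> {1..<Suc N}"
    hence "t ^ Suc N = t ^ m * t ^ (Suc N - m)" by (simp del: power_Suc flip: power_add)
    moreover have "(1 - a) * (1 - b) = 1 + a * b - a - b" for a b :: "complex poly"
      by (simp add: algebra_simps)
    ultimately show "(1 - t ^ m) * (1 - t ^ (Suc N - m)) = 1 + t ^ Suc N - t ^ m - t ^ (Suc N - m)"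
      by (simp only:)
  qed
  also have "\<dots> = of_nat N * (1 + t ^ Suc N) - (\<Sum>m=1..<Suc N. t ^ m) - (\<Sum>m=1..<Suc N. t ^ (Suc N - m))"
    by (simp add: sum_subtractf)
  also have "(\<Sum>m=1..<Suc N. t ^ (Suc N - m)) = (\<Sum>m=1..<Suc N. t ^ m)"
    by (rule sum.reindex_bij_witness[of _ "\<lambda>m. Suc N - m" "\<lambda>m. Suc N - m"]) auto
  finally have "cN (Suc N) = of_nat N * (1 + t ^ Suc N) - 2 * (\<Sum>m=1..<Suc N. t ^ m)" by simp
  thus ?thesis
    using sum_powers_upto[of t N] unfolding mt power_one_right
    by (simp only: right_diff_distrib mult.left_commute[of "1 - t" 2])
qed

private definition "S = Abs_fps (\<lambda>N. smult (p N) (cN N))"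

private lemma S_eq: "(1 - t) * S = (1 - t) * (fps_X * fps_deriv (hlW p) - hlW p + 2 * (fps_X * fps_deriv V)) - 2 * t * hlW p"
proof (rule fps_ext)
  fix N
  let ?t = "monom 1 1 :: complex poly"
  have t1: "((1 - t) * f) $ k = (1 - ?t) * f $ k" for f k by (simp add: left_diff_distrib)
  have t2: "(2 * t * f) $ k = 2 * ?t * f $ k" for f k
    by (simp add: mult.assoc numeral_fps_const fps_mult_left_const_nth)
  have t3: "(2 * f) $ k = 2 * f $ k" for f :: "complex poly fps" and k
    by (simp add: numeral_fps_const)
  show "((1 - t) * S) $ N = ((1 - t) * (fps_X * fps_deriv (hlW p) - hlW p + 2 * (fps_X * fps_deriv V)) - 2 * t * hlW p) $ N"
  proof (cases N)
    case 0
    then show ?thesis by (simp add: t1 t2 t3 S_def hlW_def V_def cN_def fps_sub_nth)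
  next
    case (Suc M)
    define c T \<tau> m where "c = [:p N:]" and "T = (monom 1 N :: complex poly)"
      and "\<tau> = (monom 1 1 :: complex poly)" and "m = (of_nat M :: complex poly)"
    have W: "hlW p $ N = c * (1 - T)" and V: "V $ N = c * T" and SN: "S $ N = c * cN N"
      using Suc by (simp_all add: hlW_def V_def S_def c_def T_def smult_monom)
    have d: "(fps_X * fps_deriv f) $ N = (m + 1) * f $ N" for f :: "complex poly fps"
      using Suc by (simp add: m_def algebra_simps)
    have "((1 - t) * (fps_X * fps_deriv (hlW p) - hlW p + 2 * (fps_X * fps_deriv V)) - 2 * t * hlW p) $ N
      = (1 - \<tau>) * ((m + 1) * (c * (1 - T)) - c * (1 - T) + 2 * ((m + 1) * (c * T))) - 2 * \<tau> * (c * (1 - T))"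
      by (simp only: t1 t2 t3 d W V fps_sub_nth fps_add_nth \<tau>_def)
    also have "\<dots> = c * ((1 - \<tau>) * (m * (1 + T)) - 2 * (\<tau> - T))"
      by (simp add: algebra_simps)
    also have "\<dots> = c * ((1 - \<tau>) * cN N)"
      using cN_eq[of M] Suc by (simp only: \<tau>_def m_def T_def)
    also have "\<dots> = ((1 - t) * S) $ N"
      unfolding t1 SN \<tau>_def by (simp only: mult.left_commute)
    finally show ?thesis by (rule sym)
  qed
qed

lemma hl_second_order:
  "(1 - monom 1 1) * (\<Sum>m\<in>{1..k}. (1 - monom 1 m) * [:\<Sum>l=1..<m. p l * p (m - l):] * hl p (k - m))
   + (1 - monom 1 1) * (\<Sum>m\<in>{1..k}. smult (p m) (\<Sum>l=1..<m. (1 - monom 1 l) * (1 - monom 1 (m - l))) * hl p (k - m))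
   = (1 - monom 1 1) * (of_nat (k * (k - 1)) * hl p k)
     - 2 * (1 - monom 1 1) * of_nat k * monom 1 1 * pderiv (hl p k) - 2 * monom 1 1 * of_nat k * hl p k"
proof -
  let ?t = "monom 1 1 :: complex poly"
  let ?W = "hlW p"
  note ode = hl_ode[of p]
  have XX: "fps_X * fps_deriv (fps_X * fps_deriv f) = fps_X * fps_deriv f + fps_X ^ 2 * fps_deriv (fps_deriv f)"
    for f :: "complex poly fps" by (simp add: algebra_simps power2_eq_square)
  have a: "fps_X ^ 2 * fps_deriv (fps_deriv B) = (fps_X * fps_deriv ?W + ?W ^ 2 - ?W) * B"
  proof -
    have "fps_X ^ 2 * fps_deriv (fps_deriv B) = fps_X * fps_deriv (fps_X * fps_deriv B) - fps_X * fps_deriv B"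
      using XX[of B] by (simp only: add_diff_cancel_left')
    also have "\<dots> = fps_X * fps_deriv (?W * B) - ?W * B" unfolding ode ..
    also have "fps_X * fps_deriv (?W * B) = (fps_X * fps_deriv ?W) * B + ?W * (fps_X * fps_deriv B)"
      by (simp add: algebra_simps)
    also have "?W * (fps_X * fps_deriv B) = ?W * (?W * B)" unfolding ode ..
    finally show ?thesis by (simp add: algebra_simps power2_eq_square)
  qed
  have b: "fps_X * fps_deriv (t * coeff_deriv B) = - (fps_X * fps_deriv V) * B - V * ?W * B"
  proof -
    have "fps_X * fps_deriv (t * coeff_deriv B) = fps_X * fps_deriv (- V * B)" unfolding hl_deriv ..
    also have "\<dots> = - (fps_X * fps_deriv V) * B - V * (fps_X * fps_deriv B)"
      by (simp add: algebra_simps)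
    also have "V * (fps_X * fps_deriv B) = V * (?W * B)" unfolding ode ..
    finally show ?thesis by (simp only: mult.assoc)
  qed
  have UV: "U\<^sup>2 - V\<^sup>2 = ?W\<^sup>2 + 2 * V * ?W" by (simp add: W_eq power2_eq_square algebra_simps)
  have main: "(1 - t) * ((U\<^sup>2 - V\<^sup>2) * B) + (1 - t) * (S * B) =
     (1 - t) * (fps_X ^ 2 * fps_deriv (fps_deriv B)) - 2 * (1 - t) * (fps_X * fps_deriv (t * coeff_deriv B))
       - 2 * t * (fps_X * fps_deriv B)"
  proof -
    have gen: "(1 - u) * ((w\<^sup>2 + 2 * v * w) * b) + ((1 - u) * (dw - w + 2 * dv) - 2 * u * w) * b =
       (1 - u) * ((dw + w\<^sup>2 - w) * b) - 2 * (1 - u) * (- dv * b - v * w * b) - 2 * u * (w * b)"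
      for u w v dw dv b :: "complex poly fps"
      by (simp add: algebra_simps power2_eq_square)
    have SB: "(1 - t) * (S * B) = ((1 - t) * S) * B" by (simp only: mult.assoc)
    show ?thesis unfolding a b ode UV SB unfolding S_eq by (rule gen)
  qed
  have t1: "((1 - t) * f) $ k = (1 - ?t) * f $ k" for f k by (simp add: left_diff_distrib)
  have t2: "(2 * t * f) $ k = 2 * ?t * f $ k" for f k
    by (simp add: mult.assoc numeral_fps_const fps_mult_left_const_nth)
  have t4: "(2 * (1 - t) * f) $ k = 2 * (1 - ?t) * f $ k" for f k
    unfolding mult.assoc numeral_fps_const fps_mult_left_const_nth t1 by (rule refl)
  have UV0: "(U\<^sup>2 - V\<^sup>2) $ m = (1 - monom 1 m) * [:\<Sum>l=1..<m. p l * p (m - l):]" for m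
  proof -
    have sq: "(f\<^sup>2) $ m = (\<Sum>l=1..<m. f $ l * f $ (m - l))" if "f $ 0 = 0" for f :: "complex poly fps"
      unfolding power2_eq_square fps_mult_nth
      by (rule sum.mono_neutral_right) (use that in \<open>auto simp: not_less Suc_le_eq\<close>)
    have "(U\<^sup>2) $ m = (\<Sum>l=1..<m. [:p l * p (m - l):])"
      by (subst sq) (auto simp: U_def intro!: sum.cong)
    moreover have "(V\<^sup>2) $ m = (\<Sum>l=1..<m. monom 1 m * [:p l * p (m - l):])"
      by (subst sq) (auto simp: V_def mult_monom smult_monom intro!: sum.cong)
    moreover have "[:\<Sum>l=1..<m. p l * p (m - l):] = (\<Sum>l=1..<m. [:p l * p (m - l):])"
      by (rule sum_to_poly[symmetric])
    ultimately show ?thesis by (simp only: left_diff_distrib sum_distrib_left fps_sub_nth mult_1_left sum_subtractf)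
  qed
  have drop0: "(F * B) $ k = (\<Sum>m\<in>{1..k}. F $ m * hl p (k - m))" if "F $ 0 = 0" for F
    unfolding fps_mult_nth by (rule sum.mono_neutral_cong_right) (use that in \<open>auto simp: Suc_le_eq\<close>)
  have k2: "(fps_X ^ 2 * fps_deriv (fps_deriv B)) $ k = of_nat (k * (k - 1)) * hl p k"
  proof (cases "k < 2")
    case True
    then show ?thesis by (cases k) (auto simp: fps_X_power_mult_nth)
  next
    case False
    then obtain j where "k = Suc (Suc j)" using that[of "k - 2"] by simp
    moreover have "(fps_X ^ 2 * fps_deriv (fps_deriv B)) $ Suc (Suc j) = fps_deriv (fps_deriv B) $ j"
      unfolding fps_X_power_mult_nth by simp
    ultimately show ?thesis by (simp add: algebra_simps)
  qed
  have k1: "(fps_X * fps_deriv f) $ k = of_nat k * f $ k" for f :: "complex poly fps" by simp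
  have e1: "((U\<^sup>2 - V\<^sup>2) * B) $ k = (\<Sum>m\<in>{1..k}. (1 - monom 1 m) * [:\<Sum>l=1..<m. p l * p (m - l):] * hl p (k - m))"
    by (subst drop0) (simp_all only: UV0, simp)
  have e2: "(S * B) $ k = (\<Sum>m\<in>{1..k}. smult (p m) (cN m) * hl p (k - m))"
    by (subst drop0) (simp_all add: S_def cN_def)
  have e3: "(t * coeff_deriv B) $ k = monom 1 1 * pderiv (hl p k)" by (simp add: coeff_deriv_def)
  have e4: "B $ k = hl p k" by simp
  have "((1 - t) * ((U\<^sup>2 - V\<^sup>2) * B)) $ k + ((1 - t) * (S * B)) $ k =
     ((1 - t) * (fps_X ^ 2 * fps_deriv (fps_deriv B))) $ k - (2 * (1 - t) * (fps_X * fps_deriv (t * coeff_deriv B))) $ k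
       - (2 * t * (fps_X * fps_deriv B)) $ k"
    using arg_cong[OF main, of "\<lambda>f. f $ k"] by (simp only: fps_add_nth fps_sub_nth)
  thus ?thesis unfolding t1 t2 t4 k1 k2 e1 e2 e3 e4 cN_def by (simp only: mult.assoc)
qed

end

lemma triangle_swap:
  fixes F :: "nat \<Rightarrow> nat \<Rightarrow> 'a :: comm_monoid_add"
  shows "(\<Sum>m\<in>{1..k}. \<Sum>l\<in>{1..k-m}. F m l) = (\<Sum>l\<in>{1..k}. \<Sum>m\<in>{1..k-l}. F m l)"
  unfolding sum.Sigma[OF finite_atLeastAtMost ballI[OF finite_atLeastAtMost]]
  by (rule sum.reindex_bij_witness[of _ prod.swap prod.swap]) auto

lemma triangle_diagonal:
  fixes F :: "nat \<Rightarrow> nat \<Rightarrow> 'a :: comm_monoid_add"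
  shows "(\<Sum>m\<in>{1..k}. \<Sum>l\<in>{1..k-m}. F m l) = (\<Sum>N\<in>{1..k}. \<Sum>m\<in>{1..<N}. F m (N - m))"
  unfolding sum.Sigma[OF finite_atLeastAtMost ballI[OF finite_atLeastAtMost]]
    sum.Sigma[OF finite_atLeastAtMost ballI[OF finite_atLeastLessThan]]
  by (rule sum.reindex_bij_witness[of _ "\<lambda>(N, m). (m, N - m)" "\<lambda>(m, l). (m + l, m)"]) auto

lemma poly_hl_rec:
  assumes "0 < k"
  shows "of_nat k * poly (hl p k) t = (\<Sum>m\<in>{1..k}. (1 - t ^ m) * p m * poly (hl p (k - m)) t)"
proof -
  have "poly (of_nat k * hl p k) t = (\<Sum>m\<in>{1..k}. (1 - t ^ m) * p m * poly (hl p (k - m)) t)"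
    unfolding hl_rec[OF assms] poly_sum by (intro sum.cong refl) (simp add: poly_monom)
  thus ?thesis by simp
qed

lemma poly_hl_second_order:
  "(1 - t) * (\<Sum>m\<in>{1..k}. (1 - t ^ m) * (\<Sum>l=1..<m. p l * p (m - l)) * poly (hl p (k - m)) t)
   + (1 - t) * (\<Sum>m\<in>{1..k}. \<Sum>l\<in>{1..k-m}. (1 - t ^ m) * (1 - t ^ l) * p (m + l) * poly (hl p (k - m - l)) t)
   = (1 - t) * (of_nat (k * (k - 1)) * poly (hl p k) t)
     - 2 * (1 - t) * of_nat k * t * poly (pderiv (hl p k)) t - 2 * t * of_nat k * poly (hl p k) t"
proof -
  have "(\<Sum>m\<in>{1..k}. \<Sum>l\<in>{1..k-m}. (1 - t ^ m) * (1 - t ^ l) * p (m + l) * poly (hl p (k - m - l)) t)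
    = (\<Sum>N\<in>{1..k}. p N * (\<Sum>m=1..<N. (1 - t ^ m) * (1 - t ^ (N - m))) * poly (hl p (k - N)) t)"
    unfolding triangle_diagonal
    by (intro sum.cong refl) (auto simp: sum_distrib_left sum_distrib_right intro!: sum.cong)
  thus ?thesis
    using arg_cong[OF hl_second_order[of p k], of "\<lambda>q. poly q t"]
    by (simp add: poly_sum poly_monom mult.assoc mult.left_commute del: One_nat_def)
qed

lemma pderiv_hl_1: "poly (pderiv (hl p k)) 1 = - p k" if "0 < k"
proof -
  have z: "poly (hl p j) 1 = 0" if "0 < j" for j
    using poly_hl_rec[OF that, of p 1] that by simp
  have "of_nat k * poly (pderiv (hl p k)) 1 = poly (pderiv (of_nat k * hl p k)) 1"
    by (simp add: pderiv_of_nat_mult)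
  also have "\<dots> = (\<Sum>m\<in>{1..k}. - (of_nat m * p m * poly (hl p (k - m)) 1))"
    unfolding hl_rec[OF that] higher_pderiv_sum[of 1, simplified] poly_sum
    by (intro sum.cong refl)
      (simp add: pderiv_mult pderiv_smult pderiv_diff pderiv_monom poly_monom)
  also have "\<dots> = (\<Sum>m\<in>{k}. - (of_nat m * p m * poly (hl p (k - m)) 1))"
    by (rule sum.mono_neutral_right) (use that z in auto)
  also have "\<dots> = of_nat k * (- p k)" by simp
  finally show ?thesis using that by (simp only: mult_cancel_left of_nat_eq_0_iff) simp
qed

lemma hl_ode_zero:
  fixes Z :: "complex poly"
  assumes Z: "\<And>t. (1 - t) * of_nat c * poly Z t - 2 * t * (1 - t) * poly (pderiv Z) t - 2 * t * poly Z t = 0"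
    and N: "degree Z \<le> N" "2 * N \<le> c + 1" "0 < c"
  shows "Z = 0"
proof -
  let ?D = "pCons 0 (pderiv Z)"
  have "poly (smult (of_nat c) Z - pCons 0 (smult (of_nat c) Z) - smult 2 ?D + pCons 0 (smult 2 ?D) - pCons 0 (smult 2 Z)) t = 0" for t
    using Z[of t] by (simp add: algebra_simps)
  hence eq: "smult (of_nat c) Z - pCons 0 (smult (of_nat c) Z) - smult 2 ?D + pCons 0 (smult 2 ?D) - pCons 0 (smult 2 Z) = 0"
    by (metis poly_all_0_iff_0)
  have D: "coeff (pCons 0 (smult 2 (pderiv Z))) j = of_nat j * (2 * coeff Z j)" for j
    by (cases j) (simp_all add: coeff_pderiv)
  have z0: "coeff Z 0 = 0" using arg_cong[OF eq, of "\<lambda>q. coeff q 0"] N by simp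
  have rec: "(of_int (int c - 2 * int j - 2)) * coeff Z (Suc j) = (of_int (int c - 2 * int j + 2)) * coeff Z j" for j
    using arg_cong[OF eq, of "\<lambda>q. coeff q (Suc j)"] unfolding coeff_0
    by (simp add: D coeff_pderiv algebra_simps)
  have zj: "coeff Z j = 0" if "j < N" for j
    using that
  proof (induction j)
    case (Suc j)
    have zj: "coeff Z j = 0" using Suc by simp
    have nz: "(of_int (int c - 2 * int j - 2) :: complex) \<noteq> 0"
      unfolding of_int_eq_0_iff using Suc.prems N by linarith
    have "of_int (int c - 2 * int j - 2) * coeff Z (Suc j) = 0"
      unfolding rec zj by (rule mult_zero_right)
    thus ?case using nz unfolding mult_eq_0_iff by blast
  qed (rule z0)
  have zN: "coeff Z (Suc N) = 0" using N by (intro coeff_eq_0) simp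
  have nz: "(of_int (int c - 2 * int N + 2) :: complex) \<noteq> 0"
    unfolding of_int_eq_0_iff using N by linarith
  have "of_int (int c - 2 * int N + 2) * coeff Z N = 0"
    unfolding rec[symmetric] zN by (rule mult_zero_right)
  hence "coeff Z N = 0" using nz unfolding mult_eq_0_iff by blast
  hence "coeff Z j = 0" for j
    using zj N(1) by (cases "j < N"; cases "j = N") (auto intro: coeff_eq_0)
  thus ?thesis by (simp add: poly_eq_iff)
qed

lemma sum_one_minus_powers:
  fixes t :: complex
  shows "(1 - t) * (\<Sum>j\<in>{1..<Suc N}. (1 - t ^ (Suc N + r - j)) * (1 - t ^ j)) =
    (1 - t) * of_nat N * (1 + t ^ (Suc N + r)) - (1 + t ^ r) * (t - t ^ Suc N)"
proof -
  have "(\<Sum>j\<in>{1..<Suc N}. (1 - t ^ (Suc N + r - j)) * (1 - t ^ j)) =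
     (\<Sum>j\<in>{1..<Suc N}. 1 + t ^ (Suc N + r) - t ^ j - t ^ r * t ^ (Suc N - j))"
  proof (intro sum.cong refl)
    fix j assume "j \<in> {1..<Suc N}"
    hence "Suc N + r = (Suc N + r - j) + j" "Suc N + r - j = r + (Suc N - j)" by auto
    hence "t ^ (Suc N + r) = t ^ (Suc N + r - j) * t ^ j" "t ^ (Suc N + r - j) = t ^ r * t ^ (Suc N - j)"
      by (metis power_add)+
    thus "(1 - t ^ (Suc N + r - j)) * (1 - t ^ j) = 1 + t ^ (Suc N + r) - t ^ j - t ^ r * t ^ (Suc N - j)"
      by (simp only:) (simp add: algebra_simps)
  qed
  also have "\<dots> = of_nat N * (1 + t ^ (Suc N + r)) - (\<Sum>j\<in>{1..<Suc N}. t ^ j) - t ^ r * (\<Sum>j\<in>{1..<Suc N}. t ^ (Suc N - j))"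
    by (simp only: sum_subtractf sum_distrib_left sum_constant card_atLeastLessThan diff_Suc_1)
  also have "(\<Sum>j\<in>{1..<Suc N}. t ^ (Suc N - j)) = (\<Sum>j\<in>{1..<Suc N}. t ^ j)"
    by (rule sum.reindex_bij_witness[of _ "\<lambda>m. Suc N - m" "\<lambda>m. Suc N - m"]) auto
  finally have *: "(\<Sum>j\<in>{1..<Suc N}. (1 - t ^ (Suc N + r - j)) * (1 - t ^ j)) =
     of_nat N * (1 + t ^ (Suc N + r)) - (1 + t ^ r) * (\<Sum>j\<in>{1..<Suc N}. t ^ j)" by (simp add: algebra_simps)
  have "(1 - t) * (\<Sum>j\<in>{1..<Suc N}. (1 - t ^ (Suc N + r - j)) * (1 - t ^ j)) =
     (1 - t) * of_nat N * (1 + t ^ (Suc N + r)) - (1 + t ^ r) * ((1 - t) * (\<Sum>j\<in>{1..<Suc N}. t ^ j))"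
    unfolding * by (simp add: algebra_simps)
  thus ?thesis unfolding sum_powers_upto .
qed

lemma hl_ode_solution:
  fixes t :: complex
  assumes "0 < n" "0 < k"
  defines "N \<equiv> min k n"
  shows "(1 - t) * of_nat (n + k - 1) * (1 - t ^ N) + 2 * (1 - t) * of_nat N * t ^ N - 2 * t * (1 - t ^ N)
    = (1 - t) * (of_nat n * (1 - t ^ k) + (\<Sum>j\<in>{1..<k}. (1 - t ^ (k - j)) * (1 - t ^ min j n)))"
proof (cases "k \<le> n")
  case True
  define m where "m = k - 1"
  have k: "k = Suc m" using assms by (simp add: m_def)
  have N: "N = Suc m" using True k by (simp add: N_def)
  have nk: "of_nat (n + k - 1) = (of_nat n + of_nat m :: complex)" unfolding k by simp
  have "(\<Sum>j\<in>{1..<k}. (1 - t ^ (k - j)) * (1 - t ^ min j n)) = (\<Sum>j\<in>{1..<Suc m}. (1 - t ^ (Suc m + 0 - j)) * (1 - t ^ j))"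
    unfolding k[symmetric] by (intro sum.cong refl) (use True in \<open>auto simp: min_def\<close>)
  hence "(1 - t) * (\<Sum>j\<in>{1..<k}. (1 - t ^ (k - j)) * (1 - t ^ min j n)) =
     (1 - t) * of_nat m * (1 + t ^ Suc m) - (1 + 1) * (t - t ^ Suc m)"
    using sum_one_minus_powers[of t m 0] by simp
  thus ?thesis unfolding distrib_left[of "1 - t"] nk unfolding N k by (simp add: algebra_simps)
next
  case False
  define m r where "m = n - 1" and "r = k - n"
  have n: "n = Suc m" and k: "k = Suc m + r" using assms False by (simp_all add: m_def r_def)
  have N: "N = Suc m" using False n by (simp add: N_def)
  have nk: "of_nat (n + k - 1) = (2 * of_nat m + of_nat r + 1 :: complex)" unfolding k n by simp
  define A where "A = (\<Sum>j\<in>{1..<k}. (1 - t ^ (k - j)) * (1 - t ^ min j n))"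
  define A1 where "A1 = (\<Sum>j\<in>{1..<Suc m}. (1 - t ^ (Suc m + r - j)) * (1 - t ^ j))"
  have "A = (\<Sum>j\<in>{1..<Suc m}. (1 - t ^ (k - j)) * (1 - t ^ min j n)) + (\<Sum>j\<in>{Suc m..<k}. (1 - t ^ (k - j)) * (1 - t ^ min j n))"
    unfolding A_def by (rule sum.atLeastLessThan_concat[symmetric]) (use k in auto)
  also have "(\<Sum>j\<in>{1..<Suc m}. (1 - t ^ (k - j)) * (1 - t ^ min j n)) = A1"
    unfolding A1_def k by (intro sum.cong refl) (auto simp: n min_def)
  also have "(\<Sum>j\<in>{Suc m..<k}. (1 - t ^ (k - j)) * (1 - t ^ min j n)) = (\<Sum>i\<in>{1..<Suc r}. (1 - t ^ i) * (1 - t ^ Suc m))"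
    by (rule sum.reindex_bij_witness[of _ "\<lambda>i. k - i" "\<lambda>j. k - j"]) (auto simp: k n min_def)
  also have "\<dots> = (1 - t ^ Suc m) * (of_nat r - (\<Sum>i\<in>{1..<Suc r}. t ^ i))"
    by (simp only: sum_subtractf sum_distrib_right[symmetric] sum_constant card_atLeastLessThan diff_Suc_1
        mult_1_right mult_1_left mult.commute)
  finally have AA: "A = A1 + (1 - t ^ Suc m) * (of_nat r - (\<Sum>i\<in>{1..<Suc r}. t ^ i))" .
  have "(1 - t) * (a + b * (c - d)) = (1 - t) * a + b * ((1 - t) * c - (1 - t) * d)" for a b c d
    by (simp add: algebra_simps)
  hence "(1 - t) * A = (1 - t) * A1 + (1 - t ^ Suc m) * ((1 - t) * of_nat r - (1 - t) * (\<Sum>i\<in>{1..<Suc r}. t ^ i))"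
    unfolding AA .
  also have "\<dots> = (1 - t) * of_nat m * (1 + t ^ (Suc m + r)) - (1 + t ^ r) * (t - t ^ Suc m)
      + (1 - t ^ Suc m) * ((1 - t) * of_nat r - (t - t ^ Suc r))"
    unfolding A1_def sum_one_minus_powers sum_powers_upto ..
  finally have A: "(1 - t) * A = (1 - t) * of_nat m * (1 + t ^ (Suc m + r)) - (1 + t ^ r) * (t - t ^ Suc m)
      + (1 - t ^ Suc m) * ((1 - t) * of_nat r - (t - t ^ Suc r))" .
  show ?thesis unfolding A_def[symmetric] distrib_left[of "1 - t"] A nk unfolding N k n
    by (simp add: power_add) (simp add: algebra_simps)
qed

lemma hl_recursion_solution:
  fixes Y :: "nat \<Rightarrow> complex poly"
  assumes n: "0 < n" and Y0: "Y 0 = [:of_nat n:]" and deg: "\<And>k. degree (Y k) \<le> min k n"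
    and rec: "\<And>k t. 0 < k \<Longrightarrow> (1 - t) * of_nat (n + k - 1) * poly (Y k) t - 2 * t * (1 - t) * poly (pderiv (Y k)) t
      - 2 * t * poly (Y k) t = (1 - t) * (\<Sum>m\<in>{1..k}. (1 - t ^ m) * poly (Y (k - m)) t)"
    and k: "0 < k"
  shows "Y k = 1 - monom 1 (min k n)"
  using k
proof (induction k rule: less_induct)
  case (less k)
  define N where "N = min k n"
  have Npos: "0 < N" using n less.prems by (simp add: N_def)
  define E :: "complex poly" where "E = 1 - monom 1 N"
  have pE: "poly E t = 1 - t ^ N" "t * poly (pderiv E) t = - of_nat N * t ^ N" for t
    using Npos by (simp_all add: E_def poly_monom pderiv_diff pderiv_monom) (cases N; simp)
  have sum: "(\<Sum>m\<in>{1..k}. (1 - t ^ m) * poly (Y (k - m)) t) =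
     of_nat n * (1 - t ^ k) + (\<Sum>j\<in>{1..<k}. (1 - t ^ (k - j)) * (1 - t ^ min j n))" for t
  proof -
    have "(\<Sum>m\<in>{1..k}. (1 - t ^ m) * poly (Y (k - m)) t) = (\<Sum>m\<in>insert k {1..<k}. (1 - t ^ m) * poly (Y (k - m)) t)"
      using less.prems by (intro sum.cong refl) auto
    also have "\<dots> = of_nat n * (1 - t ^ k) + (\<Sum>m\<in>{1..<k}. (1 - t ^ m) * (1 - t ^ min (k - m) n))"
      using less.IH by (simp add: Y0 poly_monom)
    also have "(\<Sum>m\<in>{1..<k}. (1 - t ^ m) * (1 - t ^ min (k - m) n)) = (\<Sum>j\<in>{1..<k}. (1 - t ^ (k - j)) * (1 - t ^ min j n))"
      by (rule sum.reindex_bij_witness[of _ "\<lambda>m. k - m" "\<lambda>m. k - m"]) auto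
    finally show ?thesis .
  qed
  have "Y k - E = 0"
  proof (rule hl_ode_zero[where c = "n + k - 1" and N = N])
    fix t
    have E_eq: "(1 - t) * of_nat (n + k - 1) * poly E t - 2 * (1 - t) * (t * poly (pderiv E) t) - 2 * t * poly E t =
       (1 - t) * (\<Sum>m\<in>{1..k}. (1 - t ^ m) * poly (Y (k - m)) t)"
      unfolding sum pE using hl_ode_solution[OF n less.prems, of t] by (simp add: N_def mult.assoc)
    show "(1 - t) * of_nat (n + k - 1) * poly (Y k - E) t - 2 * t * (1 - t) * poly (pderiv (Y k - E)) t
        - 2 * t * poly (Y k - E) t = 0"
    proof -
      have gen: "u * c * (y - e) - 2 * t * u * (y' - e') - 2 * t * (y - e) =
         (u * c * y - 2 * t * u * y' - 2 * t * y) - (u * c * e - 2 * u * (t * e') - 2 * t * e)"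
        for u c y e y' e' :: complex by (simp add: algebra_simps)
      show ?thesis unfolding pderiv_diff poly_diff gen rec[OF less.prems, of t] E_eq by simp
    qed
  next
    show "degree (Y k - E) \<le> N"
    proof (intro degree_diff_le)
      show "degree (Y k) \<le> N" using deg[of k] by (simp add: N_def)
      show "degree E \<le> N" unfolding E_def by (intro degree_diff_le degree_monom_le) simp
    qed
  qed (use n less.prems in \<open>auto simp: N_def\<close>)
  thus ?case by (simp add: E_def N_def)
qed

lemma poly_sum_upto:
  fixes p :: "complex poly"
  assumes "degree p \<le> k"
  shows "poly p x = (\<Sum>i\<le>k. coeff p i * x ^ i)"
  unfolding poly_altdef
  by (rule sum.mono_neutral_left) (use assms in \<open>auto simp: coeff_eq_0\<close>)

context haar_unitary
begin

definition hlp :: "nat \<Rightarrow> complex mat \<Rightarrow> complex poly" where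
  "hlp k M = hl (\<lambda>m. ptrace n (int m) M) k"

lemma has_gradient_hlp:
  "has_gradient (\<lambda>M. poly (hlp k M) t)
    (\<lambda>M a b. \<Sum>m\<in>{1..k}. (1 - t ^ m) * mpow M (int m) a b * poly (hlp (k - m) M) t)"
proof (induction k rule: less_induct)
  case (less k)
  show ?case
  proof (cases "k = 0")
    case True
    then show ?thesis using has_gradient_const[of 1] by (simp add: hlp_def)
  next
    case False
    let ?b = "\<lambda>k M. poly (hlp k M) t"
    let ?K = "\<lambda>k M a b. \<Sum>m\<in>{1..k}. (1 - t ^ m) * mpow M (int m) a b * ?b (k - m) M"
    have "has_gradient (\<lambda>M. (1 / of_nat k) * (\<Sum>m\<in>{1..k}. (1 - t ^ m) * (ptrace n (int m) M * ?b (k - m) M)))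
      (\<lambda>M a b. (1 / of_nat k) * (\<Sum>m\<in>{1..k}. (1 - t ^ m) *
        (of_nat m * mpow M (int m) a b * ?b (k - m) M + ptrace n (int m) M * ?K (k - m) M a b)))"
      by (intro has_gradient_cmult has_gradient_sum has_gradient_mult has_gradient_ptrace_nat less) (use False in auto)
    thus ?thesis
    proof (rule has_gradient_cong)
      fix M
      have rec: "of_nat j * ?b j M = (\<Sum>m\<in>{1..j}. (1 - t ^ m) * ptrace n (int m) M * ?b (j - m) M)" for j
        using poly_hl_rec[of j _ t] by (cases "j = 0") (auto simp: hlp_def)
      show "(1 / of_nat k) * (\<Sum>m\<in>{1..k}. (1 - t ^ m) * (ptrace n (int m) M * ?b (k - m) M)) = ?b k M"
        using rec[of k] False by (simp add: field_simps)
      fix a b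
      have "(\<Sum>m\<in>{1..k}. (1 - t ^ m) * (ptrace n (int m) M * ?K (k - m) M a b)) =
        (\<Sum>m\<in>{1..k}. \<Sum>l\<in>{1..k-m}. (1 - t ^ m) * ptrace n (int m) M * ((1 - t ^ l) * mpow M (int l) a b * ?b (k - m - l) M))"
        by (simp only: sum_distrib_left mult.assoc)
      also have "\<dots> = (\<Sum>l\<in>{1..k}. \<Sum>m\<in>{1..k-l}. (1 - t ^ m) * ptrace n (int m) M * ((1 - t ^ l) * mpow M (int l) a b * ?b (k - m - l) M))"
        by (rule triangle_swap)
      also have "\<dots> = (\<Sum>l\<in>{1..k}. (1 - t ^ l) * mpow M (int l) a b * (of_nat (k - l) * ?b (k - l) M))"
        unfolding rec by (intro sum.cong refl) (simp add: sum_distrib_left mult_ac add.commute)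
      finally have "(\<Sum>m\<in>{1..k}. (1 - t ^ m) *
        (of_nat m * mpow M (int m) a b * ?b (k - m) M + ptrace n (int m) M * ?K (k - m) M a b)) =
        (\<Sum>l\<in>{1..k}. (1 - t ^ l) * (of_nat l * mpow M (int l) a b * ?b (k - l) M)
          + (1 - t ^ l) * mpow M (int l) a b * (of_nat (k - l) * ?b (k - l) M))"
        by (simp only: distrib_left sum.distrib)
      also have "\<dots> = of_nat k * ?K k M a b"
        unfolding sum_distrib_left by (intro sum.cong refl) (auto simp: of_nat_diff algebra_simps)
      finally show "(1 / of_nat k) * (\<Sum>m\<in>{1..k}. (1 - t ^ m) *
        (of_nat m * mpow M (int m) a b * ?b (k - m) M + ptrace n (int m) M * ?K (k - m) M a b)) = ?K k M a b"
        using False by simp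
    qed
  qed
qed

lemma regular_hlp [intro]: "regular (\<lambda>M. poly (hlp k M) t)"
  using has_gradientD(1)[OF has_gradient_hlp] .

lemmas regular_intros = regular_const regular_add regular_mult regular_sum regular_uminus regular_diff
  regular_cnj regular_exp regular_ptrace regular_qtrace regular_hlp

lemma regular_coeff_hlp [intro]: "regular (\<lambda>M. coeff (hlp k M) b)"
proof (induction k arbitrary: b rule: less_induct)
  case (less k)
  show ?case
  proof (cases "k = 0")
    case True
    then show ?thesis by (simp add: hlp_def)
  next
    case False
    have eq: "coeff (hlp k M) b = (1 / of_nat k) * (\<Sum>m\<in>{1..k}. ptrace n (int m) M *
        (coeff (hlp (k - m) M) b - (if m \<le> b then coeff (hlp (k - m) M) (b - m) else 0)))" for M
      unfolding hlp_def using False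
      by (subst hl.simps) (simp add: coeff_sum left_diff_distrib coeff_monom_mult cong: if_cong)
    have "regular (\<lambda>M. if m \<le> b then coeff (hlp (k - m) M) (b - m) else 0)" if "m \<in> {1..k}" for m
      using that less by (cases "m \<le> b") auto
    thus ?thesis unfolding eq
      by (intro regular_mult regular_sum regular_diff regular_const regular_ptrace less) (use False in auto)
  qed
qed

lemma hlp_loop:
  assumes m: "0 < m" "m \<le> k"
  shows "(LINT M|H. ((of_nat n * ptrace n (int m) M + qtrace m M) * poly (hlp (k - m) M) t
      + (\<Sum>l\<in>{1..k-m}. (1 - t ^ l) * ptrace n (int (m + l)) M * poly (hlp (k - m - l) M) t)) * ptrace n (- int k) M)
    = of_nat k * (LINT M|H. poly (hlp (k - m) M) t * ptrace n (- int (k - m)) M)"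
proof -
  let ?b = "\<lambda>k M. poly (hlp k M) t"
  let ?K = "\<lambda>k M a b. \<Sum>m\<in>{1..k}. (1 - t ^ m) * mpow M (int m) a b * ?b (k - m) M"
  let ?L = "\<lambda>M. ((of_nat n * ptrace n (int m) M + qtrace m M) * ?b (k - m) M
      + (\<Sum>l\<in>{1..k-m}. (1 - t ^ l) * ptrace n (int (m + l)) M * ?b (k - m - l) M)) * ptrace n (- int k) M"
  have "0 = (LINT M|H. (of_nat n * ptrace n (int m) M + qtrace m M) * (?b (k - m) M * ptrace n (- int k) M)
    + (\<Sum>i<n. \<Sum>j<n. mpow M (int m) i j * (?K (k - m) M j i * ptrace n (- int k) M
        + ?b (k - m) M * (of_int (- int k) * mpow M (- int k) j i))))"
    by (rule loop_equation[symmetric, OF has_gradient_mult[OF has_gradient_hlp has_gradient_ptrace] m(1)])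
  also have "\<dots> = (LINT M|H. ?L M - of_nat k * (?b (k - m) M * ptrace n (- int (k - m)) M))"
  proof (intro Bochner_Integration.integral_cong refl)
    fix M assume "M \<in> space H"
    hence M: "M \<in> unitary_group n" by (simp add: space_H)
    have "(\<Sum>i<n. \<Sum>j<n. mpow M (int m) i j * ?K (k - m) M j i) =
      (\<Sum>i<n. \<Sum>j<n. \<Sum>l\<in>{1..k-m}. (1 - t ^ l) * ?b (k - m - l) M * (mpow M (int m) i j * mpow M (int l) j i))"
      by (simp only: sum_distrib_left mult_ac)
    also have "\<dots> = (\<Sum>i<n. \<Sum>l\<in>{1..k-m}. \<Sum>j<n. (1 - t ^ l) * ?b (k - m - l) M * (mpow M (int m) i j * mpow M (int l) j i))"
      by (intro sum.cong refl sum.swap)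
    also have "\<dots> = (\<Sum>l\<in>{1..k-m}. \<Sum>i<n. \<Sum>j<n. (1 - t ^ l) * ?b (k - m - l) M * (mpow M (int m) i j * mpow M (int l) j i))"
      by (rule sum.swap)
    also have "\<dots> = (\<Sum>l\<in>{1..k-m}. (1 - t ^ l) * ptrace n (int (m + l)) M * ?b (k - m - l) M)"
      unfolding sum_distrib_left[symmetric] mpow_trace_mult[OF M] by (simp only: of_nat_add mult_ac)
    finally have 1: "(\<Sum>i<n. \<Sum>j<n. mpow M (int m) i j * (?K (k - m) M j i * ptrace n (- int k) M)) =
      (\<Sum>l\<in>{1..k-m}. (1 - t ^ l) * ptrace n (int (m + l)) M * ?b (k - m - l) M) * ptrace n (- int k) M"
      by (simp only: mult.assoc[symmetric] sum_distrib_right[symmetric])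
    have "(\<Sum>i<n. \<Sum>j<n. mpow M (int m) i j * (?b (k - m) M * (of_int (- int k) * mpow M (- int k) j i))) =
      - of_nat k * ?b (k - m) M * (\<Sum>i<n. \<Sum>j<n. mpow M (int m) i j * mpow M (- int k) j i)"
      unfolding sum_distrib_left by (intro sum.cong refl) simp
    also have "\<dots> = - (of_nat k * (?b (k - m) M * ptrace n (- int (k - m)) M))"
      unfolding mpow_trace_mult[OF M] using m by (simp add: of_nat_diff)
    finally have 2: "(\<Sum>i<n. \<Sum>j<n. mpow M (int m) i j * (?b (k - m) M * (of_int (- int k) * mpow M (- int k) j i))) =
      - (of_nat k * (?b (k - m) M * ptrace n (- int (k - m)) M))" .
    show "(of_nat n * ptrace n (int m) M + qtrace m M) * (?b (k - m) M * ptrace n (- int k) M)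
      + (\<Sum>i<n. \<Sum>j<n. mpow M (int m) i j * (?K (k - m) M j i * ptrace n (- int k) M
        + ?b (k - m) M * (of_int (- int k) * mpow M (- int k) j i)))
      = ?L M - of_nat k * (?b (k - m) M * ptrace n (- int (k - m)) M)"
      unfolding distrib_left[of "mpow M (int m) _ _"] sum.distrib 1 2 by (simp add: algebra_simps)
  qed
  also have "\<dots> = (LINT M|H. ?L M) - of_nat k * (LINT M|H. ?b (k - m) M * ptrace n (- int (k - m)) M)"
    by (subst Bochner_Integration.integral_diff)
      (simp_all only: integral_mult_right_zero, (rule regular_integrable, intro regular_intros)+)
  finally show ?thesis by simp
qed

definition ypoly :: "nat \<Rightarrow> complex poly" where
  "ypoly k = (\<Sum>b\<le>k. monom (LINT M|H. coeff (hlp k M) b * ptrace n (- int k) M) b)"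

lemma coeff_ypoly: "coeff (ypoly k) b = (LINT M|H. coeff (hlp k M) b * ptrace n (- int k) M)"
proof (cases "b \<le> k")
  case True
  then show ?thesis by (simp add: ypoly_def coeff_sum)
next
  case False
  hence "coeff (hlp k M) b = 0" for M
    unfolding hlp_def using False by (intro coeff_eq_0 order.strict_trans1[OF degree_hl_le]) simp
  then show ?thesis using False by (simp add: ypoly_def coeff_sum)
qed

lemma poly_ypoly: "poly (ypoly k) t = (LINT M|H. poly (hlp k M) t * ptrace n (- int k) M)"
proof -
  have d: "degree (hlp k M) \<le> k" for M unfolding hlp_def by (rule degree_hl_le)
  have "degree (ypoly k) \<le> k" unfolding ypoly_def
    by (intro degree_sum_le) (auto intro: order_trans[OF degree_monom_le])
  hence "poly (ypoly k) t = (\<Sum>b\<le>k. (LINT M|H. coeff (hlp k M) b * ptrace n (- int k) M) * t ^ b)"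
    by (simp add: poly_sum_upto coeff_ypoly)
  also have "\<dots> = (LINT M|H. (\<Sum>b\<le>k. coeff (hlp k M) b * ptrace n (- int k) M * t ^ b))"
    by (subst expectation_sum, intro regular_intros regular_coeff_hlp) (simp only: integral_mult_left_zero)
  also have "\<dots> = (LINT M|H. poly (hlp k M) t * ptrace n (- int k) M)"
    unfolding poly_sum_upto[OF d] sum_distrib_right
    by (intro Bochner_Integration.integral_cong sum.cong refl) (simp only: mult_ac)
  finally show ?thesis .
qed

lemma poly_pderiv_ypoly: "poly (pderiv (ypoly k)) t = (LINT M|H. poly (pderiv (hlp k M)) t * ptrace n (- int k) M)"
  and regular_pderiv_hlp: "regular (\<lambda>M. poly (pderiv (hlp k M)) t)"
proof -
  have eq: "poly (pderiv q) t = (\<Sum>b\<le>k. of_nat (Suc b) * coeff q (Suc b) * t ^ b)" if "degree q \<le> k" for q :: "complex poly"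
    using that by (subst poly_sum_upto[of _ k]) (auto simp: coeff_pderiv intro: order_trans[OF degree_pderiv_le])
  have d: "degree (hlp k M) \<le> k" for M unfolding hlp_def by (rule degree_hl_le)
  have dY: "degree (ypoly k) \<le> k" unfolding ypoly_def
    by (intro degree_sum_le) (auto intro: order_trans[OF degree_monom_le])
  show "regular (\<lambda>M. poly (pderiv (hlp k M)) t)"
    unfolding eq[OF d] by (intro regular_sum regular_mult regular_coeff_hlp regular_const)
  have "poly (pderiv (ypoly k)) t = (LINT M|H. (\<Sum>b\<le>k. of_nat (Suc b) * (coeff (hlp k M) (Suc b) * ptrace n (- int k) M) * t ^ b))"
    unfolding eq[OF dY] coeff_ypoly
    by (subst expectation_sum, intro regular_intros regular_coeff_hlp)
      (simp only: integral_mult_left_zero integral_mult_right_zero)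
  also have "\<dots> = (LINT M|H. poly (pderiv (hlp k M)) t * ptrace n (- int k) M)"
    unfolding eq[OF d] sum_distrib_right
    by (intro Bochner_Integration.integral_cong sum.cong refl) (simp only: mult_ac)
  finally show "poly (pderiv (ypoly k)) t = (LINT M|H. poly (pderiv (hlp k M)) t * ptrace n (- int k) M)" .
qed

lemma degree_ypoly_le: "degree (ypoly k) \<le> min k n"
proof (rule degree_le, intro allI impI)
  fix b assume b: "min k n < b"
  have "coeff (hlp k M) b = 0" if "M \<in> space H" for M
  proof -
    have M: "M \<in> unitary_group n" using that by (simp add: space_H)
    obtain z where "char_poly M = (\<Prod>j<n. [:- z j, 1:])"
      using char_poly_factors[OF unitary_groupD(1)[OF M]] .
    hence "degree (hlp k M) \<le> n"
      unfolding hlp_def by (intro degree_hl_le_n[of _ z] ptrace_eigenvalues[OF M])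
    moreover have "degree (hlp k M) \<le> k" unfolding hlp_def by (rule degree_hl_le)
    ultimately show ?thesis using b by (intro coeff_eq_0) auto
  qed
  hence "(LINT M|H. coeff (hlp k M) b * ptrace n (- int k) M) = (LINT M|H. 0)"
    by (intro Bochner_Integration.integral_cong refl) simp
  thus "coeff (ypoly k) b = 0" by (simp add: coeff_ypoly)
qed

lemma ypoly_0: "ypoly 0 = [:of_nat n:]"
proof -
  have "(LINT M|H. coeff (hlp 0 M) 0 * ptrace n (- int 0) M) = (LINT M|H. of_nat n)"
    by (intro Bochner_Integration.integral_cong refl) (simp add: hlp_def ptrace_0 space_H)
  thus ?thesis by (simp add: ypoly_def monom_0 prob_space)
qed

lemma ypoly_ode:
  assumes k: "0 < k"
  shows "(1 - t) * of_nat (n + k - 1) * poly (ypoly k) t - 2 * t * (1 - t) * poly (pderiv (ypoly k)) t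
      - 2 * t * poly (ypoly k) t = (1 - t) * (\<Sum>m\<in>{1..k}. (1 - t ^ m) * poly (ypoly (k - m)) t)"
proof -
  let ?b = "\<lambda>k M. poly (hlp k M) t" and ?p = "\<lambda>m M. ptrace n (int m) M"
  let ?L = "\<lambda>m M. (of_nat n * ?p m M + qtrace m M) * ?b (k - m) M
      + (\<Sum>l\<in>{1..k-m}. (1 - t ^ l) * ?p (m + l) M * ?b (k - m - l) M)"
  have pt: "(1 - t) * (\<Sum>m\<in>{1..k}. (1 - t ^ m) * ?L m M) =
    (1 - t) * of_nat (n * k + k * (k - 1)) * ?b k M - 2 * (1 - t) * of_nat k * t * poly (pderiv (hlp k M)) t
      - 2 * t * of_nat k * ?b k M" for M
  proof -
    have q: "qtrace m M = (\<Sum>l=1..<m. ?p l M * ?p (m - l) M)" for m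
      unfolding qtrace_def by (intro sum.cong refl) (simp add: of_nat_diff)
    have "(\<Sum>m\<in>{1..k}. (1 - t ^ m) * ?L m M) = of_nat n * (\<Sum>m\<in>{1..k}. (1 - t ^ m) * ?p m M * ?b (k - m) M)
       + (\<Sum>m\<in>{1..k}. (1 - t ^ m) * qtrace m M * ?b (k - m) M)
       + (\<Sum>m\<in>{1..k}. \<Sum>l\<in>{1..k-m}. (1 - t ^ m) * (1 - t ^ l) * ?p (m + l) M * ?b (k - m - l) M)"
      by (simp only: distrib_left distrib_right sum.distrib sum_distrib_left mult_ac)
    also have "of_nat n * (\<Sum>m\<in>{1..k}. (1 - t ^ m) * ?p m M * ?b (k - m) M) = of_nat n * (of_nat k * ?b k M)"
      unfolding hlp_def poly_hl_rec[OF k] ..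
    finally have "(1 - t) * (\<Sum>m\<in>{1..k}. (1 - t ^ m) * ?L m M) = (1 - t) * (of_nat n * (of_nat k * ?b k M))
      + ((1 - t) * (\<Sum>m\<in>{1..k}. (1 - t ^ m) * qtrace m M * ?b (k - m) M)
       + (1 - t) * (\<Sum>m\<in>{1..k}. \<Sum>l\<in>{1..k-m}. (1 - t ^ m) * (1 - t ^ l) * ?p (m + l) M * ?b (k - m - l) M))"
      by (simp only: distrib_left add.assoc)
    also have "\<dots> = (1 - t) * (of_nat n * (of_nat k * ?b k M)) + ((1 - t) * (of_nat (k * (k - 1)) * ?b k M)
     - 2 * (1 - t) * of_nat k * t * poly (pderiv (hlp k M)) t - 2 * t * of_nat k * ?b k M)"
      unfolding q hlp_def
      using poly_hl_second_order[where t = t and k = k and p = "\<lambda>m. ptrace n (int m) M"] by (simp only:)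
    also have "\<dots> = (1 - t) * of_nat (n * k + k * (k - 1)) * ?b k M - 2 * (1 - t) * of_nat k * t * poly (pderiv (hlp k M)) t
      - 2 * t * of_nat k * ?b k M"
      unfolding of_nat_add of_nat_mult by (simp add: algebra_simps)
    finally show ?thesis .
  qed
  have "(LINT M|H. (1 - t) * (\<Sum>m\<in>{1..k}. (1 - t ^ m) * ?L m M) * ptrace n (- int k) M) =
     (1 - t) * (\<Sum>m\<in>{1..k}. (1 - t ^ m) * (LINT M|H. ?L m M * ptrace n (- int k) M))"
  proof -
    have "(LINT M|H. (1 - t) * (\<Sum>m\<in>{1..k}. (1 - t ^ m) * ?L m M) * ptrace n (- int k) M) =
      (LINT M|H. (1 - t) * (\<Sum>m\<in>{1..k}. (1 - t ^ m) * (?L m M * ptrace n (- int k) M)))"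
      unfolding sum_distrib_left sum_distrib_right
      by (intro Bochner_Integration.integral_cong sum.cong refl) (simp only: mult_ac)
    also have "\<dots> = (1 - t) * (\<Sum>m\<in>{1..k}. (1 - t ^ m) * (LINT M|H. ?L m M * ptrace n (- int k) M))"
      by (subst integral_mult_right_zero)
      (subst expectation_sum, (intro regular_intros)+, simp only: integral_mult_right_zero)
    finally show ?thesis .
  qed
  also have "\<dots> = (1 - t) * (\<Sum>m\<in>{1..k}. (1 - t ^ m) * (of_nat k * poly (ypoly (k - m)) t))"
    unfolding poly_ypoly
    by (intro arg_cong[where f = "\<lambda>x. (1 - t) * x"] sum.cong refl, subst hlp_loop) auto
  finally have f: "(LINT M|H. ((1 - t) * of_nat (n * k + k * (k - 1)) * ?b k M - 2 * (1 - t) * of_nat k * t * poly (pderiv (hlp k M)) t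
      - 2 * t * of_nat k * ?b k M) * ptrace n (- int k) M) =
    (1 - t) * (\<Sum>m\<in>{1..k}. (1 - t ^ m) * (of_nat k * poly (ypoly (k - m)) t))"
    unfolding pt .
  have "of_nat k * ((1 - t) * (\<Sum>m\<in>{1..k}. (1 - t ^ m) * poly (ypoly (k - m)) t)) =
    (LINT M|H. ((1 - t) * of_nat (n * k + k * (k - 1)) * ?b k M - 2 * (1 - t) * of_nat k * t * poly (pderiv (hlp k M)) t
      - 2 * t * of_nat k * ?b k M) * ptrace n (- int k) M)"
    unfolding f sum_distrib_left by (intro sum.cong refl) (simp only: mult_ac)
  also have "\<dots> = (LINT M|H. (1 - t) * of_nat (n * k + k * (k - 1)) * (?b k M * ptrace n (- int k) M)
      - 2 * (1 - t) * of_nat k * t * (poly (pderiv (hlp k M)) t * ptrace n (- int k) M)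
      - 2 * t * of_nat k * (?b k M * ptrace n (- int k) M))"
    by (intro Bochner_Integration.integral_cong refl) (simp add: left_diff_distrib)
  also have "\<dots> = (1 - t) * of_nat (n * k + k * (k - 1)) * poly (ypoly k) t
      - 2 * (1 - t) * of_nat k * t * poly (pderiv (ypoly k)) t - 2 * t * of_nat k * poly (ypoly k) t"
    unfolding poly_ypoly poly_pderiv_ypoly
    by (subst Bochner_Integration.integral_diff, (intro regular_integrable regular_diff regular_mult regular_const regular_hlp regular_ptrace regular_pderiv_hlp)+,
      subst Bochner_Integration.integral_diff, (intro regular_integrable regular_diff regular_mult regular_const regular_hlp regular_ptrace regular_pderiv_hlp)+)
      (simp only: integral_mult_right_zero)
  also have "\<dots> = of_nat k * ((1 - t) * of_nat (n + k - 1) * poly (ypoly k) t - 2 * t * (1 - t) * poly (pderiv (ypoly k)) t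
      - 2 * t * poly (ypoly k) t)"
  proof -
    have e: "n * k + k * (k - 1) = k * (n + k - 1)" using k by (cases k) (auto simp: algebra_simps)
    have gen: "u * (a * c) * y - 2 * u * a * t * y' - 2 * t * a * y = a * (u * c * y - 2 * t * u * y' - 2 * t * y)"
      for u a c y y' :: complex by (simp add: algebra_simps)
    show ?thesis unfolding e of_nat_mult by (rule gen)
  qed
  finally show ?thesis using k by simp
qed

theorem ptrace_variance:
  assumes "0 < k"
  shows "(LINT M|H. ptrace n (int k) M * ptrace n (- int k) M) = of_nat (min k n)"
proof -
  have "ypoly k = 1 - monom 1 (min k n)"
    by (rule hl_recursion_solution[OF n_pos ypoly_0 degree_ypoly_le ypoly_ode assms])
  hence "poly (pderiv (ypoly k)) 1 = - of_nat (min k n)"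
    using assms n_pos by (simp add: pderiv_diff pderiv_monom poly_monom)
  moreover have "poly (pderiv (ypoly k)) 1 = - (LINT M|H. ptrace n (int k) M * ptrace n (- int k) M)"
    unfolding poly_pderiv_ypoly hlp_def pderiv_hl_1[OF assms] by simp
  ultimately show ?thesis by (metis neg_equal_iff_equal)
qed

end

section \<open>Characteristic functions of trigonometric sums\<close>

context haar_unitary
begin

lemma ptrace_product_expectation:
  assumes "k + l \<noteq> 0"
  shows "(LINT M|H. ptrace n k M * ptrace n l M) = 0"
proof (rule expectation_homogeneous[OF has_gradient_mult[OF has_gradient_ptrace has_gradient_ptrace]])
  show "of_int (k + l) \<noteq> (0 :: complex)" using assms by (simp only: of_int_eq_0_iff) simp
  fix M assume M: "M \<in> unitary_group n"
  show "(\<Sum>c<n. of_int k * mpow M k c c * ptrace n l M + ptrace n k M * (of_int l * mpow M l c c)) =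
    of_int (k + l) * (ptrace n k M * ptrace n l M)"
    unfolding sum.distrib sum_distrib_right[symmetric] sum_distrib_left[symmetric]
    unfolding ptrace_def[symmetric] by (simp add: algebra_simps)
qed

lemma ptrace_expectation: "k \<noteq> 0 \<Longrightarrow> (LINT M|H. ptrace n k M) = 0"
  by (rule expectation_homogeneous[OF has_gradient_ptrace, of "of_int k"])
    (simp_all add: ptrace_def sum_distrib_left)

lemma integral_cong_unitary:
  "(\<And>M. M \<in> unitary_group n \<Longrightarrow> f M = g M) \<Longrightarrow> (LINT M|H. f M) = (LINT M|H. g M)"
  by (rule Bochner_Integration.integral_cong) (simp_all add: space_H)

lemma ptrace_norm_expectation:
  assumes "k \<noteq> 0"
  shows "(LINT M|H. (cmod (ptrace n k M))\<^sup>2) = real (min (nat \<bar>k\<bar>) n)"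
proof -
  define m where "m = nat \<bar>k\<bar>"
  have m: "0 < m" "k = int m \<or> k = - int m" using assms by (auto simp: m_def)
  have "complex_of_real (LINT M|H. (cmod (ptrace n k M))\<^sup>2) = (LINT M|H. ptrace n (int m) M * ptrace n (- int m) M)"
    unfolding integral_complex_of_real[symmetric]
    by (rule integral_cong_unitary) (use m(2) in \<open>auto simp: complex_norm_square ptrace_minus simp del: of_real_power\<close>)
  also have "\<dots> = of_nat (min m n)" by (rule ptrace_variance[OF m(1)])
  finally show ?thesis unfolding m_def by (metis of_real_of_nat_eq of_real_eq_iff)
qed

lemma expectation_norm_sum:
  assumes "\<And>q. q \<in> J \<Longrightarrow> regular (f q)"
    and "\<And>q r. q \<in> J \<Longrightarrow> r \<in> J \<Longrightarrow> q \<noteq> r \<Longrightarrow> (LINT M|H. f q M * cnj (f r M)) = 0"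
  shows "(LINT M|H. (cmod (\<Sum>q\<in>J. a q * f q M))\<^sup>2) = (\<Sum>q\<in>J. (cmod (a q))\<^sup>2 * (LINT M|H. (cmod (f q M))\<^sup>2))"
proof (cases "finite J")
  case True
  have "complex_of_real (LINT M|H. (cmod (\<Sum>q\<in>J. a q * f q M))\<^sup>2) =
     (LINT M|H. (\<Sum>q\<in>J. \<Sum>r\<in>J. (a q * cnj (a r)) * (f q M * cnj (f r M))))"
    unfolding integral_complex_of_real[symmetric] complex_norm_square cnj_sum sum_product
    by (simp only: complex_cnj_mult mult_ac)
  also have "\<dots> = (\<Sum>q\<in>J. \<Sum>r\<in>J. (a q * cnj (a r)) * (LINT M|H. f q M * cnj (f r M)))"
    by (subst expectation_sum, (intro regular_intros assms(1); assumption),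
        intro sum.cong refl, subst expectation_sum, (intro regular_intros assms(1); assumption), simp)
  also have "\<dots> = (\<Sum>q\<in>J. (a q * cnj (a q)) * (LINT M|H. f q M * cnj (f q M)))"
  proof (intro sum.cong refl)
    fix q assume q: "q \<in> J"
    have "(\<Sum>r\<in>J. (a q * cnj (a r)) * (LINT M|H. f q M * cnj (f r M))) =
      (\<Sum>r\<in>{q}. (a q * cnj (a r)) * (LINT M|H. f q M * cnj (f r M)))"
      by (rule sum.mono_neutral_right) (use q True assms(2)[of q] in auto)
    thus "(\<Sum>r\<in>J. (a q * cnj (a r)) * (LINT M|H. f q M * cnj (f r M))) =
      (a q * cnj (a q)) * (LINT M|H. f q M * cnj (f q M))" by simp
  qed
  also have "\<dots> = complex_of_real (\<Sum>q\<in>J. (cmod (a q))\<^sup>2 * (LINT M|H. (cmod (f q M))\<^sup>2))"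
    unfolding of_real_sum of_real_mult integral_complex_of_real[symmetric] complex_norm_square ..
  finally show ?thesis by (simp only: of_real_eq_iff)
qed simp

lemma ptrace_sum_norm_expectation:
  assumes "\<And>m. m \<in> J \<Longrightarrow> k + m \<noteq> 0"
  shows "(LINT M|H. (cmod (\<Sum>m\<in>J. a m * ptrace n (k + m) M))\<^sup>2) = (\<Sum>m\<in>J. (cmod (a m))\<^sup>2 * real (min (nat \<bar>k + m\<bar>) n))"
proof -
  have "(LINT M|H. ptrace n (k + q) M * cnj (ptrace n (k + r) M)) = 0" if "q \<noteq> r" for q r
  proof -
    have "(LINT M|H. ptrace n (k + q) M * cnj (ptrace n (k + r) M)) = (LINT M|H. ptrace n (k + q) M * ptrace n (- (k + r)) M)"
      by (rule integral_cong_unitary) (simp only: ptrace_minus)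
    thus ?thesis using that by (simp only:) (rule ptrace_product_expectation, simp)
  qed
  thus ?thesis using assms
    by (subst expectation_norm_sum) (auto simp: ptrace_norm_expectation)
qed

lemma expectation_norm_le:
  assumes "regular f"
  shows "(LINT M|H. cmod (f M)) \<le> sqrt (LINT M|H. (cmod (f M))\<^sup>2)"
proof -
  obtain C where C: "f \<in> borel_measurable H" "\<And>M. M \<in> unitary_group n \<Longrightarrow> cmod (f M) \<le> C"
    using assms unfolding regular_def by blast
  have i1: "integrable H (\<lambda>M. cmod (f M))" using regular_integrable[OF assms] by simp
  have i2: "integrable H (\<lambda>M. (cmod (f M))\<^sup>2)"
    using C by (intro integrable_const_bound[of _ "C\<^sup>2"]) (auto simp: space_H intro!: AE_I2 power_mono)
  have "0 \<le> (LINT M|H. (cmod (f M))\<^sup>2) - (LINT M|H. cmod (f M))\<^sup>2"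
    using variance_positive[of "\<lambda>M. cmod (f M)"] unfolding variance_eq[OF i1 i2] .
  thus ?thesis by (intro real_le_rsqrt) simp
qed

lemma has_gradient_qtrace:
  "has_gradient (qtrace k) (\<lambda>M a b. \<Sum>l=1..<k. of_int (int l) * mpow M (int l) a b * ptrace n (int k - int l) M
     + ptrace n (int l) M * (of_int (int k - int l) * mpow M (int k - int l) a b))"
  unfolding qtrace_def[abs_def] by (intro has_gradient_sum has_gradient_mult has_gradient_ptrace)

lemma qtrace_orthogonal:
  assumes "k \<noteq> l"
  shows "(LINT M|H. qtrace k M * cnj (qtrace l M)) = 0"
proof (rule expectation_homogeneous[OF has_gradient_mult[OF has_gradient_qtrace has_gradient_cnj[OF has_gradient_qtrace]]])
  let ?K = "\<lambda>k M a b. \<Sum>l=1..<k. of_int (int l) * mpow M (int l) a b * ptrace n (int k - int l) M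
     + ptrace n (int l) M * (of_int (int k - int l) * mpow M (int k - int l) a b)"
  show "(of_nat k - of_nat l :: complex) \<noteq> 0" using assms by simp
  fix M assume M: "M \<in> unitary_group n"
  have tr: "(\<Sum>c<n. ?K k M c c) = of_nat k * qtrace k M" for k
  proof -
    have "(\<Sum>c<n. ?K k M c c) = (\<Sum>l=1..<k. \<Sum>c<n. of_int (int l) * mpow M (int l) c c * ptrace n (int k - int l) M
     + ptrace n (int l) M * (of_int (int k - int l) * mpow M (int k - int l) c c))"
      by (rule sum.swap)
    also have "\<dots> = (\<Sum>l=1..<k. of_int (int l) * ptrace n (int l) M * ptrace n (int k - int l) M
     + ptrace n (int l) M * (of_int (int k - int l) * ptrace n (int k - int l) M))"
      unfolding sum.distrib sum_distrib_right[symmetric] sum_distrib_left[symmetric] ptrace_def[symmetric] ..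
    also have "\<dots> = of_nat k * qtrace k M"
      unfolding qtrace_def sum_distrib_left by (intro sum.cong refl) (simp add: algebra_simps)
    finally show ?thesis .
  qed
  have gen: "(\<Sum>c<n. A c * x + y * - cnj (B c)) = (\<Sum>c<n. A c) * x - y * cnj (\<Sum>c<n. B c)"
    for A B :: "nat \<Rightarrow> complex" and x y
    by (simp add: sum.distrib sum_distrib_left sum_distrib_right sum_negf sum_subtractf)
  show "(\<Sum>c<n. ?K k M c c * cnj (qtrace l M) + qtrace k M * - cnj (?K l M c c)) =
     (of_nat k - of_nat l) * (qtrace k M * cnj (qtrace l M))"
    unfolding gen tr by (simp add: algebra_simps)
qed

lemma qtrace_norm_bound:
  assumes k: "0 < k"
  shows "(LINT M|H. (cmod (qtrace k M))\<^sup>2) \<le> real k ^ 3"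
proof -
  define v where "v = (\<lambda>k. real (min k n))"
  have E_split: "(LINT M|H. (of_nat n * ptrace n (int k) M + qtrace k M) * G M + R M) =
     of_nat n * (LINT M|H. ptrace n (int k) M * G M) + (LINT M|H. qtrace k M * G M) + (LINT M|H. R M)"
    if "regular G" "regular R" for G R
  proof -
    have "(LINT M|H. (of_nat n * ptrace n (int k) M + qtrace k M) * G M + R M) =
      (LINT M|H. (of_nat n * (ptrace n (int k) M * G M) + qtrace k M * G M) + R M)"
      by (simp only: distrib_right mult.assoc)
    also have "\<dots> = (LINT M|H. of_nat n * (ptrace n (int k) M * G M) + qtrace k M * G M) + (LINT M|H. R M)"
      by (rule Bochner_Integration.integral_add) (rule regular_integrable, intro regular_intros that)+
    also have "(LINT M|H. of_nat n * (ptrace n (int k) M * G M) + qtrace k M * G M) =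
       (LINT M|H. of_nat n * (ptrace n (int k) M * G M)) + (LINT M|H. qtrace k M * G M)"
      by (rule Bochner_Integration.integral_add) (rule regular_integrable, intro regular_intros that)+
    finally show ?thesis by (simp only: integral_mult_right_zero)
  qed
  have Ep: "(LINT M|H. ptrace n (int l) M * ptrace n (- int l) M) = of_real (v l)" if "0 < l" for l
    using ptrace_variance[OF that] by (simp add: v_def)
  have 1: "(LINT M|H. qtrace k M * ptrace n (- int k) M) = of_real (n * (k - v k))"
  proof -
    have "0 = (LINT M|H. (of_nat n * ptrace n (int k) M + qtrace k M) * ptrace n (- int k) M
      + (\<Sum>i<n. \<Sum>j<n. mpow M (int k) i j * (of_int (- int k) * mpow M (- int k) j i)))"
      by (rule loop_equation[OF has_gradient_ptrace k, symmetric])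
    also have "\<dots> = (LINT M|H. (of_nat n * ptrace n (int k) M + qtrace k M) * ptrace n (- int k) M
      + of_int (- int k) * of_nat n)"
    proof (rule integral_cong_unitary)
      fix M assume M: "M \<in> unitary_group n"
      have "(\<Sum>i<n. \<Sum>j<n. mpow M (int k) i j * (of_int (- int k) * mpow M (- int k) j i)) =
        of_int (- int k) * (\<Sum>i<n. \<Sum>j<n. mpow M (int k) i j * mpow M (- int k) j i)"
        unfolding sum_distrib_left by (intro sum.cong refl) (simp only: mult_ac)
      thus "(of_nat n * ptrace n (int k) M + qtrace k M) * ptrace n (- int k) M
      + (\<Sum>i<n. \<Sum>j<n. mpow M (int k) i j * (of_int (- int k) * mpow M (- int k) j i)) =
        (of_nat n * ptrace n (int k) M + qtrace k M) * ptrace n (- int k) M + of_int (- int k) * of_nat n"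
        unfolding mpow_trace_mult[OF M] by (simp add: ptrace_0[OF M])
    qed
    also have "\<dots> = of_nat n * of_real (v k) + (LINT M|H. qtrace k M * ptrace n (- int k) M) + of_int (- int k) * of_nat n"
      by (subst E_split) (auto simp: Ep[OF k] prob_space intro!: regular_ptrace)
    finally show ?thesis by (simp add: algebra_simps)
  qed
  let ?G = "\<lambda>M. \<Sum>l=1..<k. ptrace n (- int l) M * ptrace n (int l - int k) M"
  let ?K = "\<lambda>M a b. \<Sum>l=1..<k. of_int (- int l) * mpow M (- int l) a b * ptrace n (int l - int k) M
     + ptrace n (- int l) M * (of_int (int l - int k) * mpow M (int l - int k) a b)"
  have cnjQ: "cnj (qtrace k M) = ?G M" if "M \<in> unitary_group n" for M
    unfolding qtrace_def cnj_sum complex_cnj_mult ptrace_minus[OF that, symmetric] by simp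
  have G: "has_gradient ?G ?K"
    by (intro has_gradient_sum has_gradient_mult has_gradient_ptrace)
  let ?R = "\<lambda>M. \<Sum>l=1..<k. - of_nat l * (ptrace n (int (k - l)) M * ptrace n (- int (k - l)) M)
     - of_nat (k - l) * (ptrace n (int l) M * ptrace n (- int l) M)"
  have "0 = (LINT M|H. (of_nat n * ptrace n (int k) M + qtrace k M) * ?G M
      + (\<Sum>i<n. \<Sum>j<n. mpow M (int k) i j * ?K M j i))"
    by (rule loop_equation[OF G k, symmetric])
  also have "\<dots> = (LINT M|H. (of_nat n * ptrace n (int k) M + qtrace k M) * ?G M + ?R M)"
  proof (rule integral_cong_unitary)
    fix M assume M: "M \<in> unitary_group n"
    have "(\<Sum>i<n. \<Sum>j<n. mpow M (int k) i j * ?K M j i) = (\<Sum>i<n. \<Sum>l=1..<k. \<Sum>j<n. 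
       (of_int (- int l) * ptrace n (int l - int k) M) * (mpow M (int k) i j * mpow M (- int l) j i)
     + (ptrace n (- int l) M * of_int (int l - int k)) * (mpow M (int k) i j * mpow M (int l - int k) j i))"
      unfolding sum_distrib_left
      by (subst sum.swap) (intro sum.cong refl, simp only: distrib_left mult_ac)
    also have "\<dots> = (\<Sum>l=1..<k. \<Sum>i<n. \<Sum>j<n. 
       (of_int (- int l) * ptrace n (int l - int k) M) * (mpow M (int k) i j * mpow M (- int l) j i)
     + (ptrace n (- int l) M * of_int (int l - int k)) * (mpow M (int k) i j * mpow M (int l - int k) j i))"
      by (rule sum.swap)
    also have "\<dots> = (\<Sum>l=1..<k. (of_int (- int l) * ptrace n (int l - int k) M) * ptrace n (int k + - int l) M
     + (ptrace n (- int l) M * of_int (int l - int k)) * ptrace n (int k + (int l - int k)) M)"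
      unfolding sum.distrib sum_distrib_left[symmetric] mpow_trace_mult[OF M] ..
    also have "\<dots> = ?R M"
      by (intro sum.cong refl) (simp add: of_nat_diff algebra_simps)
    finally show "(of_nat n * ptrace n (int k) M + qtrace k M) * ?G M + (\<Sum>i<n. \<Sum>j<n. mpow M (int k) i j * ?K M j i)
      = (of_nat n * ptrace n (int k) M + qtrace k M) * ?G M + ?R M" by (simp only:)
  qed
  also have "\<dots> = of_nat n * (LINT M|H. ptrace n (int k) M * ?G M) + (LINT M|H. qtrace k M * ?G M) + (LINT M|H. ?R M)"
    by (rule E_split) (intro regular_intros)+
  also have "(LINT M|H. ptrace n (int k) M * ?G M) = of_real (n * (k - v k))"
  proof -
    have "(LINT M|H. ptrace n (int k) M * ?G M) = (LINT M|H. cnj (qtrace k M * ptrace n (- int k) M))"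
    proof (rule integral_cong_unitary)
      fix M assume M: "M \<in> unitary_group n"
      show "ptrace n (int k) M * ?G M = cnj (qtrace k M * ptrace n (- int k) M)"
        unfolding cnjQ[OF M, symmetric] unfolding complex_cnj_mult ptrace_minus[OF M] complex_cnj_cnj
        by (rule mult.commute)
    qed
    also have "\<dots> = cnj (LINT M|H. qtrace k M * ptrace n (- int k) M)"
      by (rule Bochner_Integration.integral_cnj)
    also have "\<dots> = of_real (n * (k - v k))" unfolding 1 by (rule complex_cnj_complex_of_real)
    finally show ?thesis .
  qed
  also have "(LINT M|H. qtrace k M * ?G M) = of_real (LINT M|H. (cmod (qtrace k M))\<^sup>2)"
    unfolding integral_complex_of_real[symmetric]
    by (rule integral_cong_unitary) (simp only: cnjQ[symmetric] complex_norm_square)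
  also have "(LINT M|H. ?R M) = of_real (\<Sum>l=1..<k. - l * v (k - l) - (k - l) * v l)"
  proof -
    have "(LINT M|H. ?R M) = (\<Sum>l=1..<k. - of_nat l * (LINT M|H. ptrace n (int (k - l)) M * ptrace n (- int (k - l)) M)
     - of_nat (k - l) * (LINT M|H. ptrace n (int l) M * ptrace n (- int l) M))"
      by (subst expectation_sum, (intro regular_intros), intro sum.cong refl,
        subst Bochner_Integration.integral_diff, (rule regular_integrable, intro regular_intros)+)
        (simp only: integral_mult_right_zero)
    also have "\<dots> = of_real (\<Sum>l=1..<k. - l * v (k - l) - (k - l) * v l)"
      unfolding of_real_sum
    proof (intro sum.cong refl)
      fix l assume "l \<in> {1..<k}"
      hence l: "0 < l" "0 < k - l" by auto
      show "- of_nat l * (LINT M|H. ptrace n (int (k - l)) M * ptrace n (- int (k - l)) M)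
         - of_nat (k - l) * (LINT M|H. ptrace n (int l) M * ptrace n (- int l) M) =
         complex_of_real (- l * v (k - l) - (k - l) * v l)"
        unfolding Ep[OF l(1)] Ep[OF l(2)] by simp
    qed
    finally show ?thesis .
  qed
  finally have "complex_of_real (n * (n * (k - v k)) + (LINT M|H. (cmod (qtrace k M))\<^sup>2)
      + (\<Sum>l=1..<k. - l * v (k - l) - (k - l) * v l)) = 0"
    by (simp only: of_real_add of_real_mult of_real_of_nat_eq)
  hence "n * (n * (k - v k)) + (LINT M|H. (cmod (qtrace k M))\<^sup>2) + (\<Sum>l=1..<k. - l * v (k - l) - (k - l) * v l) = 0"
    by (simp only: of_real_eq_0_iff)
  moreover have "(\<Sum>l=1..<k. - l * v (k - l) - (k - l) * v l) = - (\<Sum>l=1..<k. l * v (k - l) + (k - l) * v l)"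
    unfolding sum_negf[symmetric] by (intro sum.cong refl) simp
  ultimately have "(LINT M|H. (cmod (qtrace k M))\<^sup>2) = (\<Sum>l=1..<k. l * v (k - l) + (k - l) * v l) - n * (n * (k - v k))"
    by linarith
  also have "\<dots> \<le> (\<Sum>l=1..<k. l * v (k - l) + (k - l) * v l)"
  proof -
    have "0 \<le> real n * (real n * (real k - v k))" by (simp add: v_def)
    thus ?thesis by linarith
  qed
  also have "\<dots> \<le> (\<Sum>l=1..<k. real k ^ 2)"
  proof (rule sum_mono)
    fix l assume l: "l \<in> {1..<k}"
    have k: "real k = real l + real (k - l)" using l by simp
    have a: "real l * v (k - l) \<le> real l * real (k - l)" unfolding v_def by (intro mult_left_mono) auto
    have "real (k - l) * v l \<le> real (k - l) * real l" unfolding v_def by (intro mult_left_mono) auto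
    hence b: "real (k - l) * v l \<le> real l * real (k - l)" by (simp only: mult.commute)
    have "real k ^ 2 - 4 * (real l * real (k - l)) = (real l - real (k - l))\<^sup>2"
      unfolding k by (simp add: power2_eq_square algebra_simps)
    hence "4 * (real l * real (k - l)) \<le> real k ^ 2" using zero_le_power2[of "real l - real (k - l)"] by linarith
    thus "l * v (k - l) + (k - l) * v l \<le> real k ^ 2"
      using a b zero_le_power2[of "real k"] by linarith
  qed
  also have "\<dots> \<le> real k ^ 3" 
  proof -
    have "real (k - 1) * real k ^ 2 \<le> real k * real k ^ 2" by (intro mult_right_mono) auto
    thus ?thesis by (simp add: power2_eq_square power3_eq_cube mult.assoc)
  qed
  finally show ?thesis .
qed

end

context haar_unitary
begin

lemma norm_expectation_mult_le:
  assumes "regular f" "regular g" "\<And>M. M \<in> unitary_group n \<Longrightarrow> cmod (g M) = 1"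
  shows "cmod (LINT M|H. f M * g M) \<le> sqrt (LINT M|H. (cmod (f M))\<^sup>2)"
proof -
  have "cmod (LINT M|H. f M * g M) \<le> (LINT M|H. cmod (f M * g M))" by (rule integral_norm_bound)
  also have "\<dots> = (LINT M|H. cmod (f M))"
    by (rule integral_cong_unitary) (simp add: norm_mult assms(3))
  also have "\<dots> \<le> sqrt (LINT M|H. (cmod (f M))\<^sup>2)" by (rule expectation_norm_le[OF assms(1)])
  finally show ?thesis .
qed

lemma char_ode_bound:
  fixes \<psi> D :: "real \<Rightarrow> complex"
  assumes deriv: "\<And>u. (\<psi> has_vector_derivative D u) (at u)" and \<psi>0: "\<psi> 0 = 1"
    and bound: "\<And>u. cmod (D u + of_real (u * v) * \<psi> u) \<le> a + \<bar>u\<bar> * b" and "0 \<le> a" "0 \<le> b" "0 \<le> v"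
  shows "cmod (\<psi> s - exp (- (v * s\<^sup>2 / 2))) \<le> \<bar>s\<bar> * (a + \<bar>s\<bar> * b)"
proof -
  define E where "E = (\<lambda>u. exp (v * u\<^sup>2 / 2))"
  define F where "F = (\<lambda>u. E u *\<^sub>R \<psi> u)"
  have E: "(E has_real_derivative (v * u) * E u) (at u)" for u
    unfolding E_def by (auto intro!: derivative_eq_intros)
  have F: "(F has_vector_derivative E u *\<^sub>R (D u + of_real (u * v) * \<psi> u)) (at u)" for u
    unfolding F_def
    by (rule has_vector_derivative_eq_rhs[OF has_vector_derivative_scaleR[OF E deriv]])
      (simp add: scaleR_conv_of_real algebra_simps)
  have "norm (F s - F 0) \<le> ((a + \<bar>s\<bar> * b) * E s) * norm (s - 0)"
  proof (rule differentiable_bound[of "closed_segment 0 s"])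
    fix u assume u: "u \<in> closed_segment 0 s"
    hence us: "\<bar>u\<bar> \<le> \<bar>s\<bar>" by (auto simp: closed_segment_eq_real_ivl split: if_splits)
    show "(F has_derivative (\<lambda>x. x *\<^sub>R (E u *\<^sub>R (D u + of_real (u * v) * \<psi> u)))) (at u within closed_segment 0 s)"
      using F[of u] has_derivative_at_withinI unfolding has_vector_derivative_def by blast
    have "u\<^sup>2 \<le> s\<^sup>2" using us by (simp only: abs_le_square_iff)
    hence "v * u\<^sup>2 / 2 \<le> v * s\<^sup>2 / 2" using \<open>0 \<le> v\<close> by (intro divide_right_mono mult_left_mono) auto
    hence "E u \<le> E s" by (simp add: E_def)
    moreover have "cmod (D u + of_real (u * v) * \<psi> u) \<le> a + \<bar>s\<bar> * b"
      using bound[of u] mult_right_mono[OF us \<open>0 \<le> b\<close>] by linarith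
    ultimately have "cmod (D u + of_real (u * v) * \<psi> u) * E u \<le> (a + \<bar>s\<bar> * b) * E s"
      using assms by (intro mult_mono) (auto simp: E_def)
    hence "norm (E u *\<^sub>R (D u + of_real (u * v) * \<psi> u)) \<le> (a + \<bar>s\<bar> * b) * E s"
      by (simp add: E_def mult.commute)
    thus "onorm (\<lambda>x. x *\<^sub>R (E u *\<^sub>R (D u + of_real (u * v) * \<psi> u))) \<le> (a + \<bar>s\<bar> * b) * E s"
      by (intro onorm_le) (simp only: norm_scaleR real_norm_def mult.commute mult_left_mono abs_ge_zero)
  qed auto
  moreover have "F s - F 0 = E s *\<^sub>R (\<psi> s - exp (- (v * s\<^sup>2 / 2)))"
    by (simp add: F_def \<psi>0 E_def scaleR_conv_of_real algebra_simps exp_minus flip: of_real_mult exp_of_real)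
  ultimately have "E s * cmod (\<psi> s - exp (- (v * s\<^sup>2 / 2))) \<le> E s * (\<bar>s\<bar> * (a + \<bar>s\<bar> * b))"
    by (simp add: E_def mult_ac)
  thus ?thesis by (simp add: E_def)
qed

lemma char_has_derivative:
  assumes X: "regular X" and real: "\<And>M. M \<in> unitary_group n \<Longrightarrow> X M \<in> \<real>"
  shows "((\<lambda>s. LINT M|H. exp (\<i> * of_real s * X M)) has_vector_derivative
      \<i> * (LINT M|H. X M * exp (\<i> * of_real s * X M))) (at s)"
proof -
  define \<psi> where "\<psi> = (\<lambda>s. LINT M|H. exp (\<i> * of_real s * X M))"
  define D where "D = \<i> * (LINT M|H. X M * exp (\<i> * of_real s * X M))"
  obtain C where C: "\<And>M. M \<in> unitary_group n \<Longrightarrow> cmod (X M) \<le> C" using X unfolding regular_def by blast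
  have C0: "0 \<le> C" using C[OF unitary_group_one] norm_ge_zero order_trans by blast
  have bd: "cmod (\<psi> (s + h) - \<psi> s - h *\<^sub>R D) \<le> C\<^sup>2 * h\<^sup>2" for h
  proof -
    have reg: "regular (\<lambda>M. exp (\<i> * of_real u * X M))" for u by (intro regular_intros X)
    have "\<psi> (s + h) - \<psi> s - h *\<^sub>R D =
      (LINT M|H. exp (\<i> * of_real (s + h) * X M)) - (LINT M|H. exp (\<i> * of_real s * X M))
       - (LINT M|H. (of_real h * \<i>) * (X M * exp (\<i> * of_real s * X M)))"
      by (simp add: \<psi>_def D_def scaleR_conv_of_real)
    also have "\<dots> = (LINT M|H. exp (\<i> * of_real (s + h) * X M) - exp (\<i> * of_real s * X M)
       - (of_real h * \<i>) * (X M * exp (\<i> * of_real s * X M)))"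
      by (subst Bochner_Integration.integral_diff, (rule regular_integrable, intro regular_intros X)+,
        subst Bochner_Integration.integral_diff, (rule regular_integrable, intro regular_intros X)+) (rule refl)
    finally have "cmod (\<psi> (s + h) - \<psi> s - h *\<^sub>R D) \<le> (LINT M|H. cmod (exp (\<i> * of_real (s + h) * X M) - exp (\<i> * of_real s * X M)
       - (of_real h * \<i>) * (X M * exp (\<i> * of_real s * X M))))"
      by (simp only: integral_norm_bound)
    also have "\<dots> \<le> (LINT M|H. C\<^sup>2 * h\<^sup>2)"
    proof (rule integral_mono)
      show "integrable H (\<lambda>M. cmod (exp (\<i> * of_real (s + h) * X M) - exp (\<i> * of_real s * X M)
       - (of_real h * \<i>) * (X M * exp (\<i> * of_real s * X M))))"
        by (rule integrable_norm, rule regular_integrable) (intro regular_intros X)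
      fix M assume "M \<in> space H"
      hence M: "M \<in> unitary_group n" by (simp add: space_H)
      from real[OF M] obtain x where x: "X M = of_real x" by (auto elim: Reals_cases)
      have xC: "\<bar>x\<bar> \<le> C" using C[OF M] by (simp add: x)
      have "exp (\<i> * of_real (s + h) * X M) - exp (\<i> * of_real s * X M) - (of_real h * \<i>) * (X M * exp (\<i> * of_real s * X M))
        = iexp (s * x) * (iexp (h * x) - (\<Sum>k\<le>1. (\<i> * of_real (h * x)) ^ k / fact k))"
        by (simp add: x algebra_simps exp_add[symmetric])
      also have "cmod \<dots> \<le> \<bar>h * x\<bar> ^ Suc 1 / fact (Suc 1)"
        unfolding norm_mult using iexp_approx1[of "h * x" 1] by simp
      also have "\<dots> = (h * x)\<^sup>2 / 2" by (simp only: Suc_1 power2_abs fact_2)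
      also have "\<dots> \<le> (h * x)\<^sup>2" by simp
      also have "\<dots> \<le> C\<^sup>2 * h\<^sup>2"
      proof -
        have "x\<^sup>2 \<le> C\<^sup>2" using power_mono[OF xC, of 2] by simp
        thus ?thesis by (simp add: power_mult_distrib mult.commute[of "h\<^sup>2"] mult_right_mono)
      qed
      finally show "cmod (exp (\<i> * of_real (s + h) * X M) - exp (\<i> * of_real s * X M)
       - (of_real h * \<i>) * (X M * exp (\<i> * of_real s * X M))) \<le> C\<^sup>2 * h\<^sup>2" .
    qed auto
    also have "\<dots> = C\<^sup>2 * h\<^sup>2" by (simp add: prob_space)
    finally show ?thesis .
  qed
  have "((\<lambda>h. norm (\<psi> (s + h) - \<psi> s - h *\<^sub>R D) / norm h) \<longlongrightarrow> 0) (at 0)"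
  proof (rule tendsto_sandwich[OF _ _ tendsto_const])
    show "\<forall>\<^sub>F h in at 0. 0 \<le> norm (\<psi> (s + h) - \<psi> s - h *\<^sub>R D) / norm h" by simp
    show "\<forall>\<^sub>F h in at 0. norm (\<psi> (s + h) - \<psi> s - h *\<^sub>R D) / norm h \<le> C\<^sup>2 * \<bar>h\<bar>"
    proof (rule eventually_at_filter[THEN iffD2], rule always_eventually, intro allI impI)
      fix h :: real assume "h \<noteq> 0"
      thus "norm (\<psi> (s + h) - \<psi> s - h *\<^sub>R D) / norm h \<le> C\<^sup>2 * \<bar>h\<bar>"
        using bd[of h] by (simp add: divide_simps power2_eq_square mult.assoc)
    qed
    show "((\<lambda>h. C\<^sup>2 * \<bar>h\<bar>) \<longlongrightarrow> 0) (at 0)" by (auto intro!: tendsto_eq_intros)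
  qed
  hence "(\<psi> has_vector_derivative D) (at s)"
    by (simp add: has_vector_derivative_def has_derivative_at bounded_linear_scaleR_left)
  thus ?thesis by (simp add: \<psi>_def D_def)
qed

lemma trig_sum_char_bound:
  fixes c :: "int \<Rightarrow> complex" and N :: nat
  assumes c: "\<And>k. c (- k) = cnj (c k)"
  defines "I \<equiv> {- int N..int N} - {0}"
  defines "X \<equiv> \<lambda>M. \<Sum>k\<in>I. c k * ptrace n k M"
  shows "cmod ((LINT M|H. exp (\<i> * of_real s * X M)) - exp (- (2 * (\<Sum>k\<in>{1..int N}. of_int k * (cmod (c k))\<^sup>2) * s\<^sup>2 / 2)))
    \<le> \<bar>s\<bar> * (2 / n * sqrt (\<Sum>k\<in>{1..int N}. (cmod (c k))\<^sup>2 * of_int k ^ 3) + \<bar>s\<bar> *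
        (2 / n * (\<Sum>k\<in>{1..int N}. cmod (c k) * sqrt (\<Sum>m\<in>I. (cmod (c m))\<^sup>2 * of_int m ^ 2 * (of_int k + \<bar>of_int m\<bar>)))))"
proof -
  define P where "P = {1..int N}"
  define Xp where "Xp = (\<lambda>M. \<Sum>k\<in>P. c k * ptrace n k M)"
  define G where "G = (\<lambda>s M. exp (\<i> * of_real s * X M))"
  define \<psi> where "\<psi> = (\<lambda>s. LINT M|H. G s M)"
  define v where "v = (\<Sum>k\<in>P. of_int k * (cmod (c k))\<^sup>2)"
  define Y where "Y = (\<lambda>k M. \<Sum>m\<in>I - {-k}. (c m * of_int m) * ptrace n (k + m) M)"
  define a where "a = sqrt (\<Sum>k\<in>P. (cmod (c k))\<^sup>2 * of_int k ^ 3)"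
  define b where "b = (\<Sum>k\<in>P. cmod (c k) * sqrt (\<Sum>m\<in>I. (cmod (c m))\<^sup>2 * of_int m ^ 2 * (of_int k + \<bar>of_int m\<bar>)))"
  have finI: "finite I" and finP: "finite P" by (auto simp: I_def P_def)
  have ab: "0 \<le> a" "0 \<le> b" "0 \<le> v"
    unfolding a_def b_def v_def by (auto simp: P_def intro!: sum_nonneg mult_nonneg_nonneg)
  have regX: "regular X" unfolding X_def by (intro regular_intros)
  have regXp: "regular Xp" unfolding Xp_def by (intro regular_intros)
  have regG: "regular (G s)" for s unfolding G_def by (intro regular_intros regX)
  have regY: "regular (Y k)" for k unfolding Y_def by (intro regular_intros)
  have split: "X M = Xp M + cnj (Xp M)" if "M \<in> unitary_group n" for M
  proof -
    have "X M = (\<Sum>k\<in>P. c k * ptrace n k M) + (\<Sum>k\<in>uminus ` P. c k * ptrace n k M)"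
      unfolding X_def by (subst sum.union_disjoint[symmetric]) (auto simp: P_def I_def intro!: sum.cong)
    also have "(\<Sum>k\<in>uminus ` P. c k * ptrace n k M) = cnj (Xp M)"
      unfolding Xp_def by (subst sum.reindex) (auto simp: c ptrace_minus[OF that] o_def)
    finally show ?thesis by (simp add: Xp_def)
  qed
  have Xreal: "X M \<in> \<real>" if "M \<in> unitary_group n" for M
    unfolding split[OF that] by (simp add: complex_is_Real_iff)
  have normG: "cmod (G s M) = 1" and cnjG: "cnj (G s M) = G (- s) M" if "M \<in> unitary_group n" for s M
  proof -
    from Xreal[OF that] obtain x where "X M = of_real x" by (auto elim: Reals_cases)
    thus "cmod (G s M) = 1" "cnj (G s M) = G (- s) M" by (simp_all add: G_def norm_exp_eq_Re exp_cnj)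
  qed
  have loop: "of_nat n * (LINT M|H. ptrace n k M * G s M) = - (LINT M|H. qtrace (nat k) M * G s M)
     - \<i> * of_real s * (LINT M|H. Y k M * G s M) + \<i> * of_real s * of_nat n * (of_int k * cnj (c k)) * \<psi> s"
    if k: "k \<in> P" for k s
  proof -
    define q where "q = nat k"
    have q: "0 < q" "int q = k" using k by (auto simp: q_def P_def)
    have mk: "- k \<in> I" using k by (auto simp: P_def I_def)
    let ?K = "\<lambda>M a b. exp (\<i> * of_real s * X M) * (\<i> * of_real s * (\<Sum>m\<in>I. c m * (of_int m * mpow M m a b)))"
    have "has_gradient (G s) ?K"
      unfolding G_def X_def
      by (intro has_gradient_exp has_gradient_cmult has_gradient_sum has_gradient_ptrace)
    from loop_equation[OF this q(1)]
    have "0 = (LINT M|H. (of_nat n * ptrace n (int q) M + qtrace q M) * G s M + (\<Sum>i<n. \<Sum>j<n. mpow M (int q) i j * ?K M j i))"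
      by (rule sym)
    also have "\<dots> = (LINT M|H. of_nat n * (ptrace n k M * G s M) + (qtrace (nat k) M * G s M
       + (\<i> * of_real s * (Y k M * G s M) - \<i> * of_real s * of_nat n * (of_int k * cnj (c k)) * G s M)))"
    proof (rule integral_cong_unitary)
      fix M assume M: "M \<in> unitary_group n"
      have "(\<Sum>i<n. \<Sum>j<n. mpow M (int q) i j * ?K M j i) = (\<Sum>i<n. \<Sum>j<n. \<Sum>m\<in>I.
         (\<i> * of_real s * G s M * (c m * of_int m)) * (mpow M k i j * mpow M m j i))"
        unfolding sum_distrib_left G_def q by (intro sum.cong refl) (simp only: mult_ac)
      also have "\<dots> = (\<Sum>i<n. \<Sum>m\<in>I. \<Sum>j<n.
         (\<i> * of_real s * G s M * (c m * of_int m)) * (mpow M k i j * mpow M m j i))"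
        by (intro sum.cong refl sum.swap)
      also have "\<dots> = (\<Sum>m\<in>I. \<Sum>i<n. \<Sum>j<n.
         (\<i> * of_real s * G s M * (c m * of_int m)) * (mpow M k i j * mpow M m j i))"
        by (rule sum.swap)
      also have "\<dots> = (\<Sum>m\<in>I. (\<i> * of_real s * G s M * (c m * of_int m)) * ptrace n (k + m) M)"
        unfolding sum_distrib_left[symmetric] mpow_trace_mult[OF M] ..
      also have "\<dots> = \<i> * of_real s * G s M * (\<Sum>m\<in>I. (c m * of_int m) * ptrace n (k + m) M)"
        unfolding sum_distrib_left by (intro sum.cong refl) (simp only: mult_ac)
      also have "(\<Sum>m\<in>I. (c m * of_int m) * ptrace n (k + m) M) = Y k M - of_nat n * (of_int k * cnj (c k))"
        unfolding Y_def by (subst sum.remove[OF finI mk]) (simp add: c ptrace_0[OF M])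
      finally show "(of_nat n * ptrace n (int q) M + qtrace q M) * G s M + (\<Sum>i<n. \<Sum>j<n. mpow M (int q) i j * ?K M j i)
        = of_nat n * (ptrace n k M * G s M) + (qtrace (nat k) M * G s M
       + (\<i> * of_real s * (Y k M * G s M) - \<i> * of_real s * of_nat n * (of_int k * cnj (c k)) * G s M))"
        unfolding q(2) q_def[symmetric] by (simp add: algebra_simps)
    qed
    also have "\<dots> = of_nat n * (LINT M|H. ptrace n k M * G s M) + ((LINT M|H. qtrace (nat k) M * G s M)
       + (\<i> * of_real s * (LINT M|H. Y k M * G s M) - \<i> * of_real s * of_nat n * (of_int k * cnj (c k)) * \<psi> s))"
      unfolding \<psi>_def integral_mult_right_zero[symmetric]
      by (subst Bochner_Integration.integral_add, (rule regular_integrable, intro regular_intros regG regY)+,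
        subst Bochner_Integration.integral_add, (rule regular_integrable, intro regular_intros regG regY)+,
        subst Bochner_Integration.integral_diff, (rule regular_integrable, intro regular_intros regG regY)+) (rule refl)
    finally show ?thesis by (simp add: algebra_simps)
  qed
  have boundQ: "cmod (LINT M|H. (\<Sum>k\<in>P. c k * qtrace (nat k) M) * G s M) \<le> a" for s
  proof -
    have "cmod (LINT M|H. (\<Sum>k\<in>P. c k * qtrace (nat k) M) * G s M) \<le> sqrt (LINT M|H. (cmod (\<Sum>k\<in>P. c k * qtrace (nat k) M))\<^sup>2)"
      by (intro norm_expectation_mult_le regular_intros regG normG)
    also have "(LINT M|H. (cmod (\<Sum>k\<in>P. c k * qtrace (nat k) M))\<^sup>2) = (\<Sum>k\<in>P. (cmod (c k))\<^sup>2 * (LINT M|H. (cmod (qtrace (nat k) M))\<^sup>2))"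
      by (intro expectation_norm_sum regular_intros qtrace_orthogonal) (auto simp: P_def)
    also have "sqrt \<dots> \<le> a"
      unfolding a_def
    proof (intro real_sqrt_le_mono sum_mono mult_left_mono)
      fix k assume "k \<in> P"
      thus "(LINT M|H. (cmod (qtrace (nat k) M))\<^sup>2) \<le> of_int k ^ 3"
        using qtrace_norm_bound[of "nat k"] by (simp add: P_def)
    qed auto
    finally show ?thesis .
  qed
  have boundY: "cmod (LINT M|H. Y k M * G s M) \<le> sqrt (\<Sum>m\<in>I. (cmod (c m))\<^sup>2 * of_int m ^ 2 * (of_int k + \<bar>of_int m\<bar>))"
    if "k \<in> P" for k s
  proof -
    have "cmod (LINT M|H. Y k M * G s M) \<le> sqrt (LINT M|H. (cmod (Y k M))\<^sup>2)"
      by (intro norm_expectation_mult_le regY regG normG)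
    also have "(LINT M|H. (cmod (Y k M))\<^sup>2) = (\<Sum>m\<in>I - {-k}. (cmod (c m * of_int m))\<^sup>2 * real (min (nat \<bar>k + m\<bar>) n))"
      unfolding Y_def by (rule ptrace_sum_norm_expectation) auto
    also have "\<dots> \<le> (\<Sum>m\<in>I - {-k}. (cmod (c m))\<^sup>2 * of_int m ^ 2 * (of_int k + \<bar>of_int m\<bar>))"
    proof (rule sum_mono)
      fix m
      have "real (min (nat \<bar>k + m\<bar>) n) \<le> of_int k + \<bar>of_int m\<bar>"
        using that by (auto simp: P_def min_def)
      thus "(cmod (c m * of_int m))\<^sup>2 * real (min (nat \<bar>k + m\<bar>) n) \<le> (cmod (c m))\<^sup>2 * of_int m ^ 2 * (of_int k + \<bar>of_int m\<bar>)"
        by (simp add: norm_mult power_mult_distrib mult_left_mono)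
    qed
    also have "\<dots> \<le> (\<Sum>m\<in>I. (cmod (c m))\<^sup>2 * of_int m ^ 2 * (of_int k + \<bar>of_int m\<bar>))"
      using that by (intro sum_mono2 finI) (auto simp: P_def)
    finally show ?thesis by simp
  qed
  have Ap: "cmod ((LINT M|H. Xp M * G s M) - \<i> * of_real (s * v) * \<psi> s) \<le> (a + \<bar>s\<bar> * b) / n" for s
  proof -
    have 1: "(LINT M|H. Xp M * G s M) = (\<Sum>k\<in>P. c k * (LINT M|H. ptrace n k M * G s M))"
    proof -
      have "(LINT M|H. Xp M * G s M) = (LINT M|H. (\<Sum>k\<in>P. c k * (ptrace n k M * G s M)))"
        unfolding Xp_def sum_distrib_right mult.assoc ..
      also have "\<dots> = (\<Sum>k\<in>P. c k * (LINT M|H. ptrace n k M * G s M))"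
        by (subst expectation_sum, intro regular_intros regG) (simp only: integral_mult_right_zero)
      finally show ?thesis .
    qed
    have 2: "(LINT M|H. (\<Sum>k\<in>P. c k * qtrace (nat k) M) * G s M) = (\<Sum>k\<in>P. c k * (LINT M|H. qtrace (nat k) M * G s M))"
    proof -
      have "(LINT M|H. (\<Sum>k\<in>P. c k * qtrace (nat k) M) * G s M) = (LINT M|H. (\<Sum>k\<in>P. c k * (qtrace (nat k) M * G s M)))"
        unfolding sum_distrib_right mult.assoc ..
      also have "\<dots> = (\<Sum>k\<in>P. c k * (LINT M|H. qtrace (nat k) M * G s M))"
        by (subst expectation_sum, intro regular_intros regG) (simp only: integral_mult_right_zero)
      finally show ?thesis .
    qed
    have 3: "(\<Sum>k\<in>P. c k * (of_int k * cnj (c k))) = of_real v"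
      unfolding v_def of_real_sum by (intro sum.cong refl) (simp add: complex_norm_square mult_ac del: of_real_power)
    have "of_nat n * (LINT M|H. Xp M * G s M) = (\<Sum>k\<in>P. c k * (of_nat n * (LINT M|H. ptrace n k M * G s M)))"
      unfolding 1 sum_distrib_left by (intro sum.cong refl) (simp only: mult_ac)
    also have "\<dots> = (\<Sum>k\<in>P. c k * (- (LINT M|H. qtrace (nat k) M * G s M)
     - \<i> * of_real s * (LINT M|H. Y k M * G s M) + \<i> * of_real s * of_nat n * (of_int k * cnj (c k)) * \<psi> s))"
      by (intro sum.cong refl) (simp only: loop)
    also have "\<dots> = - (\<Sum>k\<in>P. c k * (LINT M|H. qtrace (nat k) M * G s M)) - \<i> * of_real s * (\<Sum>k\<in>P. c k * (LINT M|H. Y k M * G s M))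
       + \<i> * of_real s * of_nat n * (\<Sum>k\<in>P. c k * (of_int k * cnj (c k))) * \<psi> s"
    proof -
      have "(\<Sum>k\<in>P. f k * (- q k - u * y k + u * m * w k * p)) =
         - (\<Sum>k\<in>P. f k * q k) - u * (\<Sum>k\<in>P. f k * y k) + u * m * (\<Sum>k\<in>P. f k * w k) * p"
        for f q y w :: "int \<Rightarrow> complex" and u m p
        unfolding sum_distrib_left sum_distrib_right sum_negf[symmetric] sum_subtractf[symmetric] sum.distrib[symmetric]
        by (intro sum.cong refl) (simp add: algebra_simps)
      thus ?thesis .
    qed
    finally have e: "of_nat n * (LINT M|H. Xp M * G s M) =
       - (LINT M|H. (\<Sum>k\<in>P. c k * qtrace (nat k) M) * G s M) - \<i> * of_real s * (\<Sum>k\<in>P. c k * (LINT M|H. Y k M * G s M))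
       + \<i> * of_real s * of_nat n * of_real v * \<psi> s"
      unfolding 2 3 .
    have gen2: "m * (A - \<i> * of_real (s * v) * p) = m * A - \<i> * of_real s * m * of_real v * p" for m A p
      by (simp add: algebra_simps)
    have "of_nat n * ((LINT M|H. Xp M * G s M) - \<i> * of_real (s * v) * \<psi> s) =
       - ((LINT M|H. (\<Sum>k\<in>P. c k * qtrace (nat k) M) * G s M) + \<i> * of_real s * (\<Sum>k\<in>P. c k * (LINT M|H. Y k M * G s M)))"
      unfolding gen2 e by simp
    from arg_cong[OF this, of cmod] have "real n * cmod ((LINT M|H. Xp M * G s M) - \<i> * of_real (s * v) * \<psi> s) =
       cmod ((LINT M|H. (\<Sum>k\<in>P. c k * qtrace (nat k) M) * G s M) + \<i> * of_real s * (\<Sum>k\<in>P. c k * (LINT M|H. Y k M * G s M)))"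
      unfolding norm_mult norm_minus_cancel norm_of_nat .
    also have "\<dots> \<le> cmod (LINT M|H. (\<Sum>k\<in>P. c k * qtrace (nat k) M) * G s M) + cmod (\<i> * of_real s * (\<Sum>k\<in>P. c k * (LINT M|H. Y k M * G s M)))"
      by (rule norm_triangle_ineq)
    also have "\<dots> \<le> a + \<bar>s\<bar> * b"
    proof (intro add_mono boundQ)
      have "cmod (\<Sum>k\<in>P. c k * (LINT M|H. Y k M * G s M)) \<le> b"
        unfolding b_def by (rule sum_norm_le) (auto simp: norm_mult intro!: mult_left_mono boundY)
      thus "cmod (\<i> * of_real s * (\<Sum>k\<in>P. c k * (LINT M|H. Y k M * G s M))) \<le> \<bar>s\<bar> * b"
        by (simp add: norm_mult mult_left_mono)
    qed
    finally show ?thesis using n_pos by (simp add: field_simps)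
  qed
  have cnj\<psi>: "cnj (\<psi> (- s)) = \<psi> s" for s
    unfolding \<psi>_def Bochner_Integration.integral_cnj[symmetric]
    by (rule integral_cong_unitary) (simp add: cnjG)
  have Am: "cmod ((LINT M|H. cnj (Xp M) * G s M) - \<i> * of_real (s * v) * \<psi> s) \<le> (a + \<bar>s\<bar> * b) / n" for s
  proof -
    have "(LINT M|H. cnj (Xp M) * G s M) = cnj (LINT M|H. Xp M * G (- s) M)"
      unfolding Bochner_Integration.integral_cnj[symmetric]
      by (rule integral_cong_unitary) (simp add: cnjG)
    hence "(LINT M|H. cnj (Xp M) * G s M) - \<i> * of_real (s * v) * \<psi> s = cnj ((LINT M|H. Xp M * G (- s) M) - \<i> * of_real (- s * v) * \<psi> (- s))"
      by (simp add: cnj\<psi>)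
    thus ?thesis using Ap[of "- s"] by (metis abs_minus_cancel complex_mod_cnj)
  qed
  have A: "(LINT M|H. X M * G s M) = (LINT M|H. Xp M * G s M) + (LINT M|H. cnj (Xp M) * G s M)" for s
  proof -
    have "(LINT M|H. X M * G s M) = (LINT M|H. Xp M * G s M + cnj (Xp M) * G s M)"
      by (rule integral_cong_unitary) (simp add: split algebra_simps)
    also have "\<dots> = (LINT M|H. Xp M * G s M) + (LINT M|H. cnj (Xp M) * G s M)"
      by (rule Bochner_Integration.integral_add) (rule regular_integrable, intro regular_intros regXp regG)+
    finally show ?thesis .
  qed
  have "cmod (\<psi> s - exp (- ((2 * v) * s\<^sup>2 / 2))) \<le> \<bar>s\<bar> * (2 / n * a + \<bar>s\<bar> * (2 / n * b))"
  proof (rule char_ode_bound)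
    fix u
    show "(\<psi> has_vector_derivative \<i> * (LINT M|H. X M * G u M)) (at u)"
      unfolding \<psi>_def G_def by (rule char_has_derivative[OF regX Xreal])
    have "\<i> * (LINT M|H. X M * G u M) + of_real (u * (2 * v)) * \<psi> u =
      \<i> * (((LINT M|H. Xp M * G u M) - \<i> * of_real (u * v) * \<psi> u) + ((LINT M|H. cnj (Xp M) * G u M) - \<i> * of_real (u * v) * \<psi> u))"
      unfolding A by (simp add: algebra_simps)
    also have "cmod \<dots> \<le> (a + \<bar>u\<bar> * b) / n + (a + \<bar>u\<bar> * b) / n"
      unfolding norm_mult norm_ii mult_1_left by (intro norm_triangle_le add_mono Ap Am)
    also have "\<dots> = 2 / n * a + \<bar>u\<bar> * (2 / n * b)" using n_pos by (simp add: field_simps)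
    finally show "cmod (\<i> * (LINT M|H. X M * G u M) + of_real (u * (2 * v)) * \<psi> u) \<le> 2 / n * a + \<bar>u\<bar> * (2 / n * b)" .
  qed (use ab in \<open>auto simp: \<psi>_def G_def prob_space\<close>)
  thus ?thesis unfolding \<psi>_def G_def v_def a_def b_def P_def .
qed

end

section \<open>Fourier series on the circle\<close>

definition circ :: "real measure" where
  "circ = restrict_space lborel {-pi..<pi}"

definition fc :: "(real \<Rightarrow> complex) \<Rightarrow> int \<Rightarrow> complex" where
  "fc \<phi> k = (LINT x|circ. \<phi> x * cis (- (of_int k * x))) / (2 * pi)"

lemma space_circ: "space circ = {-pi..<pi}"
  by (simp add: circ_def space_restrict_space)

lemma integral_circ:
  fixes f :: "real \<Rightarrow> 'a :: {banach, second_countable_topology}"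
  shows "(LINT x|circ. f x) = (LINT x:{-pi..<pi}|lborel. f x)"
  unfolding circ_def set_lebesgue_integral_def by (subst integral_restrict_space) auto

lemma borel_measurable_circ: "f \<in> borel_measurable borel \<Longrightarrow> f \<in> borel_measurable circ"
  unfolding circ_def by (rule measurable_restrict_space1) simp

lemma measure_circ: "Sigma_Algebra.measure circ (space circ) = 2 * pi" "emeasure circ (space circ) = ennreal (2 * pi)"
proof -
  have "emeasure circ (space circ) = emeasure lborel {-pi..<pi}"
    unfolding space_circ unfolding circ_def by (subst emeasure_restrict_space) auto
  thus "emeasure circ (space circ) = ennreal (2 * pi)" by simp
  thus "Sigma_Algebra.measure circ (space circ) = 2 * pi" by (simp add: Sigma_Algebra.measure_def)
qed

interpretation circ: finite_measure circ
  by standard (simp add: measure_circ)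

lemma integrable_circ:
  fixes f :: "real \<Rightarrow> 'a :: {banach, second_countable_topology}"
  assumes "f \<in> borel_measurable circ" "\<And>x. x \<in> {-pi..<pi} \<Longrightarrow> norm (f x) \<le> C"
  shows "integrable circ f"
  using assms by (intro circ.integrable_const_bound[of _ C]) (auto simp: space_circ)

lemma cis_measurable: "(\<lambda>x. cis (a * x)) \<in> borel_measurable circ" "(\<lambda>x. cis (- (a * x))) \<in> borel_measurable circ"
  by (intro borel_measurable_circ borel_measurable_continuous_onI continuous_intros)+

lemma integral_circ_cis: "(LINT x|circ. cis (of_int k * x)) = (if k = 0 then 2 * pi else 0)"
proof (cases "k = 0")
  case True
  have "(LINT x|circ. (1 :: complex)) = 2 * pi" by (simp add: measure_circ scaleR_conv_of_real)
  thus ?thesis using True by simp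
next
  case False
  have AE_eq: "AE x in lborel. indicator {-pi..<pi} x *\<^sub>R cis (of_int k * x) = indicator {-pi..pi} x *\<^sub>R cis (of_int k * x)"
    using AE_lborel_singleton[of pi] by eventually_elim (auto simp: indicator_def)
  have "(LINT x|circ. cis (of_int k * x)) = (LINT x|lborel. indicator {-pi..pi} x *\<^sub>R cis (of_int k * x))"
    unfolding integral_circ set_lebesgue_integral_def
  proof (rule integral_cong_AE)
    have cm: "(\<lambda>x. cis (of_int k * x)) \<in> borel_measurable lborel"
      by (simp, intro borel_measurable_continuous_onI continuous_intros)
    show "(\<lambda>x. indicator {-pi..<pi} x *\<^sub>R cis (of_int k * x)) \<in> borel_measurable lborel"
      "(\<lambda>x. indicator {-pi..pi} x *\<^sub>R cis (of_int k * x)) \<in> borel_measurable lborel"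
      by (intro borel_measurable_scaleR borel_measurable_indicator cm, simp)+
  qed (rule AE_eq)
  also have "\<dots> = cis (of_int k * pi) / (\<i> * of_int k) - cis (of_int k * - pi) / (\<i> * of_int k)"
  proof (rule integral_FTC_atLeastAtMost)
    fix x
    show "((\<lambda>x. cis (of_int k * x) / (\<i> * of_int k)) has_vector_derivative cis (of_int k * x)) (at x within {-pi..pi})"
      unfolding cis_conv_exp using False
      by (auto intro!: derivative_eq_intros has_vector_derivative_real_field simp: field_simps)
  qed (auto intro!: continuous_intros)
  also have "cis (of_int k * pi) = cis (of_int k * - pi)"
  proof -
    have "cis (of_int k * pi) = cis (of_int k * - pi) * cis (2 * pi * of_int k)"
      unfolding cis_mult by (rule arg_cong[of _ _ cis]) (simp add: algebra_simps)
    thus ?thesis by (simp add: cis_multiple_2pi)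
  qed
  finally show ?thesis using False by simp
qed

lemma fc_bessel:
  assumes h: "h \<in> borel_measurable circ" "\<And>x. x \<in> {-pi..<pi} \<Longrightarrow> cmod (h x) \<le> C"
  shows "(\<Sum>k\<in>J. (cmod (fc h k))\<^sup>2) \<le> C\<^sup>2"
proof (cases "finite J")
  case True
  define e where "e = (\<lambda>k x. cis (of_int k * x))"
  define c where "c = fc h"
  define S where "S = (\<lambda>x. \<Sum>k\<in>J. c k * e k x)"
  define E where "E = (\<lambda>f :: real \<Rightarrow> complex. LINT x|circ. f x)"
  have bd: "\<exists>C. f \<in> borel_measurable circ \<and> (\<forall>x\<in>{-pi..<pi}. cmod (f x) \<le> C) \<Longrightarrow> integrable circ f" for f
    using integrable_circ by blast
  define R where "R = (\<lambda>f :: real \<Rightarrow> complex. f \<in> borel_measurable circ \<and> (\<exists>C. \<forall>x\<in>{-pi..<pi}. cmod (f x) \<le> C))"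
  have Ri: "integrable circ f" if "R f" for f using that bd unfolding R_def by blast
  have Rh: "R h" using h unfolding R_def by blast
  have Rc: "R (\<lambda>x. a)" for a unfolding R_def by auto
  have Re: "R (e k)" for k unfolding R_def e_def using cis_measurable by (auto intro!: exI[of _ 1])
  have Rm: "R (\<lambda>x. f x * g x)" if "R f" "R g" for f g
  proof -
    from that obtain A B where *: "\<forall>x\<in>{-pi..<pi}. cmod (f x) \<le> A" "\<forall>x\<in>{-pi..<pi}. cmod (g x) \<le> B"
      unfolding R_def by blast
    have "cmod (f x * g x) \<le> A * B" if "x \<in> {-pi..<pi}" for x
      unfolding norm_mult by (rule mult_mono) (use * that in \<open>auto intro: order_trans[OF norm_ge_zero]\<close>)
    moreover have "(\<lambda>x. f x * g x) \<in> borel_measurable circ"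
      using that unfolding R_def by (intro borel_measurable_times) blast+
    ultimately show ?thesis unfolding R_def by blast
  qed
  have Rcnj: "R (\<lambda>x. cnj (f x))" if "R f" for f
    using that unfolding R_def by (auto intro: borel_measurable_cnj)
  have Rs: "R (\<lambda>x. \<Sum>k\<in>J. f k x)" if "\<And>k. R (f k)" for f :: "int \<Rightarrow> real \<Rightarrow> complex"
    using True
  proof (induction J rule: finite_induct)
    case (insert k J)
    from insert.IH that[of k] obtain A B where
      *: "\<forall>x\<in>{-pi..<pi}. cmod (\<Sum>k\<in>J. f k x) \<le> A" "\<forall>x\<in>{-pi..<pi}. cmod (f k x) \<le> B"
      unfolding R_def by blast
    have "\<forall>x\<in>{-pi..<pi}. cmod (f k x + (\<Sum>k\<in>J. f k x)) \<le> B + A"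
      using * by (auto intro!: norm_triangle_le add_mono)
    thus ?case using insert.IH that[of k] insert.hyps unfolding R_def by auto
  qed (auto simp: Rc)
  have RS: "R S" unfolding S_def by (intro Rs Rm Rc Re)
  have hS: "E (\<lambda>x. h x * cnj (S x)) = 2 * pi * (\<Sum>k\<in>J. c k * cnj (c k))"
  proof -
    have "E (\<lambda>x. h x * cnj (S x)) = E (\<lambda>x. \<Sum>k\<in>J. cnj (c k) * (h x * cis (- (of_int k * x))))"
      unfolding E_def S_def e_def
      by (intro Bochner_Integration.integral_cong refl) (simp add: sum_distrib_left cis_cnj mult_ac)
    also have "\<dots> = (\<Sum>k\<in>J. cnj (c k) * (LINT x|circ. h x * cis (- (of_int k * x))))"
      unfolding E_def
    proof (subst Bochner_Integration.integral_sum)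
      fix k
      have "R (\<lambda>x. cnj (c k) * (h x * e (- k) x))" by (intro Rm Rc Re Rh)
      thus "integrable circ (\<lambda>x. cnj (c k) * (h x * cis (- (of_int k * x))))"
        using Ri by (simp add: e_def)
    qed simp
    also have "\<dots> = (\<Sum>k\<in>J. cnj (c k) * (2 * pi * c k))" unfolding c_def fc_def by simp
    finally show ?thesis by (simp add: sum_distrib_left mult_ac)
  qed
  have SS: "E (\<lambda>x. S x * cnj (S x)) = 2 * pi * (\<Sum>k\<in>J. c k * cnj (c k))"
  proof -
    have "E (\<lambda>x. S x * cnj (S x)) = E (\<lambda>x. \<Sum>k\<in>J. \<Sum>l\<in>J. c k * cnj (c l) * e (k - l) x)"
    proof -
      have ee: "e k x * cnj (e l x) = e (k - l) x" for k l x
        unfolding e_def cis_cnj cis_mult by (rule arg_cong[of _ _ cis]) (simp add: algebra_simps)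
      have cc: "(c k * e k x) * (cnj (c l) * cnj (e l x)) = c k * cnj (c l) * e (k - l) x" for k l x
        unfolding ee[symmetric] by (simp only: mult_ac)
      show ?thesis unfolding S_def cnj_sum complex_cnj_mult sum_product cc ..
    qed
    also have "\<dots> = (\<Sum>k\<in>J. \<Sum>l\<in>J. c k * cnj (c l) * (if k = l then 2 * pi else 0))"
      unfolding E_def
      by (subst Bochner_Integration.integral_sum, rule Ri, intro Rs Rm Rc Re, intro sum.cong refl,
        subst Bochner_Integration.integral_sum, rule Ri, intro Rm Rc Re, intro sum.cong refl)
        (simp add: e_def integral_circ_cis flip: of_int_diff)
    also have "\<dots> = (\<Sum>k\<in>J. 2 * pi * (c k * cnj (c k)))"
    proof (intro sum.cong refl)
      fix k assume k: "k \<in> J"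
      have "(\<Sum>l\<in>J. c k * cnj (c l) * complex_of_real (if k = l then 2 * pi else 0)) =
        (\<Sum>l\<in>J. if k = l then 2 * pi * (c k * cnj (c k)) else 0)"
        by (intro sum.cong refl) auto
      also have "\<dots> = 2 * pi * (c k * cnj (c k))" using True k by simp
      finally show "(\<Sum>l\<in>J. c k * cnj (c l) * complex_of_real (if k = l then 2 * pi else 0)) = 2 * pi * (c k * cnj (c k))" .
    qed
    finally show ?thesis by (simp add: sum_distrib_left)
  qed
  have Sh: "E (\<lambda>x. S x * cnj (h x)) = 2 * pi * (\<Sum>k\<in>J. c k * cnj (c k))"
  proof -
    have "E (\<lambda>x. S x * cnj (h x)) = cnj (E (\<lambda>x. h x * cnj (S x)))"
      unfolding E_def Bochner_Integration.integral_cnj[symmetric] by (simp add: mult.commute)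
    thus ?thesis unfolding hS by (simp add: mult.commute)
  qed
  have "complex_of_real (LINT x|circ. (cmod (h x - S x))\<^sup>2) = E (\<lambda>x. (h x * cnj (h x) - h x * cnj (S x)) - (S x * cnj (h x) - S x * cnj (S x)))"
    unfolding E_def integral_complex_of_real[symmetric] complex_norm_square by (simp add: algebra_simps)
  also have "\<dots> = (E (\<lambda>x. h x * cnj (h x)) - E (\<lambda>x. h x * cnj (S x))) - (E (\<lambda>x. S x * cnj (h x)) - E (\<lambda>x. S x * cnj (S x)))"
    unfolding E_def
    by (subst Bochner_Integration.integral_diff, (rule Bochner_Integration.integrable_diff, (rule Ri, intro Rm Rcnj RS Rh)+)+,
      subst Bochner_Integration.integral_diff, (rule Ri, intro Rm Rcnj RS Rh)+,
      subst Bochner_Integration.integral_diff, (rule Ri, intro Rm Rcnj RS Rh)+) (rule refl)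
  also have "\<dots> = complex_of_real ((LINT x|circ. (cmod (h x))\<^sup>2) - 2 * pi * (\<Sum>k\<in>J. (cmod (c k))\<^sup>2))"
    unfolding hS Sh SS by (simp add: E_def complex_norm_square flip: integral_complex_of_real del: of_real_power)
  finally have "(LINT x|circ. (cmod (h x - S x))\<^sup>2) = (LINT x|circ. (cmod (h x))\<^sup>2) - 2 * pi * (\<Sum>k\<in>J. (cmod (c k))\<^sup>2)"
    by (simp only: of_real_eq_iff)
  moreover have "0 \<le> (LINT x|circ. (cmod (h x - S x))\<^sup>2)" by simp
  moreover have "(LINT x|circ. (cmod (h x))\<^sup>2) \<le> (LINT x|circ. C\<^sup>2)"
  proof (rule integral_mono)
    show "integrable circ (\<lambda>x. (cmod (h x))\<^sup>2)"
      using h by (intro integrable_circ[of _ "C\<^sup>2"]) (auto intro: power_mono)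
  qed (use h in \<open>auto simp: space_circ intro!: power_mono\<close>)
  moreover have "(LINT x|circ. C\<^sup>2) = 2 * pi * C\<^sup>2" by (simp add: measure_circ)
  ultimately have "(2 * pi) * (\<Sum>k\<in>J. (cmod (c k))\<^sup>2) \<le> (2 * pi) * C\<^sup>2" by linarith
  thus ?thesis unfolding c_def by (rule mult_left_le_imp_le) simp
qed simp

lemma fc_tendsto_zero:
  assumes h: "h \<in> borel_measurable circ" "\<And>x. x \<in> {-pi..<pi} \<Longrightarrow> cmod (h x) \<le> C" and i: "inj i"
  shows "(\<lambda>N. fc h (i N)) \<longlonglongrightarrow> 0"
proof -
  have "summable (\<lambda>N. (cmod (fc h (i N)))\<^sup>2)"
  proof (rule bounded_imp_summable[of _ "C\<^sup>2"])
    fix N :: nat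
    have "(\<Sum>k\<le>N. (cmod (fc h (i k)))\<^sup>2) = (\<Sum>k\<in>i ` {..N}. (cmod (fc h k))\<^sup>2)"
      by (subst sum.reindex) (use i in \<open>auto simp: inj_on_def\<close>)
    also have "\<dots> \<le> C\<^sup>2" by (rule fc_bessel[OF h])
    finally show "(\<Sum>k\<le>N. (cmod (fc h (i k)))\<^sup>2) \<le> C\<^sup>2" .
  qed simp
  hence "(\<lambda>N. (cmod (fc h (i N)))\<^sup>2) \<longlonglongrightarrow> 0" by (rule summable_LIMSEQ_zero)
  hence "(\<lambda>N. sqrt ((cmod (fc h (i N)))\<^sup>2)) \<longlonglongrightarrow> sqrt 0" by (rule tendsto_real_sqrt)
  thus ?thesis by (simp add: tendsto_norm_zero_iff)
qed

text \<open>Dividing \<open>\<phi> x - \<phi> x0\<close> by \<open>cis x - cis x0\<close> makes the partial sums of the series at \<open>x0\<close>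
  telescope, so that only the Riemann-Lebesgue lemma for the quotient is needed.\<close>

lemma fourier_series_converges:
  assumes meas: "\<phi> \<in> borel_measurable circ"
    and K: "\<And>x. x \<in> {-pi..<pi} \<Longrightarrow> cmod (\<phi> x - \<phi> x0) \<le> K * cmod (cis x - cis x0)"
  shows "(\<lambda>N. \<Sum>k\<in>{- int N..int N}. fc \<phi> k * cis (of_int k * x0)) \<longlonglongrightarrow> \<phi> x0"
proof -
  define h where "h = (\<lambda>x. (\<phi> x - \<phi> x0) / (cis x - cis x0))"
  have hm: "h \<in> borel_measurable circ"
    unfolding h_def using meas cis_measurable(1)[of 1] by (intro borel_measurable_divide borel_measurable_diff) auto
  have hK: "cmod (h x) \<le> \<bar>K\<bar>" if "x \<in> {-pi..<pi}" for x
  proof (cases "cis x = cis x0")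
    case False
    have "cmod (\<phi> x - \<phi> x0) \<le> \<bar>K\<bar> * cmod (cis x - cis x0)"
      using K[OF that] by (rule order_trans) (intro mult_right_mono, auto)
    thus ?thesis using False by (simp add: h_def norm_divide field_simps)
  qed (simp add: h_def)
  have h_eq: "\<phi> x = \<phi> x0 + h x * cis x - cis x0 * h x" if "x \<in> {-pi..<pi}" for x
  proof -
    have "h x * (cis x - cis x0) = \<phi> x - \<phi> x0"
      using K[OF that] by (cases "cis x = cis x0") (auto simp: h_def)
    hence "\<phi> x = \<phi> x0 + h x * (cis x - cis x0)" by simp
    thus ?thesis by (simp add: right_diff_distrib mult.commute)
  qed
  have int1: "integrable circ (\<lambda>x. h x * cis (- (of_int j * x)))" for j
    by (rule integrable_circ[where C = "\<bar>K\<bar>"]) (use hm hK cis_measurable in \<open>auto simp: norm_mult\<close>)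
  have int2: "integrable circ (\<lambda>x. \<phi> x0 * cis (of_int (- j) * x))" for j
    by (rule integrable_circ[where C = "cmod (\<phi> x0)"]) (use cis_measurable in \<open>auto simp: norm_mult\<close>)
  have coeff: "fc \<phi> k = (if k = 0 then \<phi> x0 else 0) + fc h (k - 1) - cis x0 * fc h k" for k
  proof -
    have "(LINT x|circ. \<phi> x * cis (- (of_int k * x))) =
      (LINT x|circ. (\<phi> x0 * cis (of_int (- k) * x) + h x * cis (- (of_int (k - 1) * x))) - cis x0 * (h x * cis (- (of_int k * x))))"
    proof (rule Bochner_Integration.integral_cong)
      fix x assume "x \<in> space circ"
      hence x: "x \<in> {-pi..<pi}" by (simp add: space_circ)
      have "cis (- (of_int (k - 1) * x)) = cis x * cis (- (of_int k * x))"
        unfolding cis_mult by (rule arg_cong[of _ _ cis]) (simp add: algebra_simps)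
      thus "\<phi> x * cis (- (of_int k * x)) = (\<phi> x0 * cis (of_int (- k) * x) + h x * cis (- (of_int (k - 1) * x))) - cis x0 * (h x * cis (- (of_int k * x)))"
        unfolding h_eq[OF x] by (simp add: algebra_simps)
    qed simp
    also have "\<dots> = (LINT x|circ. \<phi> x0 * cis (of_int (- k) * x)) + (LINT x|circ. h x * cis (- (of_int (k - 1) * x)))
       - (LINT x|circ. cis x0 * (h x * cis (- (of_int k * x))))"
      by (subst Bochner_Integration.integral_diff, intro Bochner_Integration.integrable_add int1 int2,
        intro integrable_mult_right int1, subst Bochner_Integration.integral_add, intro int2, intro int1) (rule refl)
    also have "\<dots> = \<phi> x0 * (if k = 0 then 2 * pi else 0) + (LINT x|circ. h x * cis (- (of_int (k - 1) * x)))
       - cis x0 * (LINT x|circ. h x * cis (- (of_int k * x)))"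
      by (simp only: integral_mult_right_zero integral_circ_cis neg_equal_0_iff_equal)
    finally show ?thesis unfolding fc_def by (simp add: diff_divide_distrib add_divide_distrib)
  qed
  define a where "a = (\<lambda>k::int. cis (of_int k * x0) * fc h (k - 1))"
  have summand: "fc \<phi> k * cis (of_int k * x0) = (if k = 0 then \<phi> x0 else 0) + (a k - a (k + 1))" for k
  proof -
    have "cis (of_int (k + 1) * x0) = cis x0 * cis (of_int k * x0)"
      unfolding cis_mult by (rule arg_cong[of _ _ cis]) (simp add: algebra_simps)
    thus ?thesis unfolding coeff a_def by (simp add: algebra_simps)
  qed
  have tele: "(\<Sum>k\<in>{- int N..int N}. a k - a (k + 1)) = a (- int N) - a (int N + 1)" for N
  proof (induction N)
    case (Suc N)
    have "{- int (Suc N)..int (Suc N)} = insert (- int (Suc N)) (insert (int (Suc N)) {- int N..int N})" by auto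
    thus ?case using Suc by (simp add: algebra_simps)
  qed simp
  have sum: "(\<Sum>k\<in>{- int N..int N}. fc \<phi> k * cis (of_int k * x0)) = \<phi> x0 + (a (- int N) - a (int N + 1))" for N
    unfolding summand sum.distrib tele by simp
  have "(\<lambda>N. a (- int N)) \<longlonglongrightarrow> 0" "(\<lambda>N. a (int N + 1)) \<longlonglongrightarrow> 0"
  proof -
    have na: "cmod (a k) = cmod (fc h (k - 1))" for k by (simp add: a_def norm_mult)
    have "(\<lambda>N. fc h (- int N - 1)) \<longlonglongrightarrow> 0" "(\<lambda>N. fc h (int N + 1 - 1)) \<longlonglongrightarrow> 0"
      by (rule fc_tendsto_zero[OF hm hK]; auto simp: inj_def)+
    hence "(\<lambda>N. cmod (fc h (- int N - 1))) \<longlonglongrightarrow> 0" "(\<lambda>N. cmod (fc h (int N + 1 - 1))) \<longlonglongrightarrow> 0"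
      by (simp_all only: tendsto_norm_zero_iff)
    thus "(\<lambda>N. a (- int N)) \<longlonglongrightarrow> 0" "(\<lambda>N. a (int N + 1)) \<longlonglongrightarrow> 0"
      unfolding na[symmetric] by (simp_all only: tendsto_norm_zero_iff)
  qed
  hence "(\<lambda>N. \<phi> x0 + (a (- int N) - a (int N + 1))) \<longlonglongrightarrow> \<phi> x0 + (0 - 0)" by (intro tendsto_intros)
  thus ?thesis unfolding sum by simp
qed

lemma abs_sin_ge_linear:
  assumes "0 \<le> b" "b < pi"
  obtains m where "0 < m" "\<And>y. \<bar>y\<bar> \<le> b \<Longrightarrow> m * \<bar>y\<bar> \<le> \<bar>sin y\<bar>"
proof -
  have "continuous_on {-b..b} sinc"
    by (intro continuous_at_imp_continuous_on ballI isCont_sinc)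
  then obtain x where x: "x \<in> {-b..b}" "\<And>y. y \<in> {-b..b} \<Longrightarrow> sinc x \<le> sinc y"
    using continuous_attains_inf[of "{-b..b}" sinc] assms by force
  have "0 < sinc x"
  proof (cases "x = 0")
    case False
    have "0 < sin \<bar>x\<bar>" using x assms False by (intro sin_gt_zero) auto
    hence "0 < sin \<bar>x\<bar> / \<bar>x\<bar>" using False by simp
    thus ?thesis using False by (auto simp: abs_if split: if_splits)
  qed simp
  moreover have "sinc x * \<bar>y\<bar> \<le> \<bar>sin y\<bar>" if "\<bar>y\<bar> \<le> b" for y
  proof (cases "y = 0")
    case False
    have "sinc x \<le> sinc y" using that by (intro x) auto
    also have "sinc y \<le> \<bar>sin y\<bar> / \<bar>y\<bar>" using False abs_ge_self[of "sin y / y"] by simp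
    finally show ?thesis using False by (simp add: field_simps)
  qed simp
  ultimately show ?thesis using that by blast
qed

lemma norm_cis_diff: "cmod (cis x - cis y) = 2 * \<bar>sin ((x - y) / 2)\<bar>"
proof -
  have "cis x - cis y = cis y * (cis (x - y) - 1)" by (simp add: algebra_simps cis_mult)
  hence "cmod (cis x - cis y) = cmod (cis (x - y) - 1)" by (simp add: norm_mult)
  also have "\<dots> = cmod (exp (\<i> * of_real (x - y)) - 1)" by (simp add: cis_conv_exp)
  also have "\<dots> = 2 * \<bar>sin ((x - y) / 2)\<bar>" using dist_exp_i_1[of "x - y"] by simp
  finally show ?thesis .
qed

lemma abs_diff_le_norm_cis_diff:
  assumes "0 \<le> b" "b < 2 * pi"
  obtains K where "0 < K" "\<And>x y. \<bar>x - y\<bar> \<le> b \<Longrightarrow> \<bar>x - y\<bar> \<le> K * cmod (cis x - cis y)"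
proof -
  obtain m where m: "0 < m" "\<And>y. \<bar>y\<bar> \<le> b / 2 \<Longrightarrow> m * \<bar>y\<bar> \<le> \<bar>sin y\<bar>"
    using abs_sin_ge_linear[of "b / 2"] assms by auto
  have "\<bar>x - y\<bar> \<le> 1 / m * cmod (cis x - cis y)" if "\<bar>x - y\<bar> \<le> b" for x y
    using m(2)[of "(x - y) / 2"] m(1) that by (simp add: norm_cis_diff field_simps)
  thus ?thesis using m(1) that[of "1 / m"] by simp
qed

section \<open>Linear statistics of the eigenangles\<close>

lemma borel_measurable_of_real_circ: "f \<in> borel_measurable circ \<Longrightarrow> (\<lambda>x. complex_of_real (f x)) \<in> borel_measurable circ"
  by measurable

lemma fc_minus: "fc (\<lambda>x. complex_of_real (\<phi> x)) (- k) = cnj (fc (\<lambda>x. complex_of_real (\<phi> x)) k)"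
  unfolding fc_def complex_cnj_divide Bochner_Integration.integral_cnj[symmetric] by (simp add: cis_cnj)

lemma norm_cis_diff_le: "cmod (cis x - cis y) \<le> \<bar>x - y\<bar>"
  unfolding norm_cis_diff using abs_sin_le_one abs_sin_x_le_abs_x[of "(x - y) / 2"] by simp

definition cos_power :: "nat \<Rightarrow> real \<Rightarrow> real" where
  "cos_power m x = ((1 - cos x) / 2) ^ m"

lemma cos_power_bounds: "0 \<le> cos_power m x" "cos_power m x \<le> 1"
  unfolding cos_power_def using cos_ge_minus_one[of x] cos_le_one[of x] by (auto intro!: power_le_one)

lemma abs_cos_diff_le: "\<bar>cos x - cos y\<bar> \<le> cmod (cis x - cis y)"
  using abs_Re_le_cmod[of "cis x - cis y"] by simp

lemma cos_power_lipschitz: "\<bar>cos_power m x - cos_power m y\<bar> \<le> real m * cmod (cis x - cis y)"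
proof -
  let ?a = "(1 - cos x) / 2" and ?b = "(1 - cos y) / 2"
  have "norm ?a \<le> 1" "norm ?b \<le> 1" using cos_ge_minus_one[of x] cos_ge_minus_one[of y] by auto
  hence "norm (?a ^ m - ?b ^ m) \<le> real m * norm (?a - ?b)" by (rule norm_power_diff)
  also have "norm (?a - ?b) = \<bar>cos x - cos y\<bar> / 2" by (simp add: diff_divide_distrib[symmetric] abs_minus_commute)
  also have "real m * (\<bar>cos x - cos y\<bar> / 2) \<le> real m * cmod (cis x - cis y)"
    using abs_cos_diff_le[of x y] by (intro mult_left_mono) auto
  finally show ?thesis by (simp add: cos_power_def)
qed

lemma cos_power_measurable: "cos_power m \<in> borel_measurable circ"
  unfolding cos_power_def[abs_def] by (intro borel_measurable_circ borel_measurable_continuous_onI continuous_intros) auto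

lemma cos_power_tendsto:
  assumes "x \<in> {-pi..<pi}"
  shows "(\<lambda>m. cos_power m x) \<longlonglongrightarrow> (if x = -pi then 1 else 0)"
proof (cases "x = -pi")
  case False
  have "0 < cos (x / 2)" using assms False by (intro cos_gt_zero_pi) auto
  hence "cos x \<noteq> - 1" using cos_double_cos[of "x / 2"] by auto
  hence "- 1 < cos x" using cos_ge_minus_one[of x] by (simp add: less_le)
  hence "\<bar>(1 - cos x) / 2\<bar> < 1" using cos_ge_minus_one[of x] cos_le_one[of x] by auto
  thus ?thesis using False unfolding cos_power_def by (simp add: LIMSEQ_power_zero)
qed (simp add: cos_power_def)

locale haar_eigen = haar_unitary +
  fixes \<theta> :: "complex mat \<Rightarrow> nat \<Rightarrow> real"
  assumes \<theta>: "\<And>M. M \<in> unitary_group n \<Longrightarrow> eigenangles n M (\<theta> M)"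
begin

lemma \<theta>_range: "M \<in> unitary_group n \<Longrightarrow> j < n \<Longrightarrow> \<theta> M j \<in> {-pi..<pi}"
  using \<theta>[of M] by (simp add: eigenangles_def)

lemma ptrace_eigenangles:
  assumes M: "M \<in> unitary_group n"
  shows "ptrace n k M = (\<Sum>j<n. cis (of_int k * \<theta> M j))"
proof -
  have nat: "ptrace n (int m) M = (\<Sum>j<n. cis (real m * \<theta> M j))" for m
    using ptrace_eigenvalues[OF M, of "\<lambda>j. cis (\<theta> M j)" m] \<theta>[OF M] by (simp add: eigenangles_def Complex.DeMoivre)
  show ?thesis
  proof (cases "0 \<le> k")
    case True
    then show ?thesis using nat[of "nat k"] by simp
  next
    case False
    have "ptrace n k M = cnj (ptrace n (int (nat (- k))) M)"
      using ptrace_minus[OF M, of "- k"] False by simp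
    also have "\<dots> = (\<Sum>j<n. cis (of_int k * \<theta> M j))"
      unfolding nat cnj_sum using False by (simp add: cis_cnj)
    finally show ?thesis .
  qed
qed

definition trigsum :: "(real \<Rightarrow> complex) \<Rightarrow> nat \<Rightarrow> complex mat \<Rightarrow> complex" where
  "trigsum \<phi> N M = (\<Sum>k\<in>{- int N..int N}. fc \<phi> k * ptrace n k M)"

lemma regular_trigsum: "regular (trigsum \<phi> N)"
  unfolding trigsum_def[abs_def] by (intro regular_intros)

lemma trigsum_measurable [measurable]: "trigsum \<phi> N \<in> borel_measurable H"
  using regular_trigsum by (simp add: regular_def)

lemma trigsum_eigenangles:
  assumes M: "M \<in> unitary_group n"
  shows "trigsum \<phi> N M = (\<Sum>j<n. \<Sum>k\<in>{- int N..int N}. fc \<phi> k * cis (of_int k * \<theta> M j))"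
  unfolding trigsum_def ptrace_eigenangles[OF M] sum_distrib_left by (rule sum.swap)

lemma trigsum_tendsto:
  assumes M: "M \<in> unitary_group n" and "\<phi> \<in> borel_measurable circ"
    and "\<And>j. j < n \<Longrightarrow> \<exists>K. \<forall>x\<in>{-pi..<pi}. cmod (\<phi> x - \<phi> (\<theta> M j)) \<le> K * cmod (cis x - cis (\<theta> M j))"
  shows "(\<lambda>N. trigsum \<phi> N M) \<longlonglongrightarrow> (\<Sum>j<n. \<phi> (\<theta> M j))"
  unfolding trigsum_eigenangles[OF M]
proof (rule tendsto_sum)
  fix j assume "j \<in> {..<n}"
  then obtain K where "\<forall>x\<in>{-pi..<pi}. cmod (\<phi> x - \<phi> (\<theta> M j)) \<le> K * cmod (cis x - cis (\<theta> M j))"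
    using assms(3)[of j] by auto
  thus "(\<lambda>N. \<Sum>k\<in>{- int N..int N}. fc \<phi> k * cis (of_int k * \<theta> M j)) \<longlonglongrightarrow> \<phi> (\<theta> M j)"
    by (intro fourier_series_converges assms(2)) auto
qed

lemma statistic_measurable:
  assumes "\<phi> \<in> borel_measurable circ"
    and "\<And>x0. x0 \<in> {-pi..<pi} \<Longrightarrow> \<exists>K. \<forall>x\<in>{-pi..<pi}. cmod (\<phi> x - \<phi> x0) \<le> K * cmod (cis x - cis x0)"
  shows "(\<lambda>M. \<Sum>j<n. \<phi> (\<theta> M j)) \<in> borel_measurable H"
proof (rule borel_measurable_LIMSEQ_metric)
  show "trigsum \<phi> N \<in> borel_measurable H" for N by measurable
  fix M assume "M \<in> space H"
  hence M: "M \<in> unitary_group n" by (simp add: space_H)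
  show "(\<lambda>N. trigsum \<phi> N M) \<longlonglongrightarrow> (\<Sum>j<n. \<phi> (\<theta> M j))"
    by (rule trigsum_tendsto[OF M assms(1) assms(2)[OF \<theta>_range[OF M]]])
qed

lemma statistic_regular:
  assumes "(\<lambda>M. \<Sum>j<n. \<phi> (\<theta> M j)) \<in> borel_measurable H" "\<And>x. x \<in> {-pi..<pi} \<Longrightarrow> cmod (\<phi> x) \<le> C"
  shows "regular (\<lambda>M. \<Sum>j<n. \<phi> (\<theta> M j))"
proof (rule regularI[OF assms(1)])
  fix M assume "M \<in> unitary_group n"
  thus "cmod (\<Sum>j<n. \<phi> (\<theta> M j)) \<le> (\<Sum>j<n. C)"
    by (intro sum_norm_le assms(2) \<theta>_range) auto
qed

definition trigvar :: "(real \<Rightarrow> complex) \<Rightarrow> nat \<Rightarrow> real" where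
  "trigvar \<phi> N = (\<Sum>k\<in>{- int N..int N} - {0}. (cmod (fc \<phi> k))\<^sup>2 * real (min (nat \<bar>k\<bar>) n))"

lemma trigvar_mono: "N \<le> N' \<Longrightarrow> trigvar \<phi> N \<le> trigvar \<phi> N'"
  unfolding trigvar_def by (intro sum_mono2) auto

lemma trigsum_diff_norm:
  assumes "N \<le> N'"
  shows "(LINT M|H. (cmod (trigsum \<phi> N' M - trigsum \<phi> N M))\<^sup>2) = trigvar \<phi> N' - trigvar \<phi> N"
proof -
  let ?J = "{- int N'..int N'} - {- int N..int N}"
  have "trigsum \<phi> N' M - trigsum \<phi> N M = (\<Sum>k\<in>?J. fc \<phi> k * ptrace n (0 + k) M)" for M
    unfolding trigsum_def using assms by (subst sum_diff) auto
  hence "(LINT M|H. (cmod (trigsum \<phi> N' M - trigsum \<phi> N M))\<^sup>2) = (\<Sum>k\<in>?J. (cmod (fc \<phi> k))\<^sup>2 * real (min (nat \<bar>0 + k\<bar>) n))"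
    by (simp only:) (rule ptrace_sum_norm_expectation, auto)
  also have "?J = ({- int N'..int N'} - {0}) - ({- int N..int N} - {0})" by auto
  also have "(\<Sum>k\<in>\<dots>. (cmod (fc \<phi> k))\<^sup>2 * real (min (nat \<bar>0 + k\<bar>) n)) = trigvar \<phi> N' - trigvar \<phi> N"
    unfolding trigvar_def add_0 by (rule sum_diff) (use assms in auto)
  finally show ?thesis .
qed

lemma trigsum_expectation: "(LINT M|H. trigsum \<phi> N M) = of_nat n * fc \<phi> 0"
proof -
  have "(LINT M|H. trigsum \<phi> N M) = (\<Sum>k\<in>{- int N..int N}. fc \<phi> k * (LINT M|H. ptrace n k M))"
    unfolding trigsum_def by (subst expectation_sum, intro regular_intros) simp
  also have "\<dots> = (\<Sum>k\<in>{0}. fc \<phi> k * (LINT M|H. ptrace n k M))"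
    by (rule sum.mono_neutral_right) (auto simp: ptrace_expectation)
  also have "(LINT M|H. ptrace n 0 M) = (LINT M|H. of_nat n)"
    by (rule integral_cong_unitary) (simp add: ptrace_0)
  hence "(\<Sum>k\<in>{0}. fc \<phi> k * (LINT M|H. ptrace n k M)) = of_nat n * fc \<phi> 0" by (simp add: prob_space)
  finally show ?thesis .
qed

lemma trigvar_bounded:
  assumes "\<phi> \<in> borel_measurable circ" "\<And>x. x \<in> {-pi..<pi} \<Longrightarrow> cmod (\<phi> x) \<le> C"
  shows "trigvar \<phi> N \<le> C\<^sup>2 * n"
proof -
  have "trigvar \<phi> N \<le> (\<Sum>k\<in>{- int N..int N} - {0}. (cmod (fc \<phi> k))\<^sup>2 * n)"
    unfolding trigvar_def by (intro sum_mono mult_left_mono) auto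
  also have "\<dots> \<le> C\<^sup>2 * n" unfolding sum_distrib_right[symmetric]
    by (intro mult_right_mono fc_bessel[OF assms]) auto
  finally show ?thesis .
qed

context
  fixes \<phi> :: "real \<Rightarrow> complex" and F :: "complex mat \<Rightarrow> complex" and C :: real
  assumes \<phi>: "\<phi> \<in> borel_measurable circ" "\<And>x. x \<in> {-pi..<pi} \<Longrightarrow> cmod (\<phi> x) \<le> C"
    and F: "regular F" "AE M in H. (\<lambda>N. trigsum \<phi> N M) \<longlonglongrightarrow> F M"
begin

lemma trigvar_convergent: "trigvar \<phi> \<longlonglongrightarrow> (SUP N. trigvar \<phi> N)"
proof (rule LIMSEQ_incseq_SUP)
  show "bdd_above (range (trigvar \<phi>))" using trigvar_bounded[OF \<phi>] by (intro bdd_aboveI2)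
  show "incseq (trigvar \<phi>)" by (intro monoI trigvar_mono)
qed

lemma statistic_approx:
  "(LINT M|H. (cmod (F M - trigsum \<phi> N M))\<^sup>2) \<le> (SUP N. trigvar \<phi> N) - trigvar \<phi> N"
proof -
  define W where "W = (SUP N. trigvar \<phi> N)"
  have le: "trigvar \<phi> N' \<le> W" for N'
    unfolding W_def using trigvar_bounded[OF \<phi>] by (intro cSUP_upper bdd_aboveI2) auto
  have reg: "regular (\<lambda>M. F M - trigsum \<phi> N M)" "\<And>N'. regular (\<lambda>M. trigsum \<phi> N' M - trigsum \<phi> N M)"
    by (intro regular_intros F regular_trigsum)+
  have int: "integrable H (\<lambda>M. (cmod (f M))\<^sup>2)" if f: "regular f" for f
  proof -
    obtain C where C: "f \<in> borel_measurable H" "\<And>M. M \<in> unitary_group n \<Longrightarrow> cmod (f M) \<le> C"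
      using f unfolding regular_def by blast
    thus ?thesis by (intro integrable_const_bound[of _ "C\<^sup>2"]) (auto simp: space_H intro!: AE_I2 power_mono)
  qed
  have m: "(\<lambda>M. ennreal ((cmod (trigsum \<phi> (N + i) M - trigsum \<phi> N M))\<^sup>2)) \<in> borel_measurable H" for i
    by measurable
  have "(\<integral>\<^sup>+M. ennreal ((cmod (F M - trigsum \<phi> N M))\<^sup>2) \<partial>H) =
     (\<integral>\<^sup>+M. liminf (\<lambda>i. ennreal ((cmod (trigsum \<phi> (N + i) M - trigsum \<phi> N M))\<^sup>2)) \<partial>H)"
  proof (rule nn_integral_cong_AE)
    show "AE M in H. ennreal ((cmod (F M - trigsum \<phi> N M))\<^sup>2) = liminf (\<lambda>i. ennreal ((cmod (trigsum \<phi> (N + i) M - trigsum \<phi> N M))\<^sup>2))"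
      using F(2)
    proof eventually_elim
      case (elim M)
      have "(\<lambda>i. trigsum \<phi> (i + N) M) \<longlonglongrightarrow> F M" using elim by (rule LIMSEQ_ignore_initial_segment)
      hence "(\<lambda>i. ennreal ((cmod (trigsum \<phi> (N + i) M - trigsum \<phi> N M))\<^sup>2)) \<longlonglongrightarrow> ennreal ((cmod (F M - trigsum \<phi> N M))\<^sup>2)"
        unfolding add.commute[of N] by (intro tendsto_intros)
      thus ?case by (rule lim_imp_Liminf[symmetric, rotated]) simp
    qed
  qed
  also have "\<dots> \<le> liminf (\<lambda>i. \<integral>\<^sup>+M. ennreal ((cmod (trigsum \<phi> (N + i) M - trigsum \<phi> N M))\<^sup>2) \<partial>H)"
    by (rule nn_integral_liminf[OF m])
  also have "\<dots> \<le> liminf (\<lambda>i. ennreal (W - trigvar \<phi> N))"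
  proof (rule Liminf_mono, rule always_eventually, intro allI)
    fix i
    have "(\<integral>\<^sup>+M. ennreal ((cmod (trigsum \<phi> (N + i) M - trigsum \<phi> N M))\<^sup>2) \<partial>H) = ennreal (trigvar \<phi> (N + i) - trigvar \<phi> N)"
      by (subst nn_integral_eq_integral[OF int[OF reg(2)]]) (simp_all add: trigsum_diff_norm)
    also have "\<dots> \<le> ennreal (W - trigvar \<phi> N)" using le[of "N + i"] by (intro ennreal_leI) simp
    finally show "(\<integral>\<^sup>+M. ennreal ((cmod (trigsum \<phi> (N + i) M - trigsum \<phi> N M))\<^sup>2) \<partial>H) \<le> ennreal (W - trigvar \<phi> N)" .
  qed
  also have "\<dots> = ennreal (W - trigvar \<phi> N)" by (simp add: Liminf_const)
  finally have "ennreal (LINT M|H. (cmod (F M - trigsum \<phi> N M))\<^sup>2) \<le> ennreal (W - trigvar \<phi> N)"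
    by (subst (asm) nn_integral_eq_integral[OF int[OF reg(1)]]) auto
  thus ?thesis using le[of N] by (simp add: W_def)
qed

lemma statistic_approx_L1: "(\<lambda>N. LINT M|H. cmod (F M - trigsum \<phi> N M)) \<longlonglongrightarrow> 0"
proof (rule tendsto_sandwich[OF _ _ tendsto_const])
  show "\<forall>\<^sub>F N in sequentially. 0 \<le> (LINT M|H. cmod (F M - trigsum \<phi> N M))" by simp
  show "\<forall>\<^sub>F N in sequentially. (LINT M|H. cmod (F M - trigsum \<phi> N M)) \<le> sqrt ((SUP N. trigvar \<phi> N) - trigvar \<phi> N)"
  proof (rule always_eventually, intro allI)
    fix N
    have "(LINT M|H. cmod (F M - trigsum \<phi> N M)) \<le> sqrt (LINT M|H. (cmod (F M - trigsum \<phi> N M))\<^sup>2)"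
      by (intro expectation_norm_le regular_intros F regular_trigsum)
    also have "\<dots> \<le> sqrt ((SUP N. trigvar \<phi> N) - trigvar \<phi> N)"
      by (intro real_sqrt_le_mono statistic_approx)
    finally show "(LINT M|H. cmod (F M - trigsum \<phi> N M)) \<le> sqrt ((SUP N. trigvar \<phi> N) - trigvar \<phi> N)" .
  qed
  show "(\<lambda>N. sqrt ((SUP N. trigvar \<phi> N) - trigvar \<phi> N)) \<longlonglongrightarrow> 0"
    using trigvar_convergent by (auto intro!: tendsto_eq_intros)
qed

lemma statistic_expectation: "(LINT M|H. F M) = of_nat n * fc \<phi> 0"
proof -
  have "(\<lambda>N. (LINT M|H. F M) - of_nat n * fc \<phi> 0) \<longlonglongrightarrow> 0"
  proof (rule Lim_null_comparison[OF _ statistic_approx_L1], rule always_eventually, intro allI)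
    fix N
    have "(LINT M|H. F M) - of_nat n * fc \<phi> 0 = (LINT M|H. F M - trigsum \<phi> N M)"
      unfolding trigsum_expectation[of \<phi> N, symmetric]
      by (rule Bochner_Integration.integral_diff[symmetric]) (rule regular_integrable, rule F regular_trigsum)+
    also have "norm \<dots> \<le> (LINT M|H. cmod (F M - trigsum \<phi> N M))" by (rule integral_norm_bound)
    finally show "norm ((LINT M|H. F M) - of_nat n * fc \<phi> 0) \<le> (LINT M|H. cmod (F M - trigsum \<phi> N M))" .
  qed
  thus ?thesis by (simp add: LIMSEQ_const_iff)
qed

lemma statistic_variance:
  assumes "\<And>N. trigvar \<phi> N \<le> V"
  shows "(LINT M|H. (cmod (F M - (LINT M|H. F M)))\<^sup>2) \<le> V"
proof -
  have "(LINT M|H. (cmod (F M - (LINT M|H. F M)))\<^sup>2) = (LINT M|H. (cmod (F M - trigsum \<phi> 0 M))\<^sup>2)"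
    unfolding statistic_expectation by (rule integral_cong_unitary) (simp add: trigsum_def ptrace_0 mult.commute)
  also have "\<dots> \<le> (SUP N. trigvar \<phi> N) - trigvar \<phi> 0" by (rule statistic_approx)
  also have "\<dots> \<le> V" using assms by (auto simp: trigvar_def intro!: cSUP_least)
  finally show ?thesis .
qed

lemma statistic_char_limit:
  assumes real: "\<And>M. M \<in> unitary_group n \<Longrightarrow> F M \<in> \<real>" "\<And>k. fc \<phi> (- k) = cnj (fc \<phi> k)"
  shows "(\<lambda>N. LINT M|H. exp (\<i> * of_real s * (\<Sum>k\<in>{- int N..int N} - {0}. fc \<phi> k * ptrace n k M)))
     \<longlonglongrightarrow> (LINT M|H. exp (\<i> * of_real s * (F M - (LINT M|H. F M))))"
proof -
  let ?X = "\<lambda>N M. \<Sum>k\<in>{- int N..int N} - {0}. fc \<phi> k * ptrace n k M"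
  define m where "m = (LINT M|H. F M)"
  have m: "m = of_nat n * fc \<phi> 0" unfolding m_def by (rule statistic_expectation)
  have X: "?X N M = trigsum \<phi> N M - m" if "M \<in> unitary_group n" for N M
    unfolding trigsum_def m by (subst sum_diff1) (auto simp: ptrace_0[OF that])
  have mreal: "m \<in> \<real>" unfolding m using real(2)[of 0] by (auto simp: complex_is_Real_iff complex_eq_iff)
  have Xreal: "?X N M \<in> \<real>" if "M \<in> unitary_group n" for N M
  proof -
    have "cnj (?X N M) = (\<Sum>k\<in>{- int N..int N} - {0}. fc \<phi> (- k) * ptrace n (- k) M)"
      by (simp add: real(2) ptrace_minus[OF that])
    also have "\<dots> = ?X N M" by (rule sum.reindex_bij_witness[of _ uminus uminus]) auto
    finally show ?thesis by (simp only: Reals_cnj_iff)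
  qed
  have lip: "cmod (exp (\<i> * of_real s * a) - exp (\<i> * of_real s * b)) \<le> \<bar>s\<bar> * cmod (a - b)" if "a \<in> \<real>" "b \<in> \<real>" for a b
  proof -
    from that obtain x y where "a = of_real x" "b = of_real y" by (auto elim!: Reals_cases)
    thus ?thesis using norm_cis_diff_le[of "s * x" "s * y"]
      by (simp add: cis_conv_exp mult.assoc abs_mult flip: right_diff_distrib of_real_diff)
  qed
  have reg: "regular (\<lambda>M. exp (\<i> * of_real s * ?X N M))" "regular (\<lambda>M. exp (\<i> * of_real s * (F M - m)))" for N
    by (intro regular_intros F)+
  have "(\<lambda>N. (LINT M|H. exp (\<i> * of_real s * ?X N M)) - (LINT M|H. exp (\<i> * of_real s * (F M - m)))) \<longlonglongrightarrow> 0"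
  proof (rule Lim_null_comparison)
    show "\<forall>\<^sub>F N in sequentially. norm ((LINT M|H. exp (\<i> * of_real s * ?X N M)) - (LINT M|H. exp (\<i> * of_real s * (F M - m))))
      \<le> \<bar>s\<bar> * (LINT M|H. cmod (F M - trigsum \<phi> N M))"
    proof (rule always_eventually, intro allI)
      fix N
      have e: "(LINT M|H. exp (\<i> * of_real s * ?X N M)) - (LINT M|H. exp (\<i> * of_real s * (F M - m))) =
        (LINT M|H. exp (\<i> * of_real s * ?X N M) - exp (\<i> * of_real s * (F M - m)))"
        by (rule Bochner_Integration.integral_diff[symmetric]) (rule regular_integrable, rule reg)+
      have "norm ((LINT M|H. exp (\<i> * of_real s * ?X N M)) - (LINT M|H. exp (\<i> * of_real s * (F M - m))))
          \<le> (LINT M|H. cmod (exp (\<i> * of_real s * ?X N M) - exp (\<i> * of_real s * (F M - m))))"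
        unfolding e by (rule integral_norm_bound)
      also have "\<dots> \<le> (LINT M|H. \<bar>s\<bar> * cmod (F M - trigsum \<phi> N M))"
      proof (rule integral_mono)
        show "integrable H (\<lambda>M. cmod (exp (\<i> * of_real s * ?X N M) - exp (\<i> * of_real s * (F M - m))))"
          by (rule integrable_norm, rule regular_integrable, rule regular_diff, rule reg(1), rule reg(2))
        show "integrable H (\<lambda>M. \<bar>s\<bar> * cmod (F M - trigsum \<phi> N M))"
          by (rule integrable_mult_right, rule integrable_norm, rule regular_integrable, rule regular_diff,
            rule F(1), rule regular_trigsum)
        fix M assume "M \<in> space H"
        hence M: "M \<in> unitary_group n" by (simp add: space_H)
        have "cmod (exp (\<i> * of_real s * ?X N M) - exp (\<i> * of_real s * (F M - m))) \<le> \<bar>s\<bar> * cmod (?X N M - (F M - m))"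
          by (intro lip Xreal[OF M] Reals_diff real(1)[OF M] mreal)
        also have "cmod (?X N M - (F M - m)) = cmod (F M - trigsum \<phi> N M)"
          unfolding X[OF M] by (simp add: norm_minus_commute)
        finally show "cmod (exp (\<i> * of_real s * ?X N M) - exp (\<i> * of_real s * (F M - m))) \<le> \<bar>s\<bar> * cmod (F M - trigsum \<phi> N M)" .
      qed
      finally show "norm ((LINT M|H. exp (\<i> * of_real s * ?X N M)) - (LINT M|H. exp (\<i> * of_real s * (F M - m))))
      \<le> \<bar>s\<bar> * (LINT M|H. cmod (F M - trigsum \<phi> N M))" by simp
    qed
    show "(\<lambda>N. \<bar>s\<bar> * (LINT M|H. cmod (F M - trigsum \<phi> N M))) \<longlonglongrightarrow> 0"
      using tendsto_mult_right_zero[OF statistic_approx_L1] .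
  qed
  thus ?thesis unfolding m_def by (rule LIM_zero_cancel)
qed

end

text \<open>A function that is only Lipschitz on \<open>{-pi..<pi}\<close> jumps at \<open>- pi\<close>, where its Fourier series has the wrong limit;
  the statistics of \<open>cos_power m\<close>, which tends to the indicator of that point, show that almost surely there is no eigenvalue \<open>-1\<close>.\<close>

definition minus_one_count :: "complex mat \<Rightarrow> complex" where
  "minus_one_count M = (\<Sum>j<n. if \<theta> M j = - pi then 1 else 0)"

lemma cos_power_statistic:
  "regular (\<lambda>M. \<Sum>j<n. complex_of_real (cos_power m (\<theta> M j)))"
  "(LINT M|H. (\<Sum>j<n. complex_of_real (cos_power m (\<theta> M j)))) = of_nat n * fc (\<lambda>x. complex_of_real (cos_power m x)) 0"
proof -
  let ?w = "\<lambda>x. complex_of_real (cos_power m x)"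
  have meas: "?w \<in> borel_measurable circ" by (intro borel_measurable_of_real_circ cos_power_measurable)
  have bd: "cmod (?w x) \<le> 1" for x using cos_power_bounds[of m x] by simp
  have lip: "cmod (?w x - ?w x0) \<le> real m * cmod (cis x - cis x0)" for x x0
    unfolding of_real_diff[symmetric] norm_of_real by (rule cos_power_lipschitz)
  show reg: "regular (\<lambda>M. \<Sum>j<n. ?w (\<theta> M j))"
    by (rule statistic_regular[OF statistic_measurable[OF meas] bd]) (use lip in blast)
  show "(LINT M|H. (\<Sum>j<n. ?w (\<theta> M j))) = of_nat n * fc ?w 0"
    by (rule statistic_expectation[OF meas bd reg], rule AE_I2, rule trigsum_tendsto[OF _ meas])
      (use lip in \<open>auto simp: space_H\<close>)
qed

lemma minus_one_count_limit:
  "M \<in> unitary_group n \<Longrightarrow> (\<lambda>m. \<Sum>j<n. complex_of_real (cos_power m (\<theta> M j))) \<longlonglongrightarrow> minus_one_count M"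
  unfolding minus_one_count_def
proof (rule tendsto_sum)
  fix j assume "M \<in> unitary_group n" "j \<in> {..<n}"
  hence "(\<lambda>m. cos_power m (\<theta> M j)) \<longlonglongrightarrow> (if \<theta> M j = - pi then 1 else 0)"
    by (intro cos_power_tendsto \<theta>_range) auto
  hence "(\<lambda>m. complex_of_real (cos_power m (\<theta> M j))) \<longlonglongrightarrow> complex_of_real (if \<theta> M j = - pi then 1 else 0)"
    by (rule tendsto_of_real)
  thus "(\<lambda>m. complex_of_real (cos_power m (\<theta> M j))) \<longlonglongrightarrow> (if \<theta> M j = - pi then 1 else 0)"
    by (simp split: if_splits)
qed

lemma minus_one_count_measurable: "minus_one_count \<in> borel_measurable H"
  by (rule borel_measurable_LIMSEQ_metric[where f = "\<lambda>m M. \<Sum>j<n. complex_of_real (cos_power m (\<theta> M j))"])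
    (use cos_power_statistic(1) in \<open>auto simp: regular_def space_H intro!: minus_one_count_limit\<close>)

lemma fc_cos_power_tendsto: "(\<lambda>m. fc (\<lambda>x. complex_of_real (cos_power m x)) 0) \<longlonglongrightarrow> 0"
proof -
  have "(\<lambda>m. LINT x|circ. complex_of_real (cos_power m x)) \<longlonglongrightarrow> (LINT x|circ. complex_of_real (if x = - pi then 1 else 0))"
  proof (rule integral_dominated_convergence[where w = "\<lambda>_. 1"])
    show "AE x in circ. (\<lambda>m. complex_of_real (cos_power m x)) \<longlonglongrightarrow> complex_of_real (if x = - pi then 1 else 0)"
      by (rule AE_I2, rule tendsto_of_real, rule cos_power_tendsto) (simp add: space_circ)
    show "AE x in circ. norm (complex_of_real (cos_power m x)) \<le> 1" for m
      using cos_power_bounds by (intro AE_I2) simp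
    show "(\<lambda>x. complex_of_real (if x = - pi then 1 else 0)) \<in> borel_measurable circ"
      by (rule borel_measurable_circ) measurable
    show "(\<lambda>x. complex_of_real (cos_power m x)) \<in> borel_measurable circ" for m
      by (intro borel_measurable_of_real_circ cos_power_measurable)
  qed auto
  moreover have "(LINT x|circ. complex_of_real (if x = - pi then 1 else 0)) = 0"
  proof -
    have "AE x in lborel. indicator {- pi..<pi} x *\<^sub>R complex_of_real (if x = - pi then 1 else 0) = 0"
      using AE_lborel_singleton[of "-pi"] by eventually_elim simp
    thus ?thesis unfolding integral_circ set_lebesgue_integral_def by (rule integral_eq_zero_AE)
  qed
  ultimately have "(\<lambda>m. LINT x|circ. complex_of_real (cos_power m x)) \<longlonglongrightarrow> 0" by simp
  thus ?thesis by (simp add: fc_def tendsto_divide_zero)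
qed

lemma no_eigenvalue_minus_one: "AE M in H. \<forall>j<n. \<theta> M j \<noteq> - pi"
proof -
  have nn: "minus_one_count M = of_nat (card {j. j < n \<and> \<theta> M j = - pi})" for M
    unfolding minus_one_count_def by (simp add: sum.If_cases Int_def)
  have "(\<lambda>m. LINT M|H. (\<Sum>j<n. complex_of_real (cos_power m (\<theta> M j)))) \<longlonglongrightarrow> (LINT M|H. minus_one_count M)"
  proof (rule integral_dominated_convergence[where w = "\<lambda>_. real n"])
    show "(\<lambda>M. \<Sum>j<n. complex_of_real (cos_power m (\<theta> M j))) \<in> borel_measurable H" for m
      using cos_power_statistic(1) by (simp add: regular_def)
    show "AE M in H. norm (\<Sum>j<n. complex_of_real (cos_power m (\<theta> M j))) \<le> real n" for m
    proof (rule AE_I2)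
      fix M
      have "norm (\<Sum>j<n. complex_of_real (cos_power m (\<theta> M j))) \<le> (\<Sum>j<n. 1)"
        using cos_power_bounds by (intro sum_norm_le) simp
      thus "norm (\<Sum>j<n. complex_of_real (cos_power m (\<theta> M j))) \<le> real n" by simp
    qed
  qed (auto simp: space_H intro!: minus_one_count_measurable minus_one_count_limit)
  moreover have "(\<lambda>m. LINT M|H. (\<Sum>j<n. complex_of_real (cos_power m (\<theta> M j)))) \<longlonglongrightarrow> 0"
    unfolding cos_power_statistic(2) using tendsto_mult_right_zero[OF fc_cos_power_tendsto] .
  ultimately have z: "(LINT M|H. minus_one_count M) = 0" by (rule LIMSEQ_unique)
  have re: "Re (minus_one_count M) = real (card {j. j < n \<and> \<theta> M j = - pi})" for M unfolding nn by simp
  have e: "complex_of_real (Re (minus_one_count M)) = minus_one_count M" for M unfolding re unfolding nn by simp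
  have le: "card {j. j < n \<and> \<theta> M j = - pi} \<le> n" for M
    using card_mono[of "{..<n}" "{j. j < n \<and> \<theta> M j = - pi}"] by fastforce
  have "integrable H minus_one_count"
  proof (rule regular_integrable, rule regularI[OF minus_one_count_measurable, of "real n"])
    show "cmod (minus_one_count M) \<le> real n" for M unfolding nn using le[of M] by simp
  qed
  hence i: "integrable H (\<lambda>M. Re (minus_one_count M))" by (rule integrable_Re)
  have "complex_of_real (LINT M|H. Re (minus_one_count M)) = (LINT M|H. minus_one_count M)"
    unfolding integral_complex_of_real[symmetric] e ..
  hence "(LINT M|H. Re (minus_one_count M)) = 0" using z by simp
  hence "AE M in H. Re (minus_one_count M) = 0"
    by (subst (asm) integral_nonneg_eq_0_iff_AE[OF i]) (auto simp: re)
  thus ?thesis by eventually_elim (auto simp: re)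
qed

context
  fixes f :: "real \<Rightarrow> complex" and C Lp :: real
  assumes f: "f \<in> borel_measurable circ" "\<And>x. x \<in> {-pi..<pi} \<Longrightarrow> cmod (f x) \<le> C"
    and lip: "\<And>x y. x \<in> {-pi..<pi} \<Longrightarrow> y \<in> {-pi..<pi} \<Longrightarrow> cmod (f x - f y) \<le> Lp * \<bar>x - y\<bar>"
begin

lemma lipschitz_chord:
  assumes "x0 \<in> {-pi..<pi}" "x0 \<noteq> - pi"
  shows "\<exists>K. \<forall>x\<in>{-pi..<pi}. cmod (f x - f x0) \<le> K * cmod (cis x - cis x0)"
proof -
  have "0 \<le> pi + \<bar>x0\<bar>" "pi + \<bar>x0\<bar> < 2 * pi" using assms by auto
  from abs_diff_le_norm_cis_diff[OF this] obtain K where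
    K: "0 < K" "\<And>x y. \<bar>x - y\<bar> \<le> pi + \<bar>x0\<bar> \<Longrightarrow> \<bar>x - y\<bar> \<le> K * cmod (cis x - cis y)" by blast
  have "cmod (f x - f x0) \<le> (\<bar>Lp\<bar> * K) * cmod (cis x - cis x0)" if x: "x \<in> {-pi..<pi}" for x
  proof -
    have "cmod (f x - f x0) \<le> Lp * \<bar>x - x0\<bar>" by (rule lip[OF x assms(1)])
    also have "\<dots> \<le> \<bar>Lp\<bar> * (K * cmod (cis x - cis x0))"
      using x by (intro mult_mono K(2)) auto
    finally show ?thesis by (simp add: mult.assoc)
  qed
  thus ?thesis by (intro exI[of _ "\<bar>Lp\<bar> * K"] ballI)
qed

lemma lipschitz_statistic_measurable: "(\<lambda>M. \<Sum>j<n. f (\<theta> M j)) \<in> borel_measurable H"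
proof (rule borel_measurable_LIMSEQ_metric)
  let ?f = "\<lambda>m x. f x * (1 - complex_of_real (cos_power m x))"
  have "(\<lambda>M. \<Sum>j<n. ?f m (\<theta> M j)) \<in> borel_measurable H" for m
  proof (rule statistic_measurable)
    show "?f m \<in> borel_measurable circ"
      by (intro borel_measurable_times f(1) borel_measurable_diff borel_measurable_const borel_measurable_of_real_circ cos_power_measurable)
    fix x0 assume x0: "x0 \<in> {-pi..<pi}"
    have w: "cmod (1 - complex_of_real (cos_power m x)) \<le> 1" for x
    proof -
      have "1 - complex_of_real (cos_power m x) = complex_of_real (1 - cos_power m x)" by simp
      show ?thesis unfolding \<open>1 - complex_of_real (cos_power m x) = complex_of_real (1 - cos_power m x)\<close> norm_of_real
        using cos_power_bounds[of m x] by linarith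
    qed
    have wl: "cmod (complex_of_real (cos_power m x) - complex_of_real (cos_power m y)) \<le> real m * cmod (cis x - cis y)" for x y
      unfolding of_real_diff[symmetric] norm_of_real by (rule cos_power_lipschitz)
    have C0: "0 \<le> C" by (rule order_trans[OF norm_ge_zero f(2)[OF x0]])
    show "\<exists>K. \<forall>x\<in>{-pi..<pi}. cmod (?f m x - ?f m x0) \<le> K * cmod (cis x - cis x0)"
    proof (cases "x0 = - pi")
      case True
      have w0: "complex_of_real (cos_power m x0) = 1" by (simp add: True cos_power_def)
      have "cmod (?f m x - ?f m x0) \<le> (C * real m) * cmod (cis x - cis x0)" if x: "x \<in> {-pi..<pi}" for x
      proof -
        have "?f m x - ?f m x0 = f x * (complex_of_real (cos_power m x0) - complex_of_real (cos_power m x))"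
          by (simp add: w0)
        also have "cmod \<dots> \<le> C * (real m * cmod (cis x0 - cis x))"
          unfolding norm_mult using C0 by (intro mult_mono f x wl) auto
        finally show ?thesis by (simp add: norm_minus_commute mult.assoc)
      qed
      thus ?thesis by (intro exI[of _ "C * real m"] ballI)
    next
      case False
      from lipschitz_chord[OF x0 False] obtain K where K: "\<forall>x\<in>{-pi..<pi}. cmod (f x - f x0) \<le> K * cmod (cis x - cis x0)" by blast
      have "cmod (?f m x - ?f m x0) \<le> (K + C * real m) * cmod (cis x - cis x0)" if x: "x \<in> {-pi..<pi}" for x
      proof -
        have "?f m x - ?f m x0 = (f x - f x0) * (1 - complex_of_real (cos_power m x))
           + f x0 * (complex_of_real (cos_power m x0) - complex_of_real (cos_power m x))"
          by (simp add: algebra_simps)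
        also have "cmod \<dots> \<le> K * cmod (cis x - cis x0) * 1 + C * (real m * cmod (cis x0 - cis x))"
        proof (intro norm_triangle_le add_mono)
          show "cmod ((f x - f x0) * (1 - complex_of_real (cos_power m x))) \<le> K * cmod (cis x - cis x0) * 1"
            unfolding norm_mult using K x by (intro mult_mono w) (auto intro: order_trans[OF norm_ge_zero])
          show "cmod (f x0 * (complex_of_real (cos_power m x0) - complex_of_real (cos_power m x))) \<le> C * (real m * cmod (cis x0 - cis x))"
            unfolding norm_mult using C0 by (intro mult_mono f x0 wl) auto
        qed
        finally show ?thesis by (simp add: norm_minus_commute algebra_simps)
      qed
      thus ?thesis by (intro exI[of _ "K + C * real m"] ballI)
    qed
  qed
  thus "(\<lambda>M. (\<Sum>j<n. ?f m (\<theta> M j)) + f (- pi) * minus_one_count M) \<in> borel_measurable H" for m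
    by (rule borel_measurable_add[OF _ borel_measurable_times[OF borel_measurable_const minus_one_count_measurable]])
  fix M assume "M \<in> space H"
  hence M: "M \<in> unitary_group n" by (simp add: space_H)
  have "(\<lambda>m. (\<Sum>j<n. ?f m (\<theta> M j)) + f (- pi) * minus_one_count M) \<longlonglongrightarrow>
     (\<Sum>j<n. f (\<theta> M j) * (1 - complex_of_real (if \<theta> M j = - pi then 1 else 0))) + f (- pi) * minus_one_count M"
    by (intro tendsto_intros cos_power_tendsto \<theta>_range M) auto
  also have "(\<Sum>j<n. f (\<theta> M j) * (1 - complex_of_real (if \<theta> M j = - pi then 1 else 0))) + f (- pi) * minus_one_count M = (\<Sum>j<n. f (\<theta> M j))"
    unfolding minus_one_count_def sum_distrib_left sum.distrib[symmetric] by (intro sum.cong refl) auto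
  finally show "(\<lambda>m. (\<Sum>j<n. ?f m (\<theta> M j)) + f (- pi) * minus_one_count M) \<longlonglongrightarrow> (\<Sum>j<n. f (\<theta> M j))" .
qed

lemma lipschitz_statistic_limit: "AE M in H. (\<lambda>N. trigsum f N M) \<longlonglongrightarrow> (\<Sum>j<n. f (\<theta> M j))"
  using no_eigenvalue_minus_one AE_space[of H]
proof eventually_elim
  case (elim M)
  hence M: "M \<in> unitary_group n" by (simp add: space_H)
  show ?case
    by (rule trigsum_tendsto[OF M f(1)], rule lipschitz_chord[OF \<theta>_range[OF M]]) (use elim in auto)
qed

end

end

section \<open>Fourier integrals of Schwartz functions\<close>

lemma one_plus_square_pos: "0 < 1 + (x::real)\<^sup>2"
  by (rule add_pos_nonneg) simp_all

lemma sum_inverse_square_le: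
  assumes "0 < L"
  shows "(\<Sum>k=1..N. 1 / (1 + (real k / L)\<^sup>2)) \<le> 2 * L"
proof -
  have step: "1 / (1 + (real (Suc k) / L)\<^sup>2) \<le> L * (arctan (real (Suc k) / L) - arctan (real k / L))" for k
  proof -
    have "\<exists>z. real k / L < z \<and> z < real (Suc k) / L \<and>
      arctan (real (Suc k) / L) - arctan (real k / L) = (real (Suc k) / L - real k / L) * inverse (1 + z\<^sup>2)"
      using assms by (intro MVT2) (auto intro!: DERIV_arctan divide_strict_right_mono)
    then obtain z where z: "real k / L < z" "z < real (Suc k) / L"
      "arctan (real (Suc k) / L) - arctan (real k / L) = (real (Suc k) / L - real k / L) * inverse (1 + z\<^sup>2)" by blast
    have "0 \<le> z" using z(1) assms by (meson divide_nonneg_pos less_eq_real_def of_nat_0_le_iff order_trans)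
    hence "z\<^sup>2 \<le> (real (Suc k) / L)\<^sup>2" using z(2) by (intro power_mono) auto
    hence "inverse (1 + (real (Suc k) / L)\<^sup>2) \<le> inverse (1 + z\<^sup>2)"
      by (intro le_imp_inverse_le) (auto intro: add_pos_nonneg)
    moreover have "L * (real (Suc k) / L - real k / L) = 1" using assms by (simp add: field_simps)
    ultimately show ?thesis unfolding z(3) by (simp add: inverse_eq_divide mult.assoc[symmetric] del: of_nat_Suc)
  qed
  have "(\<Sum>k=1..N. 1 / (1 + (real k / L)\<^sup>2)) \<le> L * arctan (real N / L)"
  proof (induction N)
    case (Suc N)
    have "(\<Sum>k=1..Suc N. 1 / (1 + (real k / L)\<^sup>2)) = (\<Sum>k=1..N. 1 / (1 + (real k / L)\<^sup>2)) + 1 / (1 + (real (Suc N) / L)\<^sup>2)"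
      by simp
    also have "\<dots> \<le> L * arctan (real N / L) + L * (arctan (real (Suc N) / L) - arctan (real N / L))"
      by (intro add_mono Suc step)
    finally show ?case by (simp add: algebra_simps del: of_nat_Suc)
  qed simp
  also have "\<dots> \<le> L * 2" using assms arctan_ubound[of "real N / L"] pi_less_4 by (intro mult_left_mono) auto
  finally show ?thesis by simp
qed

lemma schwartz_deriv: "schwartz g \<Longrightarrow> schwartz (deriv g)"
proof -
  assume g: "schwartz g"
  have e: "(deriv ^^ k) (deriv g) = (deriv ^^ Suc k) g" for k by (simp add: funpow_swap1)
  show ?thesis using g unfolding schwartz_def e by blast
qed

lemma schwartz_has_derivative:
  assumes "schwartz g"
  shows "(g has_real_derivative deriv g x) (at x)"
proof -
  have "(deriv ^^ 0) g field_differentiable at x" using assms unfolding schwartz_def by blast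
  thus ?thesis by (simp add: DERIV_deriv_iff_field_differentiable)
qed

lemma schwartz_isCont: "schwartz g \<Longrightarrow> isCont g x"
  using schwartz_has_derivative DERIV_isCont by blast

lemma schwartz_measurable: "schwartz g \<Longrightarrow> g \<in> borel_measurable borel"
  by (intro borel_measurable_continuous_onI continuous_at_imp_continuous_on ballI schwartz_isCont)

lemma schwartz_bound:
  assumes "schwartz g"
  obtains C where "0 < C" "\<And>x. \<bar>g x\<bar> \<le> C / (1 + x\<^sup>2)\<^sup>2"
proof -
  have "\<exists>C. \<forall>x. \<bar>x ^ j * g x\<bar> \<le> C" for j
  proof -
    have "bounded (range (\<lambda>x. x ^ j * (deriv ^^ 0) g x))" using assms unfolding schwartz_def by blast
    thus ?thesis by (auto simp: bounded_iff)
  qed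
  then obtain C where C: "\<And>j x. \<bar>x ^ j * g x\<bar> \<le> C j" by metis
  define D where "D = \<bar>C 0\<bar> + 2 * \<bar>C 2\<bar> + \<bar>C 4\<bar> + 1"
  have "\<bar>g x\<bar> \<le> D / (1 + x\<^sup>2)\<^sup>2" for x
  proof -
    have "(1 + x\<^sup>2)\<^sup>2 * \<bar>g x\<bar> = \<bar>x ^ 0 * g x\<bar> + 2 * \<bar>x ^ 2 * g x\<bar> + \<bar>x ^ 4 * g x\<bar>"
    proof -
      have "\<bar>x ^ 2 * g x\<bar> = x\<^sup>2 * \<bar>g x\<bar>" "\<bar>x ^ 4 * g x\<bar> = x ^ 4 * \<bar>g x\<bar>"
        by (simp_all add: abs_mult power_even_abs)
      thus ?thesis by (simp add: power2_eq_square power4_eq_xxxx algebra_simps)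
    qed
    also have "\<dots> \<le> D" using C[of x 0] C[of x 2] C[of x 4] unfolding D_def by linarith
    finally show ?thesis by (simp add: pos_le_divide_eq[OF zero_less_power[OF one_plus_square_pos]] mult.commute)
  qed
  moreover have "0 < D" unfolding D_def by linarith
  ultimately show ?thesis using that[of D] by blast
qed

lemma schwartz_bound2:
  assumes "schwartz g"
  obtains C where "0 < C" "\<And>x. \<bar>g x\<bar> \<le> C / (1 + x\<^sup>2)"
proof -
  obtain C where C: "0 < C" "\<And>x. \<bar>g x\<bar> \<le> C / (1 + x\<^sup>2)\<^sup>2" using schwartz_bound[OF assms] by blast
  have "\<bar>g x\<bar> \<le> C / (1 + x\<^sup>2)" for x
  proof (rule order_trans[OF C(2)], rule divide_left_mono)
    show "1 + x\<^sup>2 \<le> (1 + x\<^sup>2)\<^sup>2" using mult_left_mono[of 1 "1 + x\<^sup>2" "1 + x\<^sup>2"] by (simp add: power2_eq_square)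
  qed (use C one_plus_square_pos[of x] in \<open>auto intro!: mult_pos_pos zero_less_power\<close>)
  thus ?thesis using that[OF C(1)] by blast
qed

lemma integrable_inverse_square: "integrable lborel (\<lambda>x::real. C / (1 + x\<^sup>2))"
proof -
  have "integrable lborel (\<lambda>x::real. inverse (1 + x\<^sup>2))"
    using integrable_inverse_1_plus_square by (simp add: set_integrable_def)
  hence "integrable lborel (\<lambda>x::real. C * inverse (1 + x\<^sup>2))" by (rule integrable_mult_right)
  thus ?thesis by (simp add: divide_inverse)
qed

lemma integral_inverse_square: "(LINT x|lborel. 1 / (1 + (x::real)\<^sup>2)) = pi"
  using LBINT_inverse_1_plus_square
  by (simp add: interval_lebesgue_integral_def set_lebesgue_integral_def inverse_eq_divide)

lemma schwartz_integrable:
  assumes "schwartz g"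
  shows "integrable lborel g"
proof -
  obtain C where C: "0 < C" "\<And>x. \<bar>g x\<bar> \<le> C / (1 + x\<^sup>2)" using schwartz_bound2[OF assms] by blast
  show ?thesis
    by (rule Bochner_Integration.integrable_bound[OF integrable_inverse_square[of C]])
      (use C schwartz_measurable[OF assms] in \<open>auto intro!: AE_I2 order_trans[OF C(2)]\<close>)
qed

lemma schwartz_cis_integrable:
  assumes "schwartz g"
  shows "integrable lborel (\<lambda>x. complex_of_real (g x) * cis (- (t * x)))"
proof (rule Bochner_Integration.integrable_bound[OF schwartz_integrable[OF assms]])
  have "(\<lambda>x. cis (- (t * x))) \<in> borel_measurable borel"
    by (intro borel_measurable_continuous_onI continuous_intros)
  thus "(\<lambda>x. complex_of_real (g x) * cis (- (t * x))) \<in> borel_measurable lborel"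
    using schwartz_measurable[OF assms] by simp
qed (simp add: norm_mult)

lemma schwartz_tendsto:
  assumes "schwartz g"
  shows "((\<lambda>x. complex_of_real (g x) * cis (- (t * x))) \<longlongrightarrow> 0) at_top"
    "((\<lambda>x. complex_of_real (g x) * cis (- (t * x))) \<longlongrightarrow> 0) at_bot"
proof -
  obtain C where C: "0 < C" "\<And>x. \<bar>g x\<bar> \<le> C / (1 + x\<^sup>2)" using schwartz_bound2[OF assms] by blast
  have n: "norm (complex_of_real (g x) * cis (- (t * x))) \<le> C / (1 + x\<^sup>2)" for x
    using C(2)[of x] by (simp add: norm_mult)
  have "((\<lambda>x::real. C / (1 + x\<^sup>2)) \<longlongrightarrow> 0) at_top" "((\<lambda>x::real. C / (1 + x\<^sup>2)) \<longlongrightarrow> 0) at_bot"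
    by real_asymp+
  thus "((\<lambda>x. complex_of_real (g x) * cis (- (t * x))) \<longlongrightarrow> 0) at_top"
    "((\<lambda>x. complex_of_real (g x) * cis (- (t * x))) \<longlongrightarrow> 0) at_bot"
    by (auto intro!: Lim_null_comparison[where g = "\<lambda>x. C / (1 + x\<^sup>2)"] always_eventually n)
qed

lemma isCont_cis_linear: "isCont (\<lambda>x. cis (- (t * x))) x"
proof -
  have "continuous_on UNIV (\<lambda>x. cis (- (t * x)))" by (intro continuous_intros)
  thus ?thesis by (simp add: continuous_on_eq_continuous_at)
qed

definition fti :: "real set \<Rightarrow> (real \<Rightarrow> real) \<Rightarrow> real \<Rightarrow> complex" where
  "fti A g t = (LINT x:A|lborel. complex_of_real (g x) * cis (- (t * x)))"

lemma fti_norm_le: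
  assumes "schwartz g" "A \<in> sets borel"
  shows "cmod (fti A g t) \<le> (LINT x:A|lborel. \<bar>g x\<bar>)"
proof -
  have "cmod (fti A g t) \<le> (LINT x|lborel. norm (indicator A x *\<^sub>R (complex_of_real (g x) * cis (- (t * x)))))"
    unfolding fti_def set_lebesgue_integral_def by (rule integral_norm_bound)
  also have "\<dots> = (LINT x:A|lborel. \<bar>g x\<bar>)"
    unfolding set_lebesgue_integral_def by (intro Bochner_Integration.integral_cong) (auto simp: norm_mult)
  finally show ?thesis .
qed

lemma fti_by_parts:
  fixes a b :: ereal
  assumes g: "schwartz g" and ab: "a < b"
    and A: "(((\<lambda>x. complex_of_real (g x) * cis (- (t * x))) \<circ> real_of_ereal) \<longlongrightarrow> A) (at_right a)"
    and B: "(((\<lambda>x. complex_of_real (g x) * cis (- (t * x))) \<circ> real_of_ereal) \<longlongrightarrow> B) (at_left b)"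
  shows "\<i> * of_real t * fti (einterval a b) g t = A - B + fti (einterval a b) (deriv g) t"
proof -
  let ?E = "einterval a b"
  let ?f = "\<lambda>x. complex_of_real (deriv g x) * cis (- (t * x)) - \<i> * of_real t * (complex_of_real (g x) * cis (- (t * x)))"
  have si: "set_integrable lborel ?E (\<lambda>x. complex_of_real (u x) * cis (- (t * x)))" if "schwartz u" for u
    unfolding set_integrable_def using integrable_mult_indicator[OF _ schwartz_cis_integrable[OF that]] by simp
  have si2: "set_integrable lborel ?E (\<lambda>x. \<i> * of_real t * (complex_of_real (g x) * cis (- (t * x))))"
    by (rule set_integrable_mult_right) (simp add: si[OF g])
  have "(LBINT x=a..b. ?f x) = B - A"
  proof (rule interval_integral_FTC_integrable[OF ab _ _ _ A B])
    fix x
    show "((\<lambda>x. complex_of_real (g x) * cis (- (t * x))) has_vector_derivative ?f x) (at x)"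
    proof -
      have "((\<lambda>z. exp (- (\<i> * of_real t * z))) has_field_derivative - (\<i> * of_real t) * exp (- (\<i> * of_real t * of_real x))) (at (of_real x))"
        by (auto intro!: derivative_eq_intros)
      from has_vector_derivative_real_field[OF this]
      have "((\<lambda>x. cis (- (t * x))) has_vector_derivative - (\<i> * of_real t) * cis (- (t * x))) (at x)"
        by (simp add: cis_conv_exp mult.assoc)
      from has_vector_derivative_mult[OF has_vector_derivative_of_real[OF schwartz_has_derivative[OF g]] this]
      show ?thesis by (simp add: algebra_simps)
    qed
    show "isCont ?f x"
      by (intro continuous_intros isCont_cis_linear schwartz_isCont[OF g] schwartz_isCont[OF schwartz_deriv[OF g]])
  next
    show "set_integrable lborel ?E ?f"
      by (intro set_integral_diff si[OF schwartz_deriv[OF g]] si2)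
  qed
  hence "(LINT x:?E|lborel. ?f x) = B - A" using ab by (simp add: interval_lebesgue_integral_le_eq)
  hence "fti ?E (deriv g) t - \<i> * of_real t * fti ?E g t = B - A"
    unfolding fti_def by (subst (asm) set_integral_diff(2)[OF si[OF schwartz_deriv[OF g]] si2]) simp
  thus ?thesis by (simp add: algebra_simps)
qed

lemma fti_by_parts_cases:
  assumes g: "schwartz g"
  shows "\<i> * of_real t * fti UNIV g t = fti UNIV (deriv g) t"
    and "\<i> * of_real t * fti {a<..} g t = g a * cis (- (t * a)) + fti {a<..} (deriv g) t"
    and "\<i> * of_real t * fti {..<a} g t = - (complex_of_real (g a) * cis (- (t * a))) + fti {..<a} (deriv g) t"
proof -
  let ?F = "\<lambda>x. complex_of_real (g x) * cis (- (t * x))"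
  have top: "((?F \<circ> real_of_ereal) \<longlongrightarrow> 0) (at_left \<infinity>)" and bot: "((?F \<circ> real_of_ereal) \<longlongrightarrow> 0) (at_right (- \<infinity>))"
    using schwartz_tendsto[OF g, of t] by (auto simp: ereal_tendsto_simps)
  have c: "isCont ?F a" by (intro continuous_intros isCont_cis_linear schwartz_isCont[OF g])
  have r: "((?F \<circ> real_of_ereal) \<longlongrightarrow> ?F a) (at_right (ereal a))" and l: "((?F \<circ> real_of_ereal) \<longlongrightarrow> ?F a) (at_left (ereal a))"
    using c unfolding ereal_tendsto_simps isCont_def by (auto intro: filterlim_at_split[THEN iffD1, THEN conjunct1] filterlim_at_split[THEN iffD1, THEN conjunct2])
  show "\<i> * of_real t * fti UNIV g t = fti UNIV (deriv g) t"
    using fti_by_parts[OF g _ bot top] by simp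
  show "\<i> * of_real t * fti {a<..} g t = g a * cis (- (t * a)) + fti {a<..} (deriv g) t"
    using fti_by_parts[OF g _ r top] by simp
  show "\<i> * of_real t * fti {..<a} g t = - (complex_of_real (g a) * cis (- (t * a))) + fti {..<a} (deriv g) t"
    using fti_by_parts[OF g _ bot l] by simp
qed

lemma fti_UNIV: "fti UNIV g t = (LINT x|lborel. complex_of_real (g x) * cis (- (t * x)))"
  by (simp add: fti_def set_lebesgue_integral_def)

lemma fti_decay:
  assumes g: "schwartz g"
  obtains A where "0 < A" "\<And>t. cmod (fti UNIV g t) \<le> A / (1 + \<bar>t\<bar> ^ 3)"
proof -
  let ?I = "\<lambda>u. LINT x:UNIV|lborel. \<bar>u x :: real\<bar>"
  note g1 = schwartz_deriv[OF g] note g2 = schwartz_deriv[OF g1] note g3 = schwartz_deriv[OF g2]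
  define A where "A = \<bar>?I g\<bar> + \<bar>?I (deriv (deriv (deriv g)))\<bar> + 1"
  have "cmod (fti UNIV g t) \<le> A / (1 + \<bar>t\<bar> ^ 3)" for t
  proof -
    have "fti UNIV (deriv (deriv (deriv g))) t = (\<i> * of_real t) ^ 3 * fti UNIV g t"
      unfolding fti_by_parts_cases(1)[OF g2, symmetric] fti_by_parts_cases(1)[OF g1, symmetric]
        fti_by_parts_cases(1)[OF g, symmetric] by (simp add: power3_eq_cube)
    hence "\<bar>t\<bar> ^ 3 * cmod (fti UNIV g t) = cmod (fti UNIV (deriv (deriv (deriv g))) t)"
      by (simp add: norm_mult norm_power)
    also have "\<dots> \<le> ?I (deriv (deriv (deriv g)))" by (rule fti_norm_le[OF g3]) simp
    finally have "(1 + \<bar>t\<bar> ^ 3) * cmod (fti UNIV g t) \<le> A"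
      using fti_norm_le[OF g, of UNIV t] unfolding A_def by (simp add: distrib_right)
    moreover have "0 < 1 + \<bar>t\<bar> ^ 3" by (rule add_pos_nonneg) simp_all
    ultimately show ?thesis by (simp add: pos_le_divide_eq mult.commute)
  qed
  moreover have "0 < A" unfolding A_def by linarith
  ultimately show ?thesis using that[of A] by blast
qed

lemma fti_isCont:
  assumes g: "schwartz g"
  shows "isCont (fti UNIV g) t"
  unfolding continuous_at_sequentially
proof (intro allI impI)
  fix x assume x: "x \<longlonglongrightarrow> t"
  show "(fti UNIV g \<circ> x) \<longlonglongrightarrow> fti UNIV g t"
    unfolding fti_UNIV o_def
  proof (rule integral_dominated_convergence[where w = "\<lambda>x. \<bar>g x\<bar>"])
    show "AE y in lborel. (\<lambda>i. complex_of_real (g y) * cis (- (x i * y))) \<longlonglongrightarrow> complex_of_real (g y) * cis (- (t * y))"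
      using x by (intro AE_I2 tendsto_intros)
    show "integrable lborel (\<lambda>x. \<bar>g x\<bar>)" using schwartz_integrable[OF g] by simp
  qed (use schwartz_cis_integrable[OF g] in \<open>auto simp: norm_mult\<close>)
qed

lemma fti_uminus: "fti UNIV g (- t) = cnj (fti UNIV g t)"
  unfolding fti_UNIV Bochner_Integration.integral_cnj[symmetric] by (simp add: cis_cnj)

lemma step_sum_integral:
  fixes h :: "real \<Rightarrow> real"
  assumes L: "0 < L"
  shows "set_integrable lborel {0<..real N / L} (\<lambda>t. h (of_int \<lceil>L * t\<rceil> / L))
    \<and> (LINT t:{0<..real N / L}|lborel. h (of_int \<lceil>L * t\<rceil> / L)) = (\<Sum>k=1..N. h (real k / L) / L)"
proof (induction N)
  case 0
  show ?case by (simp add: set_integrable_def set_lebesgue_integral_def)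
next
  case (Suc N)
  let ?h = "\<lambda>t. h (of_int \<lceil>L * t\<rceil> / L)"
  let ?J = "{real N / L<..real (Suc N) / L}"
  have J: "?h t = h (real (Suc N) / L)" if "t \<in> ?J" for t
  proof -
    have "\<lceil>L * t\<rceil> = int (Suc N)"
      using that L by (intro ceiling_unique) (auto simp: field_simps)
    thus ?thesis by simp
  qed
  have eq: "(\<lambda>t. indicator ?J t *\<^sub>R ?h t) = (\<lambda>t. indicator ?J t *\<^sub>R h (real (Suc N) / L))"
    using J by (auto simp: indicator_def fun_eq_iff)
  have le: "real N / L \<le> real (Suc N) / L" using L by (intro divide_right_mono) auto
  have iJ: "set_integrable lborel ?J ?h"
    unfolding set_integrable_def eq using le by (intro integrable_scaleR_left integrable_real_indicator) (auto simp: emeasure_lborel_Ioc)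
  have "(LINT t:?J|lborel. ?h t) = measure lborel ?J *\<^sub>R h (real (Suc N) / L)"
    unfolding set_lebesgue_integral_def eq by (subst integral_scaleR_left) (use le in \<open>auto simp: emeasure_lborel_Ioc\<close>)
  also have "measure lborel ?J = 1 / L" using le L by (simp add: field_simps)
  finally have vJ: "(LINT t:?J|lborel. ?h t) = h (real (Suc N) / L) / L" by simp
  have U: "{0<..real (Suc N) / L} = {0<..real N / L} \<union> ?J"
    using L le by (intro ivl_disj_un_two(6)[symmetric]) auto
  have "(LINT t:{0<..real (Suc N) / L}|lborel. ?h t) = (LINT t:{0<..real N / L}|lborel. ?h t) + (LINT t:?J|lborel. ?h t)"
    unfolding U using Suc iJ by (intro set_integral_Un) auto
  moreover have "set_integrable lborel {0<..real (Suc N) / L} ?h"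
    unfolding U using Suc iJ by (intro set_integrable_Un) auto
  ultimately show ?case using Suc vJ by simp
qed

lemma riemann_sum_tendsto:
  fixes h :: "real \<Rightarrow> real" and L :: "nat \<Rightarrow> real"
  assumes cont: "\<And>t. isCont h t" and bound: "\<And>t. 0 \<le> t \<Longrightarrow> \<bar>h t\<bar> \<le> C / (1 + t\<^sup>2)" and "0 \<le> C"
    and Lpos: "\<And>n. 0 < L n" and Linf: "filterlim L at_top sequentially"
  obtains v where "\<And>n. (\<lambda>N. \<Sum>k=1..N. h (real k / L n) / L n) \<longlonglongrightarrow> v n"
    and "v \<longlonglongrightarrow> (LINT t:{0<..}|lborel. h t)"
proof -
  let ?s = "\<lambda>L t. h (of_int \<lceil>L * t\<rceil> / L)"
  have hm: "h \<in> borel_measurable borel"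
    using cont by (intro borel_measurable_continuous_onI continuous_at_imp_continuous_on) auto
  have sm: "?s L \<in> borel_measurable borel" for L using hm by measurable
  have ge: "t \<le> of_int \<lceil>L * t\<rceil> / L" "of_int \<lceil>L * t\<rceil> / L \<le> t + 1 / L" if "0 < L" for L t
    using that le_of_int_ceiling[of "L * t"] of_int_ceiling_le_add_one[of "L * t"] by (auto simp: field_simps)
  have sb: "\<bar>?s L t\<bar> \<le> C / (1 + t\<^sup>2)" if "0 < L" "0 < t" for L t
  proof -
    have "\<bar>?s L t\<bar> \<le> C / (1 + (of_int \<lceil>L * t\<rceil> / L)\<^sup>2)"
      using ge(1)[OF that(1), of t] that by (intro bound) linarith
    also have "\<dots> \<le> C / (1 + t\<^sup>2)"
      using ge(1)[OF that(1), of t] that \<open>0 \<le> C\<close>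
      by (intro divide_left_mono add_left_mono power_mono mult_pos_pos add_pos_nonneg) auto
    finally show ?thesis .
  qed
  define v where "v = (\<lambda>n. LINT t:{0<..}|lborel. ?s (L n) t)"
  have "(\<lambda>N. \<Sum>k=1..N. h (real k / L n) / L n) \<longlonglongrightarrow> v n" for n
  proof -
    have "(\<lambda>N. LINT t:{0<..real N / L n}|lborel. ?s (L n) t) \<longlonglongrightarrow> v n"
      unfolding v_def set_lebesgue_integral_def
    proof (rule integral_dominated_convergence[where w = "\<lambda>t. C / (1 + t\<^sup>2)"])
      show "AE t in lborel. (\<lambda>N. indicator {0<..real N / L n} t *\<^sub>R ?s (L n) t) \<longlonglongrightarrow> indicator {0<..} t *\<^sub>R ?s (L n) t"
      proof (rule AE_I2)
        fix t
        have "\<forall>\<^sub>F N in sequentially. t * L n \<le> real N"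
          using filterlim_real_sequentially unfolding filterlim_at_top by blast
        hence "\<forall>\<^sub>F N in sequentially. indicator {0<..real N / L n} t *\<^sub>R ?s (L n) t = indicator {0<..} t *\<^sub>R ?s (L n) t"
          by eventually_elim (use Lpos[of n] in \<open>auto simp: indicator_def field_simps\<close>)
        thus "(\<lambda>N. indicator {0<..real N / L n} t *\<^sub>R ?s (L n) t) \<longlonglongrightarrow> indicator {0<..} t *\<^sub>R ?s (L n) t"
          by (rule tendsto_eventually)
      qed
      show "AE t in lborel. norm (indicator {0<..real N / L n} t *\<^sub>R ?s (L n) t) \<le> C / (1 + t\<^sup>2)" for N
        using sb[OF Lpos[of n]] \<open>0 \<le> C\<close> by (auto simp: indicator_def intro!: AE_I2 divide_nonneg_pos add_pos_nonneg)
    qed (use sm[of "L n"] integrable_inverse_square in \<open>auto intro!: borel_measurable_scaleR\<close>)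
    thus ?thesis using step_sum_integral[OF Lpos[of n], of _ h] by simp
  qed
  moreover have "v \<longlonglongrightarrow> (LINT t:{0<..}|lborel. h t)"
    unfolding v_def set_lebesgue_integral_def
  proof (rule integral_dominated_convergence[where w = "\<lambda>t. C / (1 + t\<^sup>2)"])
    show "AE t in lborel. (\<lambda>n. indicator {0<..} t *\<^sub>R ?s (L n) t) \<longlonglongrightarrow> indicator {0<..} t *\<^sub>R h t"
    proof (rule AE_I2, rule tendsto_scaleR[OF tendsto_const])
      fix t
      have "(\<lambda>n. t + 1 / L n) \<longlonglongrightarrow> t + 0"
        using tendsto_inverse_0_at_top[OF Linf] by (intro tendsto_add tendsto_const) (simp add: inverse_eq_divide)
      hence t: "(\<lambda>n. t + 1 / L n) \<longlonglongrightarrow> t" by simp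
      have "(\<lambda>n. of_int \<lceil>L n * t\<rceil> / L n) \<longlonglongrightarrow> t"
        by (rule tendsto_sandwich[OF _ _ tendsto_const t]) (use ge[OF Lpos] in \<open>auto intro!: always_eventually\<close>)
      thus "(\<lambda>n. ?s (L n) t) \<longlonglongrightarrow> h t" by (rule isCont_tendsto_compose[OF cont])
    qed
    show "AE t in lborel. norm (indicator {0<..} t *\<^sub>R ?s (L n) t) \<le> C / (1 + t\<^sup>2)" for n
      using sb[OF Lpos[of n]] \<open>0 \<le> C\<close> by (auto simp: indicator_def intro!: AE_I2 divide_nonneg_pos add_pos_nonneg)
  qed (use sm hm integrable_inverse_square in \<open>auto intro!: borel_measurable_scaleR\<close>)
  ultimately show ?thesis by (rule that[of v])
qed

section \<open>Periodised dilations\<close>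

lemma cis_period: "cis (x + 2 * pi * of_int m) = cis x"
  unfolding cis_mult[symmetric] cis_multiple_2pi[OF Ints_of_int] by simp

lemma sum_symmetric_int:
  fixes f :: "int \<Rightarrow> 'a::comm_monoid_add"
  shows "(\<Sum>k\<in>{- int N..int N} - {0}. f k) = (\<Sum>k=1..N. f (int k) + f (- int k))"
proof (induction N)
  case (Suc N)
  have e: "{- int (Suc N)..int (Suc N)} - {0} = insert (int (Suc N)) (insert (- int (Suc N)) ({- int N..int N} - {0}))"
    by auto
  have "(\<Sum>k\<in>{- int (Suc N)..int (Suc N)} - {0}. f k) = f (int (Suc N)) + (f (- int (Suc N)) + (\<Sum>k\<in>{- int N..int N} - {0}. f k))"
    unfolding e by (subst sum.insert, simp, simp, subst sum.insert, simp_all)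
  thus ?case unfolding Suc by (simp add: ac_simps)
qed simp

lemma sum_int_atLeast1:
  fixes f :: "int \<Rightarrow> 'a::comm_monoid_add"
  shows "(\<Sum>k\<in>{1..int N}. f k) = (\<Sum>k=1..N. f (int k))"
proof (induction N)
  case (Suc N)
  have e: "{1..int (Suc N)} = insert (int (Suc N)) {1..int N}" by auto
  have "(\<Sum>k\<in>{1..int (Suc N)}. f k) = f (int (Suc N)) + (\<Sum>k\<in>{1..int N}. f k)"
    unfolding e by (subst sum.insert) simp_all
  thus ?case unfolding Suc by (simp add: ac_simps)
qed simp

lemma frac_le_cross: "0 < b \<Longrightarrow> 0 < d \<Longrightarrow> a * d \<le> c * b \<Longrightarrow> a / b \<le> c / (d::real)"
  by (simp add: field_simps)

lemma symmetric_inverse_square_sum_le: "(\<Sum>k\<in>{- int N..int N}. 1 / (1 + (real_of_int k)\<^sup>2)) \<le> 5"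
proof -
  have "(\<Sum>k\<in>{- int N..int N}. 1 / (1 + (real_of_int k)\<^sup>2)) = 1 + (\<Sum>k\<in>{- int N..int N} - {0}. 1 / (1 + (real_of_int k)\<^sup>2))"
    by (subst sum.remove[of _ 0]) auto
  also have "(\<Sum>k\<in>{- int N..int N} - {0}. 1 / (1 + (real_of_int k)\<^sup>2)) = 2 * (\<Sum>k=1..N. 1 / (1 + (real k / 1)\<^sup>2))"
    unfolding sum_symmetric_int sum_distrib_left by (intro sum.cong) auto
  also have "\<dots> \<le> 2 * (2 * 1)" by (intro mult_left_mono sum_inverse_square_le) auto
  finally show ?thesis by simp
qed

lemma finite_int_bounded: "finite (X :: int set) \<Longrightarrow> \<exists>N. X \<subseteq> {- int N..int N}"
proof -
  assume "finite X"
  then obtain k where "abs ` X \<subseteq> {..k}" by (auto simp: finite_int_iff_bounded_le)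
  hence "X \<subseteq> {- int (nat k)..int (nat k)}" by fastforce
  thus ?thesis by blast
qed

lemma filterlim_symmetric_int: "filterlim (\<lambda>N. {- int N..int N}) (finite_subsets_at_top UNIV) sequentially"
  unfolding filterlim_finite_subsets_at_top
proof (intro allI impI)
  fix X :: "int set" assume "finite X \<and> X \<subseteq> UNIV"
  then obtain N0 where "X \<subseteq> {- int N0..int N0}" using finite_int_bounded by blast
  hence "finite {- int N..int N} \<and> X \<subseteq> {- int N..int N} \<and> {- int N..int N} \<subseteq> UNIV" if "N0 \<le> N" for N
    using that by fastforce
  thus "\<forall>\<^sub>F N in sequentially. finite {- int N..int N} \<and> X \<subseteq> {- int N..int N} \<and> {- int N..int N} \<subseteq> UNIV"
    unfolding eventually_sequentially by blast
qed

lemma schwartz_shift_bound: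
  assumes u: "schwartz u" and L: "0 < L"
  obtains B where "0 < B" "\<And>x (k::int). \<bar>x\<bar> \<le> 2 * pi \<Longrightarrow> \<bar>u (L * (x + 2 * pi * of_int k))\<bar> \<le> B / (1 + (of_int k)\<^sup>2)"
proof -
  obtain C where C: "0 < C" "\<And>y. \<bar>u y\<bar> \<le> C / (1 + y\<^sup>2)" using schwartz_bound2[OF u] by blast
  have "\<bar>u (L * (x + 2 * pi * of_int k))\<bar> \<le> (C * (2 + 1 / L\<^sup>2)) / (1 + (of_int k)\<^sup>2)" if x: "\<bar>x\<bar> \<le> 2 * pi" for x and k :: int
  proof -
    define y where "y = L * (x + 2 * pi * of_int k)"
    have key: "1 + (real_of_int k)\<^sup>2 \<le> (2 + 1 / L\<^sup>2) * (1 + y\<^sup>2)"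
    proof (cases "\<bar>k\<bar> \<le> 1")
      case True
      hence "k = 0 \<or> k = 1 \<or> k = -1" by arith
      hence "1 + (real_of_int k)\<^sup>2 \<le> 2 * 1" by auto
      also have "2 * 1 \<le> (2 + 1 / L\<^sup>2) * (1 + y\<^sup>2)" by (rule mult_mono) auto
      finally show ?thesis .
    next
      case False
      hence k: "2 \<le> \<bar>real_of_int k\<bar>" by linarith
      have "\<bar>2 * pi * of_int k\<bar> - \<bar>x\<bar> \<le> \<bar>x + 2 * pi * of_int k\<bar>" by linarith
      moreover have "\<bar>2 * pi * of_int k\<bar> = 2 * (pi * \<bar>of_int k\<bar>)" by (simp add: abs_mult)
      moreover have "pi * 2 \<le> pi * \<bar>of_int k\<bar>" using k by (intro mult_left_mono) auto
      moreover have "1 * \<bar>of_int k\<bar> \<le> pi * \<bar>of_int k\<bar>" using pi_ge_two by (intro mult_right_mono) auto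
      ultimately have "\<bar>of_int k\<bar> \<le> \<bar>x + 2 * pi * of_int k\<bar>" using x by linarith
      hence "L * \<bar>of_int k\<bar> \<le> \<bar>y\<bar>" unfolding y_def abs_mult using L by simp
      hence "(L * \<bar>of_int k\<bar>)\<^sup>2 \<le> y\<^sup>2" using power_mono[of "L * \<bar>of_int k\<bar>" "\<bar>y\<bar>" 2] L by simp
      hence "(real_of_int k)\<^sup>2 \<le> y\<^sup>2 / L\<^sup>2" using L by (simp add: power_mult_distrib pos_le_divide_eq mult.commute)
      hence "1 + (real_of_int k)\<^sup>2 \<le> 1 + y\<^sup>2 / L\<^sup>2" by simp
      also have "\<dots> \<le> (2 + 1 / L\<^sup>2) * (1 + y\<^sup>2)"
      proof -
        have "(2 + 1 / L\<^sup>2) * (1 + y\<^sup>2) = 2 + 2 * y\<^sup>2 + 1 / L\<^sup>2 + y\<^sup>2 / L\<^sup>2"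
          by (simp add: distrib_left distrib_right)
        moreover have "0 \<le> y\<^sup>2" "0 \<le> 1 / L\<^sup>2" by simp_all
        ultimately show ?thesis by linarith
      qed
      finally show ?thesis .
    qed
    have "C / (1 + y\<^sup>2) \<le> (C * (2 + 1 / L\<^sup>2)) / (1 + (of_int k)\<^sup>2)"
      using mult_left_mono[OF key, of C] C(1) by (intro frac_le_cross one_plus_square_pos) (simp add: mult.assoc)
    thus ?thesis using C(2)[of y] unfolding y_def by linarith
  qed
  moreover have "0 < C * (2 + 1 / L\<^sup>2)" using C L by (intro mult_pos_pos add_pos_pos) auto
  ultimately show ?thesis by (rule that[rotated])
qed

lemma dilate_circle_periodic: "dilate_circle L g (x + 2 * pi * of_int m) = dilate_circle L g x"
proof -
  have "bij_betw (\<lambda>k. k + m) UNIV UNIV" by (rule bij_betw_byWitness[where f' = "\<lambda>k. k - m"]) auto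
  note r = infsum_reindex_bij_betw[OF this, of "\<lambda>k. g (L * (x + 2 * pi * of_int k))"]
  have e: "x + 2 * pi * of_int m + 2 * pi * of_int k = x + 2 * pi * of_int (k + m)" for k
    by (simp add: distrib_left)
  show ?thesis unfolding dilate_circle_def e by (rule r)
qed

context
  fixes g :: "real \<Rightarrow> real" and L :: real
  assumes g: "schwartz g" and L: "0 < L"
begin

lemma dilate_circle_tendsto:
  assumes x: "\<bar>x\<bar> \<le> 2 * pi"
  shows "(\<lambda>N. \<Sum>k\<in>{- int N..int N}. g (L * (x + 2 * pi * of_int k))) \<longlonglongrightarrow> dilate_circle L g x"
proof -
  obtain B where B: "0 < B" "\<And>x (k::int). \<bar>x\<bar> \<le> 2 * pi \<Longrightarrow> \<bar>g (L * (x + 2 * pi * of_int k))\<bar> \<le> B / (1 + (of_int k)\<^sup>2)"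
    using schwartz_shift_bound[OF g L] by blast
  have "sum (\<lambda>k. norm (g (L * (x + 2 * pi * of_int k)))) X \<le> B * 5" if X: "finite X" for X :: "int set"
  proof -
    obtain N where N: "X \<subseteq> {- int N..int N}" using finite_int_bounded[OF X] by blast
    have "sum (\<lambda>k. norm (g (L * (x + 2 * pi * of_int k)))) X \<le> (\<Sum>k\<in>{- int N..int N}. norm (g (L * (x + 2 * pi * of_int k))))"
      by (rule sum_mono2) (use N in auto)
    also have "\<dots> \<le> (\<Sum>k\<in>{- int N..int N}. B * (1 / (1 + (real_of_int k)\<^sup>2)))"
      using B(2)[OF x] by (intro sum_mono) auto
    also have "\<dots> \<le> B * 5"
      unfolding sum_distrib_left[symmetric] using B(1) by (intro mult_left_mono symmetric_inverse_square_sum_le) auto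
    finally show ?thesis .
  qed
  hence "(\<lambda>k. norm (g (L * (x + 2 * pi * of_int k)))) summable_on UNIV"
    by (intro nonneg_bounded_partial_sums_imp_summable_on[where C = "B * 5"] eventually_finite_subsets_at_top_weakI) auto
  hence "(\<lambda>k. g (L * (x + 2 * pi * of_int k))) summable_on UNIV" by (rule abs_summable_summable)
  hence "((\<lambda>k. g (L * (x + 2 * pi * of_int k))) has_sum dilate_circle L g x) UNIV"
    unfolding dilate_circle_def by (rule has_sum_infsum)
  thus ?thesis unfolding has_sum_def by (rule filterlim_compose[OF _ filterlim_symmetric_int])
qed

lemma dilate_circle_bounds:
  "\<exists>C. (\<forall>x N. \<bar>x\<bar> \<le> 2 * pi \<longrightarrow> \<bar>\<Sum>k\<in>{- int N..int N}. g (L * (x + 2 * pi * of_int k))\<bar> \<le> C)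
    \<and> (\<forall>x. \<bar>x\<bar> \<le> 2 * pi \<longrightarrow> \<bar>dilate_circle L g x\<bar> \<le> C)"
proof -
  obtain B where B: "0 < B" "\<And>x (k::int). \<bar>x\<bar> \<le> 2 * pi \<Longrightarrow> \<bar>g (L * (x + 2 * pi * of_int k))\<bar> \<le> B / (1 + (of_int k)\<^sup>2)"
    using schwartz_shift_bound[OF g L] by blast
  have 1: "\<bar>\<Sum>k\<in>{- int N..int N}. g (L * (x + 2 * pi * of_int k))\<bar> \<le> B * 5" if x: "\<bar>x\<bar> \<le> 2 * pi" for x N
  proof -
    have "\<bar>\<Sum>k\<in>{- int N..int N}. g (L * (x + 2 * pi * of_int k))\<bar> \<le> (\<Sum>k\<in>{- int N..int N}. B * (1 / (1 + (real_of_int k)\<^sup>2)))"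
      using B(2)[OF x] by (intro order_trans[OF sum_abs] sum_mono) auto
    also have "\<dots> \<le> B * 5"
      unfolding sum_distrib_left[symmetric] using B(1) by (intro mult_left_mono symmetric_inverse_square_sum_le) auto
    finally show ?thesis .
  qed
  have "\<bar>dilate_circle L g x\<bar> \<le> B * 5" if x: "\<bar>x\<bar> \<le> 2 * pi" for x
    by (rule LIMSEQ_le_const2[OF tendsto_rabs[OF dilate_circle_tendsto[OF x]]]) (use 1[OF x] in blast)
  with 1 show ?thesis by blast
qed

lemma dilate_circle_lipschitz:
  obtains K where "0 \<le> K" "\<And>x y. \<bar>x\<bar> \<le> 2 * pi \<Longrightarrow> \<bar>y\<bar> \<le> 2 * pi \<Longrightarrow> \<bar>dilate_circle L g x - dilate_circle L g y\<bar> \<le> K * \<bar>x - y\<bar>"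
proof -
  obtain B where B: "0 < B" "\<And>x (k::int). \<bar>x\<bar> \<le> 2 * pi \<Longrightarrow> \<bar>deriv g (L * (x + 2 * pi * of_int k))\<bar> \<le> B / (1 + (of_int k)\<^sup>2)"
    using schwartz_shift_bound[OF schwartz_deriv[OF g] L] by blast
  have "\<bar>dilate_circle L g x - dilate_circle L g y\<bar> \<le> (B * L * 5) * \<bar>x - y\<bar>" if x: "\<bar>x\<bar> \<le> 2 * pi" and y: "\<bar>y\<bar> \<le> 2 * pi" for x y
  proof -
    let ?s = "\<lambda>x N. \<Sum>k\<in>{- int N..int N}. g (L * (x + 2 * pi * of_int k))"
    have t: "\<bar>g (L * (x + 2 * pi * of_int k)) - g (L * (y + 2 * pi * of_int k))\<bar> \<le> (B * L * \<bar>x - y\<bar>) * (1 / (1 + (real_of_int k)\<^sup>2))" for k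
    proof -
      have "norm (g (L * (x + 2 * pi * of_int k)) - g (L * (y + 2 * pi * of_int k))) \<le> (B / (1 + (of_int k)\<^sup>2) * L) * norm (x - y)"
      proof (rule field_differentiable_bound[where S = "{- 2 * pi..2 * pi}" and f' = "\<lambda>x. deriv g (L * (x + 2 * pi * of_int k)) * L"])
        fix z assume z: "z \<in> {- 2 * pi..2 * pi}"
        have "((\<lambda>x. L * (x + 2 * pi * of_int k)) has_real_derivative L) (at z)"
          by (auto intro!: derivative_eq_intros)
        from DERIV_chain2[OF schwartz_has_derivative[OF g] this]
        show "((\<lambda>x. g (L * (x + 2 * pi * of_int k))) has_real_derivative deriv g (L * (z + 2 * pi * of_int k)) * L) (at z within {- 2 * pi..2 * pi})"
          by (rule has_field_derivative_at_within)
        show "norm (deriv g (L * (z + 2 * pi * of_int k)) * L) \<le> B / (1 + (of_int k)\<^sup>2) * L"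
        proof -
          have "\<bar>z\<bar> \<le> 2 * pi" using z by auto
          from B(2)[OF this, of k] show ?thesis
            unfolding norm_mult real_norm_def abs_mult abs_of_pos[OF L] using L by (intro mult_right_mono) auto
        qed
      qed (use x y in auto)
      thus ?thesis by (simp add: mult_ac)
    qed
    have "\<bar>?s x N - ?s y N\<bar> \<le> (B * L * 5) * \<bar>x - y\<bar>" for N
    proof -
      have "\<bar>?s x N - ?s y N\<bar> \<le> (\<Sum>k\<in>{- int N..int N}. (B * L * \<bar>x - y\<bar>) * (1 / (1 + (real_of_int k)\<^sup>2)))"
        unfolding sum_subtractf[symmetric] using t by (intro order_trans[OF sum_abs] sum_mono) auto
      also have "\<dots> \<le> (B * L * \<bar>x - y\<bar>) * 5"
        unfolding sum_distrib_left[symmetric] using B(1) L by (intro mult_left_mono symmetric_inverse_square_sum_le) auto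
      finally show ?thesis by (simp add: mult_ac)
    qed
    thus ?thesis
      by (intro LIMSEQ_le_const2[OF tendsto_rabs[OF tendsto_diff[OF dilate_circle_tendsto[OF x] dilate_circle_tendsto[OF y]]]]) blast
  qed
  moreover have "0 \<le> B * L * 5" using B L by simp
  ultimately show ?thesis by (rule that[rotated])
qed

lemma dilate_circle_chord:
  assumes x0: "x0 \<in> {-pi..<pi}"
  shows "\<exists>K. \<forall>x\<in>{-pi..<pi}. cmod (complex_of_real (dilate_circle L g x) - complex_of_real (dilate_circle L g x0)) \<le> K * cmod (cis x - cis x0)"
proof -
  obtain K where K: "0 \<le> K" "\<And>x y. \<bar>x\<bar> \<le> 2 * pi \<Longrightarrow> \<bar>y\<bar> \<le> 2 * pi \<Longrightarrow> \<bar>dilate_circle L g x - dilate_circle L g y\<bar> \<le> K * \<bar>x - y\<bar>"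
    using dilate_circle_lipschitz by blast
  have "0 \<le> pi" "pi < 2 * pi" by auto
  from abs_diff_le_norm_cis_diff[OF this] obtain c where
    c: "0 < c" "\<And>x y. \<bar>x - y\<bar> \<le> pi \<Longrightarrow> \<bar>x - y\<bar> \<le> c * cmod (cis x - cis y)" by blast
  have "cmod (complex_of_real (dilate_circle L g x) - complex_of_real (dilate_circle L g x0)) \<le> (K * c) * cmod (cis x - cis x0)"
    if x: "x \<in> {-pi..<pi}" for x
  proof -
    define m :: int where "m = (if x - x0 > pi then -1 else if x - x0 < - pi then 1 else 0)"
    define y where "y = x + 2 * pi * of_int m"
    have y: "\<bar>y - x0\<bar> \<le> pi" "\<bar>y\<bar> \<le> 2 * pi" using x x0 by (auto simp: y_def m_def)
    have cy: "cis y = cis x" unfolding y_def by (rule cis_period)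
    have "\<bar>dilate_circle L g x - dilate_circle L g x0\<bar> = \<bar>dilate_circle L g y - dilate_circle L g x0\<bar>"
      unfolding y_def dilate_circle_periodic ..
    also have "\<dots> \<le> K * \<bar>y - x0\<bar>" using y x0 by (intro K(2)) auto
    also have "\<dots> \<le> K * (c * cmod (cis y - cis x0))" by (intro mult_left_mono c(2) y K(1))
    finally show ?thesis unfolding of_real_diff[symmetric] norm_of_real cy by (simp add: mult.assoc)
  qed
  thus ?thesis by blast
qed

lemma dilate_measurable: "(\<lambda>x. g (L * (x + c))) \<in> borel_measurable circ"
  by (rule borel_measurable_circ, rule measurable_compose[OF _ schwartz_measurable[OF g]]) measurable

lemma dilate_circle_measurable: "dilate_circle L g \<in> borel_measurable circ"
proof (rule borel_measurable_LIMSEQ_real)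
  fix x assume "x \<in> space circ"
  hence "\<bar>x\<bar> \<le> 2 * pi" using pi_gt_zero unfolding space_circ by auto
  thus "(\<lambda>N. \<Sum>k\<in>{- int N..int N}. g (L * (x + 2 * pi * of_int k))) \<longlonglongrightarrow> dilate_circle L g x"
    by (rule dilate_circle_tendsto)
qed (intro borel_measurable_sum dilate_measurable)

lemma circ_shift_integral:
  fixes j k :: int
  shows "(LINT x|circ. complex_of_real (g (L * (x + 2 * pi * of_int j))) * cis (- (of_int k * x)))
    = fti {L * (2 * pi * of_int j - pi)..<L * (2 * pi * of_int j + pi)} g (of_int k / L) / L"
proof -
  let ?J = "{L * (2 * pi * of_int j - pi)..<L * (2 * pi * of_int j + pi)}"
  let ?f = "\<lambda>y. indicator ?J y *\<^sub>R (complex_of_real (g y) * cis (- (of_int k / L * y)))"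
  have "fti ?J g (of_int k / L) = (LINT y|lborel. ?f y)" by (simp add: fti_def set_lebesgue_integral_def)
  also have "\<dots> = L *\<^sub>R (LINT x|lborel. ?f (L * (2 * pi * of_int j) + L * x))"
    using lborel_integral_real_affine[of L ?f "L * (2 * pi * of_int j)"] L by simp
  also have "(LINT x|lborel. ?f (L * (2 * pi * of_int j) + L * x))
    = (LINT x|circ. complex_of_real (g (L * (x + 2 * pi * of_int j))) * cis (- (of_int k * x)))"
    unfolding integral_circ set_lebesgue_integral_def
  proof (intro Bochner_Integration.integral_cong refl)
    fix x
    have a: "L * (2 * pi * of_int j) + L * x = L * (x + 2 * pi * of_int j)" by (simp add: algebra_simps)
    have i: "indicator ?J (L * (x + 2 * pi * of_int j)) = (indicator {-pi..<pi} x :: real)"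
      using L by (auto simp: indicator_def)
    have "- (of_int k / L * (L * (x + 2 * pi * of_int j))) = - (of_int k * x) + 2 * pi * of_int (- (k * j))"
      using L by (simp add: field_simps)
    hence c: "cis (- (of_int k / L * (L * (x + 2 * pi * of_int j)))) = cis (- (of_int k * x))"
      by (simp only: cis_period)
    show "?f (L * (2 * pi * of_int j) + L * x) = indicator {-pi..<pi} x *\<^sub>R (complex_of_real (g (L * (x + 2 * pi * of_int j))) * cis (- (of_int k * x)))"
      unfolding a i c by simp
  qed
  finally show ?thesis using L by (simp add: scaleR_conv_of_real)
qed

lemma fti_unfold:
  "(\<lambda>N. \<Sum>j\<in>{- int N..int N}. fti {L * (2 * pi * of_int j - pi)..<L * (2 * pi * of_int j + pi)} g t) \<longlonglongrightarrow> fti UNIV g t"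
proof -
  let ?J = "\<lambda>j::int. {L * (2 * pi * of_int j - pi)..<L * (2 * pi * of_int j + pi)}"
  let ?F = "\<lambda>y. complex_of_real (g y) * cis (- (t * y))"
  let ?G = "\<lambda>N y. \<Sum>j\<in>{- int N..int N}. indicator (?J j) y *\<^sub>R ?F y"
  define m where "m = (\<lambda>y. \<lfloor>y / (2 * pi * L) + 1 / 2\<rfloor>)"
  have ind: "indicator (?J j) y = (if j = m y then 1 else 0 :: real)" for j y
  proof -
    have "y \<in> ?J j \<longleftrightarrow> of_int j \<le> y / (2 * pi * L) + 1 / 2 \<and> y / (2 * pi * L) + 1 / 2 < of_int j + 1"
      using L by (auto simp: field_simps)
    also have "\<dots> \<longleftrightarrow> j = m y" unfolding m_def eq_commute[of j] floor_eq_iff ..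
    finally show ?thesis by (simp add: indicator_def)
  qed
  have G: "?G N y = (if m y \<in> {- int N..int N} then ?F y else 0)" for N y
  proof -
    have "?G N y = (\<Sum>j\<in>{- int N..int N}. if j = m y then ?F y else 0)"
      unfolding ind by (intro sum.cong refl) simp
    also have "\<dots> = (if m y \<in> {- int N..int N} then ?F y else 0)" by (rule sum.delta) simp
    finally show ?thesis .
  qed
  have lim: "(\<lambda>N. LINT y|lborel. ?G N y) \<longlonglongrightarrow> fti UNIV g t"
    unfolding fti_UNIV
  proof (rule integral_dominated_convergence[where w = "\<lambda>y. \<bar>g y\<bar>"])
    show "AE y in lborel. (\<lambda>N. ?G N y) \<longlonglongrightarrow> ?F y"
    proof (rule AE_I2, rule tendsto_eventually)
      fix y
      have "?G N y = ?F y" if "nat \<bar>m y\<bar> \<le> N" for N using that unfolding G by auto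
      thus "\<forall>\<^sub>F N in sequentially. ?G N y = ?F y" unfolding eventually_sequentially by blast
    qed
    show "AE y in lborel. norm (?G N y) \<le> \<bar>g y\<bar>" for N unfolding G by (simp add: norm_mult)
    show "integrable lborel (\<lambda>y. \<bar>g y\<bar>)" using schwartz_integrable[OF g] by simp
    show "?F \<in> borel_measurable lborel" using schwartz_cis_integrable[OF g] by simp
    thus "?G N \<in> borel_measurable lborel" for N by (intro borel_measurable_sum borel_measurable_scaleR) auto
  qed
  have "(LINT y|lborel. ?G N y) = (\<Sum>j\<in>{- int N..int N}. fti (?J j) g t)" for N
    unfolding fti_def set_lebesgue_integral_def
    by (rule Bochner_Integration.integral_sum) (rule integrable_mult_indicator, simp, rule schwartz_cis_integrable[OF g])
  with lim show ?thesis by (simp only:)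
qed

lemma fc_dilate_circle: "fc (\<lambda>x. complex_of_real (dilate_circle L g x)) k = fti UNIV g (of_int k / L) / (2 * pi * L)"
proof -
  obtain C where C: "\<And>x N. \<bar>x\<bar> \<le> 2 * pi \<Longrightarrow> \<bar>\<Sum>k\<in>{- int N..int N}. g (L * (x + 2 * pi * of_int k))\<bar> \<le> C"
    using dilate_circle_bounds by blast
  have x2: "\<bar>x\<bar> \<le> 2 * pi" if "x \<in> {-pi..<pi}" for x using that pi_gt_zero by auto
  let ?c = "\<lambda>x. cis (- (of_int k * x))"
  let ?s = "\<lambda>N x. \<Sum>j\<in>{- int N..int N}. complex_of_real (g (L * (x + 2 * pi * of_int j))) * ?c x"
  have s: "?s N x = complex_of_real (\<Sum>j\<in>{- int N..int N}. g (L * (x + 2 * pi * of_int j))) * ?c x" for N x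
    by (simp add: sum_distrib_right)
  have m: "(\<lambda>x. complex_of_real (g (L * (x + 2 * pi * of_int j))) * ?c x) \<in> borel_measurable circ" for j
    by (intro borel_measurable_times borel_measurable_of_real_circ dilate_measurable cis_measurable)
  have "(\<lambda>N. LINT x|circ. ?s N x) \<longlonglongrightarrow> (LINT x|circ. complex_of_real (dilate_circle L g x) * ?c x)"
  proof (rule integral_dominated_convergence[where w = "\<lambda>_. C"])
    show "AE x in circ. (\<lambda>N. ?s N x) \<longlonglongrightarrow> complex_of_real (dilate_circle L g x) * ?c x"
      unfolding s by (intro AE_I2 tendsto_intros dilate_circle_tendsto x2) (simp add: space_circ)
    show "AE x in circ. norm (?s N x) \<le> C" for N
    proof (rule AE_I2)
      fix x assume "x \<in> space circ"
      thus "norm (?s N x) \<le> C" using C[OF x2] unfolding s norm_mult norm_of_real norm_cis by (simp add: space_circ)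
    qed
    show "(\<lambda>x. complex_of_real (dilate_circle L g x) * ?c x) \<in> borel_measurable circ"
      by (intro borel_measurable_times borel_measurable_of_real_circ dilate_circle_measurable cis_measurable)
    show "?s N \<in> borel_measurable circ" for N by (intro borel_measurable_sum m)
  qed simp
  moreover have "(LINT x|circ. ?s N x) = (\<Sum>j\<in>{- int N..int N}. fti {L * (2 * pi * of_int j - pi)..<L * (2 * pi * of_int j + pi)} g (of_int k / L)) / L" for N
  proof -
    have "(LINT x|circ. ?s N x) = (\<Sum>j\<in>{- int N..int N}. LINT x|circ. complex_of_real (g (L * (x + 2 * pi * of_int j))) * ?c x)"
    proof (rule Bochner_Integration.integral_sum)
      fix j
      obtain B where B: "\<And>x. \<bar>g x\<bar> \<le> B / (1 + x\<^sup>2)" "0 < B" using schwartz_bound2[OF g] by blast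
      have "\<bar>g x\<bar> \<le> B" for x
      proof (rule order_trans[OF B(1)])
        show "B / (1 + x\<^sup>2) \<le> B" using B(2) frac_le_cross[of "1 + x\<^sup>2" 1 B B] one_plus_square_pos[of x] by (simp add: distrib_left)
      qed
      thus "integrable circ (\<lambda>x. complex_of_real (g (L * (x + 2 * pi * of_int j))) * ?c x)"
        by (intro integrable_circ[OF m, of _ B]) (simp add: norm_mult)
    qed
    thus ?thesis unfolding circ_shift_integral sum_divide_distrib .
  qed
  moreover have "(\<lambda>N. (\<Sum>j\<in>{- int N..int N}. fti {L * (2 * pi * of_int j - pi)..<L * (2 * pi * of_int j + pi)} g (of_int k / L)) / L)
     \<longlonglongrightarrow> fti UNIV g (of_int k / L) / L"
    using L by (intro tendsto_divide fti_unfold tendsto_const) auto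
  ultimately have "(LINT x|circ. complex_of_real (dilate_circle L g x) * ?c x) = fti UNIV g (of_int k / L) / L"
    using LIMSEQ_unique by simp
  thus ?thesis by (simp add: fc_def)
qed

lemma fc_dilate_window: "fc (\<lambda>x. complex_of_real (g (L * x))) k = fti {- (pi * L)..<pi * L} g (of_int k / L) / (2 * pi * L)"
  using circ_shift_integral[of 0 k] by (simp add: fc_def mult.commute)

lemma fti_tails:
  assumes a: "0 \<le> a"
  shows "fti UNIV g t - fti {- a..<a} g t = fti {..<- a} g t + fti {a<..} g t"
proof -
  let ?F = "\<lambda>y. complex_of_real (g y) * cis (- (t * y))"
  have si: "set_integrable lborel A ?F" if "A \<in> sets borel" for A
    unfolding set_integrable_def using that by (intro integrable_mult_indicator schwartz_cis_integrable[OF g]) auto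
  have "fti UNIV g t = (LINT y:(({..<- a} \<union> {- a..<a}) \<union> {a..})|lborel. ?F y)"
    unfolding fti_def using a by (intro arg_cong2[where f = "\<lambda>A. set_lebesgue_integral lborel A"] refl) auto
  also have "\<dots> = (LINT y:({..<- a} \<union> {- a..<a})|lborel. ?F y) + (LINT y:{a..}|lborel. ?F y)"
    using a by (intro set_integral_Un si) auto
  also have "(LINT y:({..<- a} \<union> {- a..<a})|lborel. ?F y) = fti {..<- a} g t + fti {- a..<a} g t"
    unfolding fti_def by (intro set_integral_Un si) auto
  also have "(LINT y:{a..}|lborel. ?F y) = fti {a<..} g t"
    unfolding fti_def set_lebesgue_integral_def
  proof (rule integral_cong_AE)
    show "AE y in lborel. indicator {a..} y *\<^sub>R ?F y = indicator {a<..} y *\<^sub>R ?F y"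
      using AE_lborel_singleton[of a] by eventually_elim (auto simp: indicator_def)
  qed (use si[of "{a..}"] si[of "{a<..}"] in \<open>auto simp: set_integrable_def\<close>)
  finally show ?thesis by simp
qed

end

lemma fti_zero: "fti A g 0 = complex_of_real (LINT x:A|lborel. g x)"
  by (simp add: fti_def set_integral_complex_of_real)

lemma schwartz_tail_integral:
  assumes u: "schwartz u" and C: "0 \<le> C" "\<And>x. \<bar>u x\<bar> \<le> C / (1 + x\<^sup>2)\<^sup>2" and a: "0 \<le> a"
    and A: "A \<in> sets borel" "\<And>x. x \<in> A \<Longrightarrow> a \<le> \<bar>x\<bar>"
  shows "(LINT x:A|lborel. \<bar>u x\<bar>) \<le> pi * C / (1 + a\<^sup>2)"
proof -
  have "(LINT x:A|lborel. \<bar>u x\<bar>) \<le> (LINT x|lborel. C / (1 + a\<^sup>2) * (1 / (1 + x\<^sup>2)))"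
    unfolding set_lebesgue_integral_def
  proof (rule integral_mono)
    show "integrable lborel (\<lambda>x. indicator A x *\<^sub>R \<bar>u x\<bar>)"
      using A schwartz_integrable[OF u] by (intro integrable_mult_indicator) auto
    show "integrable lborel (\<lambda>x. C / (1 + a\<^sup>2) * (1 / (1 + x\<^sup>2)))" by (intro integrable_mult_right integrable_inverse_square)
    fix x :: real
    have pos: "0 < 1 + x\<^sup>2" "0 < 1 + a\<^sup>2" by (rule one_plus_square_pos)+
    show "indicator A x *\<^sub>R \<bar>u x\<bar> \<le> C / (1 + a\<^sup>2) * (1 / (1 + x\<^sup>2))"
    proof (cases "x \<in> A")
      case True
      hence "a\<^sup>2 \<le> x\<^sup>2" using power_mono[OF A(2) a, of x 2] by simp
      hence "(1 + a\<^sup>2) * (1 + x\<^sup>2) \<le> (1 + x\<^sup>2)\<^sup>2" unfolding power2_eq_square[of "1 + x\<^sup>2"] using pos by (intro mult_right_mono) auto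
      hence "C / (1 + x\<^sup>2)\<^sup>2 \<le> C / ((1 + a\<^sup>2) * (1 + x\<^sup>2))" using C(1) pos by (intro divide_left_mono mult_pos_pos) auto
      thus ?thesis using True C(2)[of x] by simp
    qed (use C(1) pos in auto)
  qed
  also have "\<dots> = pi * C / (1 + a\<^sup>2)"
    by (subst integral_mult_right_zero) (simp add: integral_inverse_square)
  finally show ?thesis .
qed

text \<open>Integrating by parts twice over the two half-lines: at the frequencies \<open>k / L\<close> the boundary
  terms at \<open>\<plusminus> pi * L\<close> carry the same phase, so only the jump \<open>g (pi * L) - g (- pi * L)\<close> appears to first order.\<close>

lemma fti_tails_bound:
  assumes g: "schwartz g"
  obtains C where "0 < C" "\<And>L k. 0 < L \<Longrightarrow> k \<noteq> 0 \<Longrightarrow>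
     cmod (fti {..<- (pi * L)} g (of_int k / L) + fti {pi * L<..} g (of_int k / L))
      \<le> \<bar>g (pi * L) - g (- (pi * L))\<bar> * L / \<bar>of_int k\<bar> + C / (of_int k)\<^sup>2"
proof -
  note g1 = schwartz_deriv[OF g] note g2 = schwartz_deriv[OF g1]
  obtain C1 where C1: "0 < C1" "\<And>x. \<bar>deriv g x\<bar> \<le> C1 / (1 + x\<^sup>2)" using schwartz_bound2[OF g1] by blast
  obtain C2 where C2: "0 < C2" "\<And>x. \<bar>deriv (deriv g) x\<bar> \<le> C2 / (1 + x\<^sup>2)\<^sup>2" using schwartz_bound[OF g2] by blast
  define C where "C = 2 * C1 + 2 * (pi * C2)"
  have C0: "0 < C" using C1 C2 by (simp add: C_def add_pos_pos)
  have "cmod (fti {..<- (pi * L)} g (of_int k / L) + fti {pi * L<..} g (of_int k / L))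
      \<le> \<bar>g (pi * L) - g (- (pi * L))\<bar> * L / \<bar>of_int k\<bar> + C / (of_int k)\<^sup>2" if L: "0 < L" and k: "k \<noteq> 0" for L and k :: int
  proof -
    define a where "a = pi * L"
    define t where "t = of_int k / L"
    have a0: "0 \<le> a" using L by (simp add: a_def)
    have t0: "0 < \<bar>t\<bar>" using L k by (simp add: t_def)
    define D where "D = (\<lambda>u. fti {..<- a} u t + fti {a<..} u t)"
    have ta: "t * a = of_int k * pi" using L by (simp add: t_def a_def)
    have "- (t * - a) = - (t * a) + 2 * pi * of_int k" by (simp add: ta)
    hence ph: "cis (- (t * - a)) = cis (- (t * a))" by (simp only: cis_period)
    have parts: "\<bar>t\<bar> * cmod (D u) \<le> \<bar>u a - u (- a)\<bar> + cmod (D (deriv u))" if u: "schwartz u" for u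
    proof -
      have "\<i> * of_real t * D u = complex_of_real (u a - u (- a)) * cis (- (t * a)) + D (deriv u)"
        unfolding D_def distrib_left fti_by_parts_cases(2,3)[OF u] ph by (simp add: algebra_simps)
      hence "cmod (\<i> * of_real t * D u) \<le> cmod (complex_of_real (u a - u (- a)) * cis (- (t * a))) + cmod (D (deriv u))"
        by (simp only: norm_triangle_ineq)
      thus ?thesis by (simp add: norm_mult del: of_real_diff)
    qed
    have "cmod (D (deriv (deriv g))) \<le> (LINT x:{..<- a}|lborel. \<bar>deriv (deriv g) x\<bar>) + (LINT x:{a<..}|lborel. \<bar>deriv (deriv g) x\<bar>)"
      unfolding D_def by (intro norm_triangle_le add_mono fti_norm_le[OF g2]) auto
    also have "\<dots> \<le> pi * C2 / (1 + a\<^sup>2) + pi * C2 / (1 + a\<^sup>2)"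
      using C2 a0 by (intro add_mono schwartz_tail_integral[OF g2]) auto
    finally have "\<bar>t\<bar> * cmod (D (deriv g)) \<le> C1 / (1 + a\<^sup>2) + C1 / (1 + a\<^sup>2) + (pi * C2 / (1 + a\<^sup>2) + pi * C2 / (1 + a\<^sup>2))"
      using parts[OF g1] C1(2)[of a] C1(2)[of "- a"] by simp
    also have "\<dots> = C / (1 + a\<^sup>2)" by (simp add: C_def add_divide_distrib)
    also have "\<dots> \<le> C / L\<^sup>2"
    proof (rule divide_left_mono)
      have "1 * L\<^sup>2 \<le> pi\<^sup>2 * L\<^sup>2" using pi_ge_two by (intro mult_right_mono one_le_power) auto
      thus "L\<^sup>2 \<le> 1 + a\<^sup>2" unfolding a_def power_mult_distrib by simp
    qed (use C0 L one_plus_square_pos[of a] in auto)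
    finally have e: "\<bar>t\<bar> * cmod (D (deriv g)) \<le> C / L\<^sup>2" .
    have "t\<^sup>2 * cmod (D g) = \<bar>t\<bar> * (\<bar>t\<bar> * cmod (D g))" by (simp add: power2_eq_square mult.assoc[symmetric])
    also have "\<dots> \<le> \<bar>t\<bar> * (\<bar>g a - g (- a)\<bar> + cmod (D (deriv g)))" using parts[OF g] t0 by (intro mult_left_mono) auto
    also have "\<dots> \<le> \<bar>t\<bar> * \<bar>g a - g (- a)\<bar> + C / L\<^sup>2" using e by (simp add: distrib_left)
    finally have "cmod (D g) \<le> (\<bar>t\<bar> * \<bar>g a - g (- a)\<bar> + C / L\<^sup>2) / t\<^sup>2"
      using t0 by (simp add: pos_le_divide_eq mult.commute)
    also have "\<dots> = \<bar>g a - g (- a)\<bar> / \<bar>t\<bar> + (C / L\<^sup>2) / t\<^sup>2"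
    proof -
      have tt: "t\<^sup>2 = \<bar>t\<bar> * \<bar>t\<bar>" by (simp add: power2_eq_square)
      have "\<bar>t\<bar> * \<bar>g a - g (- a)\<bar> / t\<^sup>2 = \<bar>g a - g (- a)\<bar> / \<bar>t\<bar>" unfolding tt
        using t0 by (intro nonzero_mult_divide_mult_cancel_left) auto
      thus ?thesis unfolding add_divide_distrib by simp
    qed
    also have "\<dots> = \<bar>g (pi * L) - g (- (pi * L))\<bar> * L / \<bar>of_int k\<bar> + C / (of_int k)\<^sup>2"
      unfolding t_def a_def using L by (simp add: power_divide abs_divide)
    finally show ?thesis unfolding D_def t_def a_def .
  qed
  with C0 show ?thesis by (rule that)
qed

section \<open>Variance and error sums\<close>

lemma sum_min_inverse_square_le:
  assumes n: "1 \<le> n"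
  shows "(\<Sum>k=1..N. real (min k n) / (real k)\<^sup>2) \<le> 2 + ln (real n)"
proof -
  have *: "(\<Sum>k=1..N. real (min k n) / (real k)\<^sup>2) \<le> (if N \<le> n then 1 + ln (real N) else 2 + ln (real n) - real n / real N)" if "1 \<le> N"
    using that
  proof (induction N rule: dec_induct)
    case base
    show ?case using n by simp
  next
    case (step N)
    let ?S = "\<Sum>k=1..N. real (min k n) / (real k)\<^sup>2"
    have N: "0 < real N" using step.hyps by simp
    have S: "(\<Sum>k=1..Suc N. real (min k n) / (real k)\<^sup>2) = ?S + real (min (Suc N) n) / (real (Suc N))\<^sup>2" by simp
    show ?case
    proof (cases "Suc N \<le> n")
      case True
      have "ln (real N / real (Suc N)) \<le> real N / real (Suc N) - 1" using N by (intro ln_le_minus_one) simp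
      also have "\<dots> = - (1 / real (Suc N))" by (simp add: field_simps)
      finally have "1 / real (Suc N) \<le> ln (real (Suc N)) - ln (real N)" using N by (simp add: ln_div)
      moreover have "real (min (Suc N) n) / (real (Suc N))\<^sup>2 = 1 / real (Suc N)"
        using True by (simp add: power2_eq_square del: of_nat_Suc)
      ultimately show ?thesis using True step.IH unfolding S by simp
    next
      case False
      have "?S \<le> 2 + ln (real n) - real n / real N"
        using False step.IH N by (cases "N = n") auto
      moreover have "real (min (Suc N) n) / (real (Suc N))\<^sup>2 \<le> real n / real N - real n / real (Suc N)"
      proof -
        have "real n / real N - real n / real (Suc N) = real n / (real N * real (Suc N))" using N by (simp add: field_simps)
        moreover have "real n / (real (Suc N))\<^sup>2 \<le> real n / (real N * real (Suc N))"
          using N by (intro divide_left_mono) (auto simp: power2_eq_square)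
        ultimately show ?thesis using False by simp
      qed
      ultimately show ?thesis using False unfolding S by simp
    qed
  qed
  have l: "0 \<le> ln (real n)" using n by simp
  show ?thesis
  proof (cases "N = 0")
    case False
    hence N1: "1 \<le> N" by simp
    show ?thesis
    proof (rule order_trans[OF *[OF N1]])
      have "ln (real N) \<le> ln (real n)" if "N \<le> n" using that N1 by simp
      moreover have "0 \<le> real n / real N" by simp
      ultimately show "(if N \<le> n then 1 + ln (real N) else 2 + ln (real n) - real n / real N) \<le> 2 + ln (real n)"
        by (auto split: if_splits)
    qed
  qed (use l in simp)
qed

lemma sum_inverse_squares_le: "(\<Sum>k=1..N. 1 / (real k)\<^sup>2) \<le> 2"
proof -
  have "(\<Sum>k=1..N. 1 / (real k)\<^sup>2) = (\<Sum>k=1..N. real (min k 1) / (real k)\<^sup>2)" by (intro sum.cong) (auto simp: min_def)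
  thus ?thesis using sum_min_inverse_square_le[of 1 N] by simp
qed

lemma square_add_le: "(x + y)\<^sup>2 \<le> 2 * x\<^sup>2 + 2 * (y::real)\<^sup>2"
  using sum_squares_bound[of x y] by (simp add: power2_sum)

lemma (in haar_eigen) trigvar_le:
  assumes ab: "0 \<le> a" "0 \<le> b" and fc: "\<And>k. k \<noteq> 0 \<Longrightarrow> cmod (fc \<phi> k) \<le> a / \<bar>of_int k\<bar> + b / (of_int k)\<^sup>2"
  shows "trigvar \<phi> N \<le> 4 * a\<^sup>2 * (2 + ln (real n)) + 8 * b\<^sup>2"
proof -
  have t: "(cmod (fc \<phi> j))\<^sup>2 * real (min (nat \<bar>j\<bar>) n) \<le> 2 * a\<^sup>2 * (real (min k n) / (real k)\<^sup>2) + 2 * b\<^sup>2 * (1 / (real k)\<^sup>2)"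
    if k: "1 \<le> k" "\<bar>j\<bar> = int k" for j k
  proof -
    have k0: "1 \<le> real k" using k by simp
    have j: "\<bar>real_of_int j\<bar> = real k" "(real_of_int j)\<^sup>2 = (real k)\<^sup>2" "j \<noteq> 0"
      using k by (auto simp flip: of_int_abs power2_abs[of "real_of_int j"])
    have "(cmod (fc \<phi> j))\<^sup>2 \<le> (a / real k + b / (real k)\<^sup>2)\<^sup>2"
      using fc[OF j(3)] unfolding j by (intro power_mono) auto
    also have "\<dots> \<le> 2 * (a / real k)\<^sup>2 + 2 * (b / (real k)\<^sup>2)\<^sup>2" by (rule square_add_le)
    finally have "(cmod (fc \<phi> j))\<^sup>2 * real (min k n) \<le> (2 * (a / real k)\<^sup>2 + 2 * (b / (real k)\<^sup>2)\<^sup>2) * real (min k n)"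
      by (rule mult_right_mono) simp
    also have "\<dots> = 2 * a\<^sup>2 * (real (min k n) / (real k)\<^sup>2) + 2 * b\<^sup>2 * (real (min k n) / (real k)\<^sup>2 * (1 / (real k)\<^sup>2))"
      by (simp add: power_divide distrib_right power2_eq_square)
    also have "\<dots> \<le> 2 * a\<^sup>2 * (real (min k n) / (real k)\<^sup>2) + 2 * b\<^sup>2 * (1 * (1 / (real k)\<^sup>2))"
    proof (intro add_left_mono mult_left_mono mult_right_mono)
      have "real (min k n) \<le> real k * 1" by simp
      also have "\<dots> \<le> (real k)\<^sup>2" unfolding power2_eq_square using k0 by (intro mult_left_mono) auto
      finally have "real (min k n) \<le> (real k)\<^sup>2" .
      thus "real (min k n) / (real k)\<^sup>2 \<le> 1" using k0 by (simp add: divide_le_eq_1)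
    qed auto
    finally show ?thesis using k by simp
  qed
  have "trigvar \<phi> N \<le> (\<Sum>k=1..N. 2 * (2 * a\<^sup>2 * (real (min k n) / (real k)\<^sup>2) + 2 * b\<^sup>2 * (1 / (real k)\<^sup>2)))"
    unfolding trigvar_def sum_symmetric_int mult_2[of "_ + _"] by (intro sum_mono add_mono t) auto
  also have "\<dots> = 4 * a\<^sup>2 * (\<Sum>k=1..N. real (min k n) / (real k)\<^sup>2) + 4 * b\<^sup>2 * (\<Sum>k=1..N. 1 / (real k)\<^sup>2)"
    unfolding distrib_left sum.distrib sum_distrib_left by (simp add: mult.assoc)
  also have "\<dots> \<le> 4 * a\<^sup>2 * (2 + ln (real n)) + 4 * b\<^sup>2 * 2"
    using n_pos by (intro add_mono mult_left_mono sum_min_inverse_square_le sum_inverse_squares_le) auto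
  finally show ?thesis by simp
qed

lemma cubic_decay:
  assumes t: "0 \<le> (t::real)"
  shows "1 / (1 + t ^ 3) \<le> 2 / (1 + t\<^sup>2)" "t / (1 + t ^ 3) \<le> 2 / (1 + t\<^sup>2)"
    "t\<^sup>2 / (1 + t ^ 3) \<le> 1" "t ^ 3 / (1 + t ^ 3) \<le> 1"
proof -
  have p: "0 < 1 + t ^ 3" "0 < 1 + t\<^sup>2" using t by (simp_all add: add_pos_nonneg)
  have f: "t\<^sup>2 \<le> 1 + t ^ 3" "t \<le> 1 + t ^ 3"
  proof (atomize (full), cases "t \<le> 1")
    case True
    have "t\<^sup>2 \<le> 1" using t True by (simp add: power_le_one)
    moreover have "0 \<le> t ^ 3" using t by simp
    ultimately show "t\<^sup>2 \<le> 1 + t ^ 3 \<and> t \<le> 1 + t ^ 3" using True by linarith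
  next
    case False
    hence "t\<^sup>2 \<le> t ^ 3" "t ^ 1 \<le> t ^ 3" using power_increasing[of 2 3 t] power_increasing[of 1 3 t] by auto
    thus "t\<^sup>2 \<le> 1 + t ^ 3 \<and> t \<le> 1 + t ^ 3" by simp
  qed
  have t3: "0 \<le> t ^ 3" using t by simp
  show "1 / (1 + t ^ 3) \<le> 2 / (1 + t\<^sup>2)"   proof (rule frac_le_cross[OF p])
    have "1 + t\<^sup>2 \<le> (1 + t ^ 3) + (1 + t ^ 3)" by (rule add_mono) (use f t3 in simp_all)
    thus "1 * (1 + t\<^sup>2) \<le> 2 * (1 + t ^ 3)" unfolding mult_2 mult_1_left .
  qed
  show "t / (1 + t ^ 3) \<le> 2 / (1 + t\<^sup>2)"
  proof (intro frac_le_cross p)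
    have "t * (1 + t\<^sup>2) = t + t ^ 3" by (simp add: algebra_simps power2_eq_square power3_eq_cube)
    also have "\<dots> \<le> (1 + t ^ 3) + (1 + t ^ 3)" by (rule add_mono) (use f t3 in simp_all)
    finally show "t * (1 + t\<^sup>2) \<le> 2 * (1 + t ^ 3)" unfolding mult_2 .
  qed
  show "t\<^sup>2 / (1 + t ^ 3) \<le> 1" "t ^ 3 / (1 + t ^ 3) \<le> 1" using f p by (simp_all add: divide_le_eq_1)
qed

context
  fixes c :: "int \<Rightarrow> complex" and A L :: real
  assumes A: "0 \<le> A" and L: "1 \<le> L" and c: "\<And>k. cmod (c k) \<le> A / L / (1 + (\<bar>of_int k\<bar> / L) ^ 3)"
begin

lemma decay_sum_cube: "sqrt (\<Sum>k\<in>{1..int N}. (cmod (c k))\<^sup>2 * of_int k ^ 3) \<le> 2 * A * L"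
proof -
  have "(cmod (c (int k)))\<^sup>2 * real k ^ 3 \<le> 2 * A\<^sup>2 * L * (1 / (1 + (real k / L)\<^sup>2))" for k
  proof -
    define t where "t = real k / L"
    have t: "0 \<le> t" "real k = L * t" using L by (auto simp: t_def)
    have "(cmod (c (int k)))\<^sup>2 * real k ^ 3 \<le> (A / L / (1 + t ^ 3))\<^sup>2 * real k ^ 3"
      using c[of "int k"] by (intro mult_right_mono power_mono) (auto simp: t_def)
    also have "\<dots> = A\<^sup>2 * L * (t ^ 3 / (1 + t ^ 3)) * (1 / (1 + t ^ 3))"
    proof -
      have "(A / L / q)\<^sup>2 * (L * t) ^ 3 = A\<^sup>2 * L * (t ^ 3 / q) * (1 / q)" for q
        using L by (cases "q = 0") (simp_all add: power2_eq_square power3_eq_cube field_simps)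
      thus ?thesis unfolding t(2) .
    qed
    also have "\<dots> \<le> A\<^sup>2 * L * 1 * (2 / (1 + t\<^sup>2))"
      using A L t(1) cubic_decay[OF t(1)] by (intro mult_mono) auto
    finally show ?thesis by (simp add: t_def mult_ac)
  qed
  hence "(\<Sum>k\<in>{1..int N}. (cmod (c k))\<^sup>2 * of_int k ^ 3) \<le> 2 * A\<^sup>2 * L * (\<Sum>k=1..N. 1 / (1 + (real k / L)\<^sup>2))"
    unfolding sum_int_atLeast1 sum_distrib_left by (intro sum_mono) auto
  also have "\<dots> \<le> 2 * A\<^sup>2 * L * (2 * L)" using L A by (intro mult_left_mono sum_inverse_square_le) auto
  also have "\<dots> = (2 * A * L)\<^sup>2" by (simp add: power2_eq_square)
  finally show ?thesis using A L by (intro real_le_lsqrt) auto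
qed

lemma decay_sum_inner:
  assumes k: "0 \<le> k"
  shows "sqrt (\<Sum>m\<in>{- int N..int N} - {0}. (cmod (c m))\<^sup>2 * of_int m ^ 2 * (k + \<bar>of_int m\<bar>)) \<le> 3 * A * (k + L)"
proof -
  have t: "(cmod (c j))\<^sup>2 * of_int j ^ 2 * (k + \<bar>of_int j\<bar>) \<le> 2 * A\<^sup>2 * (k + L) * (1 / (1 + (real m / L)\<^sup>2))"
    if j: "\<bar>j\<bar> = int m" for j m
  proof -
    define t where "t = real m / L"
    have t: "0 \<le> t" "real m = L * t" using L by (auto simp: t_def)
    have j: "\<bar>real_of_int j\<bar> = real m" "(real_of_int j)\<^sup>2 = (real m)\<^sup>2"
      using j by (auto simp flip: of_int_abs power2_abs[of "real_of_int j"])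
    have "(cmod (c j))\<^sup>2 * of_int j ^ 2 * (k + \<bar>of_int j\<bar>) \<le> (A / L / (1 + t ^ 3))\<^sup>2 * of_int j ^ 2 * (k + \<bar>of_int j\<bar>)"
      using c[of j] k by (intro mult_right_mono power_mono) (auto simp: t_def j)
    also have "\<dots> = A\<^sup>2 * (t\<^sup>2 / (1 + t ^ 3)) * (k * (1 / (1 + t ^ 3)) + L * (t / (1 + t ^ 3)))"
    proof -
      have "(A / L / q)\<^sup>2 * (L * t)\<^sup>2 * (k + L * t) = A\<^sup>2 * (t\<^sup>2 / q) * (k * (1 / q) + L * (t / q))" for q
        using L by (cases "q = 0") (simp_all add: power2_eq_square field_simps)
      thus ?thesis unfolding j t(2) .
    qed
    also have "\<dots> \<le> A\<^sup>2 * 1 * (k * (2 / (1 + t\<^sup>2)) + L * (2 / (1 + t\<^sup>2)))"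
      using A L k t(1) cubic_decay[OF t(1)] by (intro mult_mono add_mono) (auto intro!: add_nonneg_nonneg)
    also have "\<dots> = 2 * A\<^sup>2 * (k + L) * (1 / (1 + t\<^sup>2))" by (simp add: add_divide_distrib[symmetric] algebra_simps)
    finally show ?thesis by (simp add: t_def mult_ac)
  qed
  have "(\<Sum>m\<in>{- int N..int N} - {0}. (cmod (c m))\<^sup>2 * of_int m ^ 2 * (k + \<bar>of_int m\<bar>))
      \<le> (\<Sum>m=1..N. 2 * A\<^sup>2 * (k + L) * (1 / (1 + (real m / L)\<^sup>2)) + 2 * A\<^sup>2 * (k + L) * (1 / (1 + (real m / L)\<^sup>2)))"
    unfolding sum_symmetric_int by (intro sum_mono add_mono t) auto
  also have "\<dots> = 4 * A\<^sup>2 * (k + L) * (\<Sum>m=1..N. 1 / (1 + (real m / L)\<^sup>2))"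
    unfolding sum_distrib_left by (intro sum.cong) auto
  also have "\<dots> \<le> 4 * A\<^sup>2 * (k + L) * (2 * L)" using L A k by (intro mult_left_mono sum_inverse_square_le) auto
  also have "\<dots> = 8 * A\<^sup>2 * ((k + L) * L)" by simp
  also have "\<dots> \<le> 9 * A\<^sup>2 * ((k + L) * (k + L))" using k L by (intro mult_mono) auto
  also have "\<dots> = (3 * A * (k + L))\<^sup>2" by (simp add: power2_eq_square)
  finally show ?thesis using A L k by (intro real_le_lsqrt) auto
qed

lemma decay_sum_outer:
  "(\<Sum>k\<in>{1..int N}. cmod (c k) * sqrt (\<Sum>m\<in>{- int N..int N} - {0}. (cmod (c m))\<^sup>2 * of_int m ^ 2 * (of_int k + \<bar>of_int m\<bar>))) \<le> 24 * A\<^sup>2 * L"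
proof -
  have "cmod (c (int k)) * sqrt (\<Sum>m\<in>{- int N..int N} - {0}. (cmod (c m))\<^sup>2 * of_int m ^ 2 * (real k + \<bar>of_int m\<bar>))
     \<le> 12 * A\<^sup>2 * (1 / (1 + (real k / L)\<^sup>2))" for k
  proof -
    define t where "t = real k / L"
    have t: "0 \<le> t" "real k = L * t" using L by (auto simp: t_def)
    have "cmod (c (int k)) * sqrt (\<Sum>m\<in>{- int N..int N} - {0}. (cmod (c m))\<^sup>2 * of_int m ^ 2 * (real k + \<bar>of_int m\<bar>))
      \<le> A / L / (1 + t ^ 3) * (3 * A * (real k + L))"
      using c[of "int k"] A L t(1) by (intro mult_mono decay_sum_inner) (auto simp: t_def intro!: real_sqrt_ge_zero sum_nonneg)
    also have "\<dots> = 3 * A\<^sup>2 * (t / (1 + t ^ 3) + 1 / (1 + t ^ 3))"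
    proof -
      have "A / L / q * (3 * A * (L * t + L)) = 3 * A\<^sup>2 * (t / q + 1 / q)" for q
        using L by (cases "q = 0") (simp_all add: power2_eq_square field_simps)
      thus ?thesis unfolding t(2) .
    qed
    also have "\<dots> \<le> 3 * A\<^sup>2 * (2 / (1 + t\<^sup>2) + 2 / (1 + t\<^sup>2))"
      using cubic_decay[OF t(1)] by (intro mult_left_mono add_mono) auto
    finally show ?thesis by (simp add: t_def mult_ac)
  qed
  hence "(\<Sum>k\<in>{1..int N}. cmod (c k) * sqrt (\<Sum>m\<in>{- int N..int N} - {0}. (cmod (c m))\<^sup>2 * of_int m ^ 2 * (of_int k + \<bar>of_int m\<bar>)))
     \<le> 12 * A\<^sup>2 * (\<Sum>k=1..N. 1 / (1 + (real k / L)\<^sup>2))"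
    unfolding sum_int_atLeast1 sum_distrib_left by (intro sum_mono) auto
  also have "\<dots> \<le> 12 * A\<^sup>2 * (2 * L)" using L by (intro mult_left_mono sum_inverse_square_le) auto
  finally show ?thesis by simp
qed

end

section \<open>Convergence in distribution\<close>

lemma (in haar_eigen) statistic_char_bound:
  assumes \<phi>: "\<phi> \<in> borel_measurable circ" "\<And>x. x \<in> {-pi..<pi} \<Longrightarrow> cmod (\<phi> x) \<le> C"
    and F: "regular F" "AE M in H. (\<lambda>N. trigsum \<phi> N M) \<longlonglongrightarrow> F M"
    and real: "\<And>M. M \<in> unitary_group n \<Longrightarrow> F M \<in> \<real>" "\<And>k. fc \<phi> (- k) = cnj (fc \<phi> k)"
    and A: "0 \<le> A" "1 \<le> L" "\<And>k. cmod (fc \<phi> k) \<le> A / L / (1 + (\<bar>of_int k\<bar> / L) ^ 3)"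
    and V: "(\<lambda>N. 2 * (\<Sum>k\<in>{1..int N}. of_int k * (cmod (fc \<phi> k))\<^sup>2)) \<longlonglongrightarrow> V"
  shows "cmod ((LINT M|H. exp (\<i> * of_real s * (F M - (LINT M|H. F M)))) - of_real (exp (- (V * s\<^sup>2 / 2))))
    \<le> \<bar>s\<bar> * (2 / n * (2 * A * L) + \<bar>s\<bar> * (2 / n * (24 * A\<^sup>2 * L)))"
proof -
  have "(\<lambda>N. - (2 * (\<Sum>k\<in>{1..int N}. of_int k * (cmod (fc \<phi> k))\<^sup>2) * s\<^sup>2 / 2)) \<longlonglongrightarrow> - (V * s\<^sup>2 / 2)"
    using V by (intro tendsto_minus tendsto_divide tendsto_mult[of _ V] tendsto_const) auto
  hence "(\<lambda>N. complex_of_real (exp (- (2 * (\<Sum>k\<in>{1..int N}. of_int k * (cmod (fc \<phi> k))\<^sup>2) * s\<^sup>2 / 2)))) \<longlonglongrightarrow> of_real (exp (- (V * s\<^sup>2 / 2)))"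
    by (intro tendsto_of_real tendsto_exp)
  hence lim: "(\<lambda>N. cmod ((LINT M|H. exp (\<i> * of_real s * (\<Sum>k\<in>{- int N..int N} - {0}. fc \<phi> k * ptrace n k M)))
        - complex_of_real (exp (- (2 * (\<Sum>k\<in>{1..int N}. of_int k * (cmod (fc \<phi> k))\<^sup>2) * s\<^sup>2 / 2)))))
     \<longlonglongrightarrow> cmod ((LINT M|H. exp (\<i> * of_real s * (F M - (LINT M|H. F M)))) - of_real (exp (- (V * s\<^sup>2 / 2))))"
    by (intro tendsto_norm tendsto_diff statistic_char_limit[OF \<phi> F real])
  show ?thesis
  proof (rule LIMSEQ_le_const2[OF lim], intro exI allI impI)
    fix N
    note trig_sum_char_bound[where c = "fc \<phi>" and s = s and N = N, OF real(2)]
    also have "\<bar>s\<bar> * (2 / n * sqrt (\<Sum>k\<in>{1..int N}. (cmod (fc \<phi> k))\<^sup>2 * of_int k ^ 3) + \<bar>s\<bar> *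
        (2 / n * (\<Sum>k\<in>{1..int N}. cmod (fc \<phi> k) * sqrt (\<Sum>m\<in>{- int N..int N} - {0}. (cmod (fc \<phi> m))\<^sup>2 * of_int m ^ 2 * (of_int k + \<bar>of_int m\<bar>)))))
       \<le> \<bar>s\<bar> * (2 / n * (2 * A * L) + \<bar>s\<bar> * (2 / n * (24 * A\<^sup>2 * L)))"
      by (intro mult_left_mono add_mono decay_sum_cube[OF A] decay_sum_outer[OF A]) auto
    finally show "cmod ((LINT M|H. exp (\<i> * of_real s * (\<Sum>k\<in>{- int N..int N} - {0}. fc \<phi> k * ptrace n k M)))
        - complex_of_real (exp (- (2 * (\<Sum>k\<in>{1..int N}. of_int k * (cmod (fc \<phi> k))\<^sup>2) * s\<^sup>2 / 2))))
      \<le> \<bar>s\<bar> * (2 / n * (2 * A * L) + \<bar>s\<bar> * (2 / n * (24 * A\<^sup>2 * L)))" .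
  qed
qed

lemma (in haar_unitary) real_statistic:
  assumes X: "regular (\<lambda>M. complex_of_real (X M))"
  shows "integrable H X"
    and "complex_of_real (LINT M|H. X M) = (LINT M|H. complex_of_real (X M))"
    and "real_distribution (distr H borel (\<lambda>M. X M - (LINT M|H. X M)))"
    and "char (distr H borel (\<lambda>M. X M - (LINT M|H. X M))) s
      = (LINT M|H. exp (\<i> * of_real s * (complex_of_real (X M) - (LINT M|H. complex_of_real (X M)))))"
proof -
  show i: "integrable H X" using integrable_Re[OF regular_integrable[OF X]] by simp
  show m: "complex_of_real (LINT M|H. X M) = (LINT M|H. complex_of_real (X M))"
    by (rule integral_complex_of_real[symmetric])
  have X': "(\<lambda>M. X M - (LINT M|H. X M)) \<in> borel_measurable H" using borel_measurable_integrable[OF i] by simp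
  thus "real_distribution (distr H borel (\<lambda>M. X M - (LINT M|H. X M)))" by (rule real_distribution_distr)
  have "char (distr H borel (\<lambda>M. X M - (LINT M|H. X M))) s = (LINT M|H. iexp (s * (X M - (LINT M|H. X M))))"
    unfolding char_def by (rule integral_distr[OF X']) simp
  also have "(\<lambda>M. iexp (s * (X M - (LINT M|H. X M)))) = (\<lambda>M. exp (\<i> * of_real s * (complex_of_real (X M) - (LINT M|H. complex_of_real (X M)))))"
    unfolding of_real_mult of_real_diff m mult.assoc ..
  finally show "char (distr H borel (\<lambda>M. X M - (LINT M|H. X M))) s
      = (LINT M|H. exp (\<i> * of_real s * (complex_of_real (X M) - (LINT M|H. complex_of_real (X M)))))" .
qed

lemma real_distribution_normal_law:
  assumes "0 \<le> v"
  shows "real_distribution (normal_law 0 v)"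
proof -
  have "prob_space (normal_law 0 v)"
    using assms unfolding normal_law_def by (auto intro!: prob_space_return prob_space_normal_density)
  thus ?thesis by (auto simp: real_distribution_def real_distribution_axioms_def normal_law_def)
qed

lemma char_normal_law:
  assumes v: "0 \<le> v"
  shows "char (normal_law 0 v) t = of_real (exp (- (v * t\<^sup>2 / 2)))"
proof (cases "v = 0")
  case True
  have "char (normal_law 0 v) t = iexp (t * 0)"
    unfolding char_def normal_law_def using True by (subst if_P, simp) (rule integral_return, simp_all)
  thus ?thesis using True by simp
next
  case False
  define \<sigma> where "\<sigma> = sqrt v"
  have \<sigma>: "0 < \<sigma>" "\<sigma>\<^sup>2 = v" using v False by (auto simp: \<sigma>_def)
  have d: "\<sigma> * normal_density 0 \<sigma> (\<sigma> * x) = std_normal_density x" for x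
    using \<sigma>(1) by (simp add: normal_density_def real_sqrt_mult power_mult_distrib)
  have "char (normal_law 0 v) t = (LINT x|lborel. normal_density 0 \<sigma> x *\<^sub>R iexp (t * x))"
    unfolding char_def normal_law_def \<sigma>_def using False by (subst if_not_P, simp) (rule integral_density, auto)
  also have "\<dots> = \<sigma> *\<^sub>R (LINT x|lborel. normal_density 0 \<sigma> (0 + \<sigma> * x) *\<^sub>R iexp (t * (0 + \<sigma> * x)))"
    using lborel_integral_real_affine[of \<sigma> "\<lambda>x. normal_density 0 \<sigma> x *\<^sub>R iexp (t * x)" 0] \<sigma>(1) by simp
  also have "\<dots> = (LINT x|lborel. \<sigma> *\<^sub>R (normal_density 0 \<sigma> (0 + \<sigma> * x) *\<^sub>R iexp (t * (0 + \<sigma> * x))))"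
    by (rule integral_scaleR_right[symmetric])
  also have "\<dots> = (LINT x|lborel. std_normal_density x *\<^sub>R iexp ((t * \<sigma>) * x))"
    by (intro Bochner_Integration.integral_cong refl) (simp only: scaleR_scaleR d add_0_left mult.assoc)
  also have "\<dots> = char std_normal_distribution (t * \<sigma>)"
    unfolding char_def by (rule integral_density[symmetric]) auto
  also have "\<dots> = of_real (exp (- (v * t\<^sup>2 / 2)))"
    unfolding char_std_normal_distribution by (simp add: power_mult_distrib \<sigma>(2) mult.commute)
  finally show ?thesis .
qed

lemma centred_tends_to_normal_law:
  assumes "\<And>n. real_distribution (distr (P (Suc n)) borel (\<lambda>\<omega>. X (Suc n) \<omega> - (LINT \<omega>'|P (Suc n). X (Suc n) \<omega>')))"
    and v: "0 \<le> v"
    and "\<And>s. (\<lambda>n. char (distr (P (Suc n)) borel (\<lambda>\<omega>. X (Suc n) \<omega> - (LINT \<omega>'|P (Suc n). X (Suc n) \<omega>'))) s)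
       \<longlonglongrightarrow> of_real (exp (- (v * s\<^sup>2 / 2)))"
  shows "centred_tends_to_law P X (normal_law 0 v)"
proof -
  let ?M = "\<lambda>n. distr (P n) borel (\<lambda>\<omega>. X n \<omega> - (LINT \<omega>'|P n. X n \<omega>'))"
  have "weak_conv_m (\<lambda>n. ?M (Suc n)) (normal_law 0 v)"
    using assms(3) by (intro levy_continuity assms(1) real_distribution_normal_law[OF v]) (simp add: char_normal_law[OF v])
  hence "(\<lambda>n. cdf (?M (Suc n)) x) \<longlonglongrightarrow> cdf (normal_law 0 v) x" if "isCont (cdf (normal_law 0 v)) x" for x
    using that unfolding weak_conv_m_def weak_conv_def by blast
  hence "(\<lambda>n. cdf (?M n) x) \<longlonglongrightarrow> cdf (normal_law 0 v) x" if "isCont (cdf (normal_law 0 v)) x" for x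
    using that by (intro LIMSEQ_imp_Suc[where f = "\<lambda>n. cdf (?M n) x"]) blast
  thus ?thesis unfolding centred_tends_to_law_def weak_conv_m_def weak_conv_def by blast
qed

context haar_eigen
begin

context
  fixes g :: "real \<Rightarrow> real" and L :: real
  assumes g: "schwartz g" and L: "0 < L"
begin

lemma dilate_statistic:
  defines "\<phi> \<equiv> \<lambda>x. complex_of_real (dilate_circle L g x)"
  shows "\<phi> \<in> borel_measurable circ"
    and "\<exists>C. \<forall>x\<in>{-pi..<pi}. cmod (\<phi> x) \<le> C"
    and "regular (\<lambda>M. \<Sum>j<n. \<phi> (\<theta> M j))"
    and "AE M in H. (\<lambda>N. trigsum \<phi> N M) \<longlonglongrightarrow> (\<Sum>j<n. \<phi> (\<theta> M j))"
proof -
  show m: "\<phi> \<in> borel_measurable circ"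
    unfolding \<phi>_def by (intro borel_measurable_of_real_circ dilate_circle_measurable[OF g L])
  have chord: "\<exists>K. \<forall>x\<in>{-pi..<pi}. cmod (\<phi> x - \<phi> x0) \<le> K * cmod (cis x - cis x0)" if "x0 \<in> {-pi..<pi}" for x0
    unfolding \<phi>_def by (rule dilate_circle_chord[OF g L that])
  obtain C where C: "\<And>x. \<bar>x\<bar> \<le> 2 * pi \<Longrightarrow> \<bar>dilate_circle L g x\<bar> \<le> C"
    using dilate_circle_bounds[OF g L] by blast
  have C': "cmod (\<phi> x) \<le> C" if "x \<in> {-pi..<pi}" for x
    using C[of x] that pi_gt_zero by (auto simp: \<phi>_def)
  thus "\<exists>C. \<forall>x\<in>{-pi..<pi}. cmod (\<phi> x) \<le> C" by blast
  show "regular (\<lambda>M. \<Sum>j<n. \<phi> (\<theta> M j))"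
    by (rule statistic_regular[OF statistic_measurable[OF m chord] C'])
  show "AE M in H. (\<lambda>N. trigsum \<phi> N M) \<longlonglongrightarrow> (\<Sum>j<n. \<phi> (\<theta> M j))"
    using AE_space[of H] by eventually_elim (auto simp: space_H intro!: trigsum_tendsto m chord \<theta>_range)
qed

lemma window_statistic:
  defines "f \<equiv> \<lambda>x. complex_of_real (g (L * x))"
  shows "f \<in> borel_measurable circ"
    and "\<exists>C. \<forall>x\<in>{-pi..<pi}. cmod (f x) \<le> C"
    and "regular (\<lambda>M. \<Sum>j<n. f (\<theta> M j))"
    and "AE M in H. (\<lambda>N. trigsum f N M) \<longlonglongrightarrow> (\<Sum>j<n. f (\<theta> M j))"
proof -
  have bd: "\<exists>C. 0 < C \<and> (\<forall>x. \<bar>u x\<bar> \<le> C)" if u: "schwartz u" for u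
  proof -
    obtain C where C: "0 < C" "\<And>x. \<bar>u x\<bar> \<le> C / (1 + x\<^sup>2)" using schwartz_bound2[OF u] by blast
    have "C / (1 + x\<^sup>2) \<le> C / 1" for x using C(1) one_plus_square_pos[of x] by (intro divide_left_mono) auto
    hence "\<bar>u x\<bar> \<le> C" for x using order_trans[OF C(2)] by simp
    thus ?thesis using C(1) by blast
  qed
  obtain C where C: "\<And>x. \<bar>g x\<bar> \<le> C" using bd[OF g] by blast
  obtain B where B: "0 < B" "\<And>x. \<bar>deriv g x\<bar> \<le> B" using bd[OF schwartz_deriv[OF g]] by blast
  show m: "f \<in> borel_measurable circ"
    unfolding f_def using borel_measurable_of_real_circ[OF dilate_measurable[OF g L, of 0]] by simp
  have C': "cmod (f x) \<le> C" for x unfolding f_def by (simp add: C)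
  thus "\<exists>C. \<forall>x\<in>{-pi..<pi}. cmod (f x) \<le> C" by blast
  have lip: "cmod (f x - f y) \<le> (B * L) * \<bar>x - y\<bar>" for x y
  proof -
    have "norm (g (L * x) - g (L * y)) \<le> B * norm (L * x - L * y)"
      by (rule field_differentiable_bound[where S = UNIV and f' = "deriv g"])
        (use B schwartz_has_derivative[OF g] in auto)
    also have "norm (L * x - L * y) = L * \<bar>x - y\<bar>" unfolding right_diff_distrib[symmetric] real_norm_def abs_mult using L by simp
    finally show ?thesis unfolding f_def of_real_diff[symmetric] norm_of_real by (simp add: mult.assoc)
  qed
  show "regular (\<lambda>M. \<Sum>j<n. f (\<theta> M j))"
    by (rule statistic_regular[OF lipschitz_statistic_measurable[OF m C' lip] C'])
  show "AE M in H. (\<lambda>N. trigsum f N M) \<longlonglongrightarrow> (\<Sum>j<n. f (\<theta> M j))"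
    by (rule lipschitz_statistic_limit[OF m C' lip])
qed

lemma regular_dilate: "regular (\<lambda>M. complex_of_real (\<Sum>j<n. dilate_circle L g (\<theta> M j)))"
  using dilate_statistic(3) by simp

lemma regular_window: "regular (\<lambda>M. complex_of_real (\<Sum>j<n. g (L * \<theta> M j)))"
  using window_statistic(3) by simp

lemma dilate_expectation: "(LINT M|H. (\<Sum>j<n. dilate_circle L g (\<theta> M j))) = real n / (2 * pi * L) * (LINT x|lborel. g x)"
proof -
  obtain C where C: "\<And>x. x \<in> {-pi..<pi} \<Longrightarrow> cmod (complex_of_real (dilate_circle L g x)) \<le> C" using dilate_statistic(2) by blast
  have "complex_of_real (LINT M|H. (\<Sum>j<n. dilate_circle L g (\<theta> M j))) = (LINT M|H. (\<Sum>j<n. complex_of_real (dilate_circle L g (\<theta> M j))))"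
    unfolding real_statistic(2)[OF regular_dilate] by simp
  also have "\<dots> = of_nat n * fc (\<lambda>x. complex_of_real (dilate_circle L g x)) 0"
    by (rule statistic_expectation[OF dilate_statistic(1) C dilate_statistic(3,4)])
  also have "\<dots> = of_nat n * (complex_of_real (LINT x|lborel. g x) / (2 * pi * L))"
    unfolding fc_dilate_circle[OF g L] by (simp add: fti_zero set_lebesgue_integral_def)
  also have "\<dots> = complex_of_real (real n / (2 * pi * L) * (LINT x|lborel. g x))" by simp
  finally show ?thesis unfolding of_real_eq_iff .
qed

lemma window_expectation: "(LINT M|H. (\<Sum>j<n. g (L * \<theta> M j))) = real n / (2 * pi * L) *
   ((LINT x|lborel. g x) - (LINT x:{x. pi * L < \<bar>x\<bar>}|lborel. g x))"
proof -
  obtain C where C: "\<And>x. x \<in> {-pi..<pi} \<Longrightarrow> cmod (complex_of_real (g (L * x))) \<le> C" using window_statistic(2) by blast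
  have a: "0 \<le> pi * L" using L by simp
  have si: "set_integrable lborel A g" if "A \<in> sets borel" for A
    unfolding set_integrable_def using that by (intro integrable_mult_indicator schwartz_integrable[OF g]) auto
  have "(LINT x:{x. pi * L < \<bar>x\<bar>}|lborel. g x) = (LINT x:{..<- (pi * L)} \<union> {pi * L<..}|lborel. g x)"
    by (rule arg_cong2[where f = "\<lambda>A. set_lebesgue_integral lborel A"]) auto
  also have "\<dots> = (LINT x:{..<- (pi * L)}|lborel. g x) + (LINT x:{pi * L<..}|lborel. g x)"
    using a by (intro set_integral_Un si) auto
  finally have tails: "(LINT x:{x. pi * L < \<bar>x\<bar>}|lborel. g x) = \<dots>" .
  have "complex_of_real (LINT M|H. (\<Sum>j<n. g (L * \<theta> M j))) = (LINT M|H. (\<Sum>j<n. complex_of_real (g (L * \<theta> M j))))"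
    unfolding real_statistic(2)[OF regular_window] by simp
  also have "\<dots> = of_nat n * fc (\<lambda>x. complex_of_real (g (L * x))) 0"
    by (rule statistic_expectation[OF window_statistic(1) C window_statistic(3,4)])
  also have "\<dots> = of_nat n * (fti {- (pi * L)..<pi * L} g 0 / (2 * pi * L))"
    unfolding fc_dilate_window[OF g L] by simp
  also have "fti {- (pi * L)..<pi * L} g 0 = fti UNIV g 0 - (fti {..<- (pi * L)} g 0 + fti {pi * L<..} g 0)"
    using fti_tails[OF g L a, of 0] by (simp add: algebra_simps)
  also have "\<dots> = complex_of_real ((LINT x|lborel. g x) - (LINT x:{x. pi * L < \<bar>x\<bar>}|lborel. g x))"
    unfolding fti_zero tails by (simp add: set_lebesgue_integral_def)
  also have "of_nat n * (complex_of_real ((LINT x|lborel. g x) - (LINT x:{x. pi * L < \<bar>x\<bar>}|lborel. g x)) / (2 * pi * L))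
     = complex_of_real (real n / (2 * pi * L) * ((LINT x|lborel. g x) - (LINT x:{x. pi * L < \<bar>x\<bar>}|lborel. g x)))" by simp
  finally show ?thesis unfolding of_real_eq_iff .
qed

lemma dilate_char_bound:
  assumes L1: "1 \<le> L" and A: "0 < A" "\<And>t. cmod (fti UNIV g t) \<le> A / (1 + \<bar>t\<bar> ^ 3)"
    and V: "(\<lambda>N. \<Sum>k=1..N. \<bar>real k / L\<bar> * (cmod (fti UNIV g (real k / L)))\<^sup>2 / L) \<longlonglongrightarrow> V"
  defines "X \<equiv> \<lambda>M. \<Sum>j<n. dilate_circle L g (\<theta> M j)"
  shows "cmod (char (distr H borel (\<lambda>M. X M - (LINT M|H. X M))) s - of_real (exp (- (1 / (2 * pi\<^sup>2) * V * s\<^sup>2 / 2))))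
    \<le> \<bar>s\<bar> * (2 / n * (2 * A * L) + \<bar>s\<bar> * (2 / n * (24 * A\<^sup>2 * L)))"
proof -
  let ?\<phi> = "\<lambda>x. complex_of_real (dilate_circle L g x)"
  obtain C where C: "\<And>x. x \<in> {-pi..<pi} \<Longrightarrow> cmod (?\<phi> x) \<le> C" using dilate_statistic(2) by blast
  have fc: "cmod (fc ?\<phi> k) = cmod (fti UNIV g (of_int k / L)) / (2 * pi * L)" for k
    unfolding fc_dilate_circle[OF g L] using L by (simp add: norm_divide norm_mult)
  have decay: "cmod (fc ?\<phi> k) \<le> A / L / (1 + (\<bar>of_int k\<bar> / L) ^ 3)" for k
  proof -
    have p: "0 < 1 + (\<bar>of_int k\<bar> / L) ^ 3" using L by (intro add_pos_nonneg) auto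
    have "cmod (fti UNIV g (of_int k / L)) \<le> A / (1 + (\<bar>of_int k\<bar> / L) ^ 3)"
      using A(2)[of "of_int k / L"] L by (simp add: abs_divide)
    hence "cmod (fc ?\<phi> k) \<le> A / (1 + (\<bar>of_int k\<bar> / L) ^ 3) / (2 * pi * L)"
      unfolding fc using L by (intro divide_right_mono) auto
    also have "\<dots> \<le> A / (1 + (\<bar>of_int k\<bar> / L) ^ 3) / L"
    proof (rule divide_left_mono)
      show "L \<le> 2 * pi * L" using L pi_ge_two mult_right_mono[of 1 "2 * pi" L] by simp
    qed (use A(1) p L in auto)
    finally show ?thesis by (simp add: mult.commute)
  qed
  have "2 * (\<Sum>k\<in>{1..int N}. of_int k * (cmod (fc ?\<phi> k))\<^sup>2)
     = 1 / (2 * pi\<^sup>2) * (\<Sum>k=1..N. \<bar>real k / L\<bar> * (cmod (fti UNIV g (real k / L)))\<^sup>2 / L)" for N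
    unfolding sum_int_atLeast1 sum_distrib_left fc
    using L by (intro sum.cong refl) (simp add: power_divide power_mult_distrib power2_eq_square)
  hence V': "(\<lambda>N. 2 * (\<Sum>k\<in>{1..int N}. of_int k * (cmod (fc ?\<phi> k))\<^sup>2)) \<longlonglongrightarrow> 1 / (2 * pi\<^sup>2) * V"
    using tendsto_mult_left[OF V, of "1 / (2 * pi\<^sup>2)"] by (simp only:)
  have "char (distr H borel (\<lambda>M. X M - (LINT M|H. X M))) s
     = (LINT M|H. exp (\<i> * of_real s * ((\<Sum>j<n. ?\<phi> (\<theta> M j)) - (LINT M|H. (\<Sum>j<n. ?\<phi> (\<theta> M j))))))"
    unfolding X_def real_statistic(4)[OF regular_dilate] by simp
  moreover have "(\<Sum>j<n. ?\<phi> (\<theta> M j)) \<in> \<real>" for M by (intro sum_in_Reals) auto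
  ultimately show ?thesis
    using statistic_char_bound[OF dilate_statistic(1) C dilate_statistic(3,4) _ fc_minus less_imp_le[OF A(1)] L1 decay V', of s] by (simp only:)
qed

lemma window_char_bound:
  assumes b: "0 \<le> b" "\<And>k. k \<noteq> 0 \<Longrightarrow> cmod (fti {..<- (pi * L)} g (of_int k / L) + fti {pi * L<..} g (of_int k / L))
      \<le> \<bar>g (pi * L) - g (- (pi * L))\<bar> * L / \<bar>of_int k\<bar> + b / (of_int k)\<^sup>2"
  defines "X \<equiv> \<lambda>M. \<Sum>j<n. dilate_circle L g (\<theta> M j)" and "Y \<equiv> \<lambda>M. \<Sum>j<n. g (L * \<theta> M j)"
  shows "cmod (char (distr H borel (\<lambda>M. Y M - (LINT M|H. Y M))) s - char (distr H borel (\<lambda>M. X M - (LINT M|H. X M))) s)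
    \<le> \<bar>s\<bar> * sqrt (4 * (g (pi * L) - g (- (pi * L)))\<^sup>2 * (2 + ln (real n)) + 8 * (b / L)\<^sup>2)"
proof -
  let ?\<phi> = "\<lambda>x. complex_of_real (dilate_circle L g x)" and ?f = "\<lambda>x. complex_of_real (g (L * x))"
  define h where "h = (\<lambda>x. ?\<phi> x - ?f x)"
  define D where "D = (\<lambda>M. (\<Sum>j<n. ?\<phi> (\<theta> M j)) - (\<Sum>j<n. ?f (\<theta> M j)))"
  define J where "J = \<bar>g (pi * L) - g (- (pi * L))\<bar>"
  obtain C1 where C1: "\<And>x. x \<in> {-pi..<pi} \<Longrightarrow> cmod (?\<phi> x) \<le> C1" using dilate_statistic(2) by blast
  obtain C2 where C2: "\<And>x. x \<in> {-pi..<pi} \<Longrightarrow> cmod (?f x) \<le> C2" using window_statistic(2) by blast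
  have hm: "h \<in> borel_measurable circ"
    unfolding h_def by (intro borel_measurable_diff dilate_statistic(1) window_statistic(1))
  have hC: "cmod (h x) \<le> C1 + C2" if "x \<in> {-pi..<pi}" for x
    unfolding h_def by (rule order_trans[OF norm_triangle_ineq4 add_mono[OF C1 C2]]) (use that in auto)
  have i1: "integrable circ (\<lambda>x. ?\<phi> x * cis (- (of_int k * x)))" for k
    using C1 by (intro integrable_circ[of _ C1] borel_measurable_times cis_measurable dilate_statistic(1)) (simp add: norm_mult)
  have i2: "integrable circ (\<lambda>x. ?f x * cis (- (of_int k * x)))" for k
    using C2 by (intro integrable_circ[of _ C2] borel_measurable_times cis_measurable window_statistic(1)) (simp add: norm_mult)
  have fc: "fc h k = fc ?\<phi> k - fc ?f k" for k
    unfolding fc_def h_def left_diff_distrib Bochner_Integration.integral_diff[OF i1 i2] by (rule diff_divide_distrib)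
  have Dr: "regular D" unfolding D_def by (intro regular_diff dilate_statistic(3) window_statistic(3))
  have Dl: "AE M in H. (\<lambda>N. trigsum h N M) \<longlonglongrightarrow> D M"
    using dilate_statistic(4) window_statistic(4)
  proof eventually_elim
    case (elim M)
    have "trigsum h N M = trigsum ?\<phi> N M - trigsum ?f N M" for N
      unfolding trigsum_def fc left_diff_distrib sum_subtractf ..
    thus ?case unfolding D_def using tendsto_diff[OF elim] by (simp only:)
  qed
  have a: "0 \<le> pi * L" using L by simp
  have hb: "cmod (fc h k) \<le> J / \<bar>of_int k\<bar> + (b / L) / (of_int k)\<^sup>2" if k: "k \<noteq> 0" for k
  proof -
    have "fc h k = (fti {..<- (pi * L)} g (of_int k / L) + fti {pi * L<..} g (of_int k / L)) / (2 * pi * L)"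
      unfolding fc fc_dilate_circle[OF g L] fc_dilate_window[OF g L] fti_tails[OF g L a, symmetric] by (simp add: diff_divide_distrib)
    hence "cmod (fc h k) = cmod (fti {..<- (pi * L)} g (of_int k / L) + fti {pi * L<..} g (of_int k / L)) / (2 * pi * L)"
      using L by (simp add: norm_divide norm_mult)
    also have "\<dots> \<le> (J * L / \<bar>of_int k\<bar> + b / (of_int k)\<^sup>2) / (2 * pi * L)"
      using b(2)[OF k] L unfolding J_def by (intro divide_right_mono) auto
    also have "\<dots> \<le> (J * L / \<bar>of_int k\<bar> + b / (of_int k)\<^sup>2) / L"
    proof (rule divide_left_mono)
      show "L \<le> 2 * pi * L" using L pi_ge_two mult_right_mono[of 1 "2 * pi" L] by simp
      show "0 \<le> J * L / \<bar>of_int k\<bar> + b / (of_int k)\<^sup>2" using b(1) L by (auto simp: J_def intro!: add_nonneg_nonneg)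
    qed (use L in auto)
    also have "\<dots> = J / \<bar>of_int k\<bar> + (b / L) / (of_int k)\<^sup>2" using L by (simp add: add_divide_distrib)
    finally show ?thesis .
  qed
  have tv: "trigvar h N \<le> 4 * J\<^sup>2 * (2 + ln (real n)) + 8 * (b / L)\<^sup>2" for N
    using hb b(1) L by (intro trigvar_le) (auto simp: J_def)
  have var: "(LINT M|H. (cmod (D M - (LINT M|H. D M)))\<^sup>2) \<le> 4 * J\<^sup>2 * (2 + ln (real n)) + 8 * (b / L)\<^sup>2"
    by (rule statistic_variance[OF hm hC Dr Dl tv])
  define mX where "mX = (LINT M|H. complex_of_real (X M))"
  define mY where "mY = (LINT M|H. complex_of_real (Y M))"
  have mr: "mX = of_real (LINT M|H. X M)" "mY = of_real (LINT M|H. Y M)"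
    unfolding mX_def mY_def X_def Y_def real_statistic(2)[OF regular_dilate] real_statistic(2)[OF regular_window] by (rule refl)+
  have rX: "regular (\<lambda>M. complex_of_real (X M))" and rY: "regular (\<lambda>M. complex_of_real (Y M))"
    unfolding X_def Y_def by (rule regular_dilate regular_window)+
  have D': "D M = complex_of_real (X M) - complex_of_real (Y M)" for M by (simp add: D_def X_def Y_def)
  have mD: "(LINT M|H. D M) = mX - mY"
    unfolding D' mX_def mY_def by (rule Bochner_Integration.integral_diff[OF regular_integrable[OF rX] regular_integrable[OF rY]])
  let ?E = "\<lambda>X m M. exp (\<i> * of_real s * (complex_of_real (X M) - m))"
  have rE: "regular (?E X mX)" "regular (?E Y mY)" by (intro regular_exp regular_mult regular_diff regular_const rX rY)+
  have "char (distr H borel (\<lambda>M. Y M - (LINT M|H. Y M))) s - char (distr H borel (\<lambda>M. X M - (LINT M|H. X M))) s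
     = (LINT M|H. ?E Y mY M - ?E X mX M)"
    unfolding real_statistic(4)[OF rX] real_statistic(4)[OF rY] mX_def[symmetric] mY_def[symmetric]
    by (rule Bochner_Integration.integral_diff[OF regular_integrable[OF rE(2)] regular_integrable[OF rE(1)], symmetric])
  hence "cmod (char (distr H borel (\<lambda>M. Y M - (LINT M|H. Y M))) s - char (distr H borel (\<lambda>M. X M - (LINT M|H. X M))) s)
     \<le> (LINT M|H. cmod (?E Y mY M - ?E X mX M))" by (simp only: integral_norm_bound)
  also have "\<dots> \<le> (LINT M|H. \<bar>s\<bar> * cmod (D M - (LINT M|H. D M)))"
  proof (rule integral_mono)
    show "integrable H (\<lambda>M. cmod (?E Y mY M - ?E X mX M))"
      by (intro integrable_norm regular_integrable regular_diff rE)
    show "integrable H (\<lambda>M. \<bar>s\<bar> * cmod (D M - (LINT M|H. D M)))"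
      by (intro integrable_mult_right integrable_norm regular_integrable regular_diff Dr regular_const)
    fix M
    have e: "exp (\<i> * of_real s * (complex_of_real x - of_real m)) = cis (s * (x - m))" for x m
      by (simp add: cis_conv_exp mult.assoc)
    have "cmod (?E Y mY M - ?E X mX M) \<le> \<bar>s * (Y M - (LINT M|H. Y M)) - s * (X M - (LINT M|H. X M))\<bar>"
      unfolding mr e by (rule norm_cis_diff_le)
    also have "\<dots> = \<bar>s\<bar> * \<bar>(X M - Y M) - ((LINT M|H. X M) - (LINT M|H. Y M))\<bar>"
      unfolding abs_mult[symmetric] by (subst abs_minus_cancel[symmetric]) (simp add: algebra_simps)
    also have "\<bar>(X M - Y M) - ((LINT M|H. X M) - (LINT M|H. Y M))\<bar> = cmod (D M - (LINT M|H. D M))"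
    proof -
      have "D M - (LINT M|H. D M) = complex_of_real ((X M - Y M) - ((LINT M|H. X M) - (LINT M|H. Y M)))"
        unfolding mD unfolding D' mr by simp
      thus ?thesis by (simp only: norm_of_real)
    qed
    finally show "cmod (?E Y mY M - ?E X mX M) \<le> \<bar>s\<bar> * cmod (D M - (LINT M|H. D M))" .
  qed
  also have "\<dots> = \<bar>s\<bar> * (LINT M|H. cmod (D M - (LINT M|H. D M)))" by (rule integral_mult_right_zero)
  also have "\<dots> \<le> \<bar>s\<bar> * sqrt (LINT M|H. (cmod (D M - (LINT M|H. D M)))\<^sup>2)"
    by (intro mult_left_mono expectation_norm_le regular_diff Dr regular_const) auto
  also have "\<dots> \<le> \<bar>s\<bar> * sqrt (4 * J\<^sup>2 * (2 + ln (real n)) + 8 * (b / L)\<^sup>2)"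
    by (intro mult_left_mono real_sqrt_le_mono var) auto
  finally show ?thesis by (simp add: J_def)
qed

end

end

lemma fti_square_decay:
  assumes A: "0 < A" "\<And>t. cmod (fti UNIV g t) \<le> A / (1 + \<bar>t\<bar> ^ 3)"
  shows "\<bar>\<bar>t\<bar> * (cmod (fti UNIV g t))\<^sup>2\<bar> \<le> 2 * A\<^sup>2 / (1 + t\<^sup>2)"
proof -
  have q: "1 \<le> 1 + \<bar>t\<bar> ^ 3" by simp
  have r: "1 / (1 + \<bar>t\<bar> ^ 3) \<le> 1" by (rule divide_le_eq_1_pos[THEN iffD2]) (use q in linarith)+
  have "\<bar>\<bar>t\<bar> * (cmod (fti UNIV g t))\<^sup>2\<bar> \<le> \<bar>t\<bar> * (A / (1 + \<bar>t\<bar> ^ 3))\<^sup>2"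
    unfolding abs_mult using A by (auto intro!: mult_left_mono power_mono)
  also have "\<dots> = A\<^sup>2 * (\<bar>t\<bar> / (1 + \<bar>t\<bar> ^ 3)) * (1 / (1 + \<bar>t\<bar> ^ 3))" by (simp add: power2_eq_square)
  also have "\<dots> \<le> A\<^sup>2 * (2 / (1 + \<bar>t\<bar>\<^sup>2)) * 1"
    using q by (intro mult_mono cubic_decay r) auto
  finally show ?thesis by (simp add: mult_ac)
qed

lemma limit_variance_eq:
  assumes g: "schwartz g"
  shows "limit_variance g = 1 / (2 * pi\<^sup>2) * (LINT t:{0<..}|lborel. \<bar>t\<bar> * (cmod (fti UNIV g t))\<^sup>2)"
proof -
  let ?h = "\<lambda>t. \<bar>t\<bar> * (cmod (fti UNIV g t))\<^sup>2"
  obtain A where A: "0 < A" "\<And>t. cmod (fti UNIV g t) \<le> A / (1 + \<bar>t\<bar> ^ 3)" using fti_decay[OF g] by blast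
  note hb = fti_square_decay[OF A]
  have hm: "?h \<in> borel_measurable borel"
    by (intro borel_measurable_continuous_onI continuous_at_imp_continuous_on ballI continuous_intros fti_isCont[OF g])
  have hi: "integrable lborel ?h"
    by (rule Bochner_Integration.integrable_bound[OF integrable_inverse_square[of "2 * A\<^sup>2"]])
      (use hm hb in \<open>auto intro!: AE_I2 order_trans[OF hb]\<close>)
  have "(LINT t|lborel. ?h t) = (LINT t|lborel. indicator {0<..} t *\<^sub>R ?h t + indicator {..<0} t *\<^sub>R ?h t)"
    by (intro Bochner_Integration.integral_cong refl) (auto simp: indicator_def)
  also have "\<dots> = (LINT t:{0<..}|lborel. ?h t) + (LINT t:{..<0}|lborel. ?h t)"
    unfolding set_lebesgue_integral_def by (intro Bochner_Integration.integral_add integrable_mult_indicator hi) auto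
  also have "(LINT t:{..<0}|lborel. ?h t) = (LINT t:{0<..}|lborel. ?h t)"
    unfolding set_lebesgue_integral_def
    by (subst lborel_integral_real_affine[where c = "-1" and t = 0])
      (auto simp: fti_uminus indicator_def intro!: Bochner_Integration.integral_cong)
  finally have s: "(LINT t|lborel. ?h t) = 2 * (LINT t:{0<..}|lborel. ?h t)" by simp
  have f: "(cmod (fourier g t))\<^sup>2 * \<bar>t\<bar> = 1 / (2 * pi) * ?h t" for t
    unfolding fourier_def fti_UNIV norm_mult norm_of_real by (simp add: power_mult_distrib power_divide mult_ac)
  have "limit_variance g = 1 / (2 * pi) * (1 / (2 * pi) * (LINT t|lborel. ?h t))"
    unfolding limit_variance_def f by simp
  also have "\<dots> = 1 / (2 * pi\<^sup>2) * (LINT t:{0<..}|lborel. ?h t)"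
    unfolding s by (simp add: power2_eq_square)
  finally show ?thesis .
qed

lemma limit_variance_nonneg: "0 \<le> limit_variance g"
  unfolding limit_variance_def by (intro mult_nonneg_nonneg integral_nonneg_AE) auto

theorem theorem1:
  fixes g :: "real \<Rightarrow> real"
    and L :: "nat \<Rightarrow> real"
    and H :: "nat \<Rightarrow> complex mat measure"
    and \<theta> :: "nat \<Rightarrow> complex mat \<Rightarrow> nat \<Rightarrow> real"
  assumes "schwartz g"
    and "\<forall>n\<ge>1. 0 < L n"
    and "filterlim L at_top sequentially"
    and "(\<lambda>n. L n / real n) \<longlonglongrightarrow> 0"
    and "\<forall>n\<ge>1. normalized_haar n (H n)"
    and "\<forall>n\<ge>1. \<forall>M \<in> unitary_group n. eigenangles n M (\<theta> n M)"
  defines "S \<equiv> \<lambda>n M. \<Sum>j<n. g (L n * \<theta> n M j)"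
    and "T \<equiv> \<lambda>n M. \<Sum>j<n. dilate_circle (L n) g (\<theta> n M j)"
  shows
    "(\<forall>n\<ge>1. integrable (H n) (T n) \<and>
        (LINT M|H n. T n M) = real n / (2 * pi * L n) * (LINT x|lborel. g x)) \<and>
     centred_tends_to_law H T (normal_law 0 (limit_variance g)) \<and>
     (\<forall>n\<ge>1. integrable (H n) (S n) \<and>
        (LINT M|H n. S n M) =
          real n / (2 * pi * L n) *
            ((LINT x|lborel. g x) - (LINT x:{x. pi * L n < \<bar>x\<bar>}|lborel. g x))) \<and>
     ((\<lambda>n. (g (pi * L n) - g (- pi * L n))\<^sup>2 * ln (real n)) \<longlonglongrightarrow> 0 \<longrightarrow>
        centred_tends_to_law H S (normal_law 0 (limit_variance g)))"
proof -
  note g = assms(1)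
  have he: "haar_eigen n (H n) (\<theta> n)" if "1 \<le> n" for n
    using that assms(5,6) by (intro haar_eigen.intro haar_unitary.intro haar_eigen_axioms.intro) auto
  have Lp: "0 < L n" if "1 \<le> n" for n using assms(2) that by blast
  have LS: "0 < L (Suc n)" for n by (rule Lp) simp
  have Linf: "filterlim (\<lambda>n. L (Suc n)) at_top sequentially"
    by (rule filterlim_compose[OF assms(3) filterlim_Suc])
  have Ln: "(\<lambda>n. L (Suc n) / real (Suc n)) \<longlonglongrightarrow> 0" using LIMSEQ_Suc[OF assms(4)] .
  obtain A where A: "0 < A" "\<And>t. cmod (fti UNIV g t) \<le> A / (1 + \<bar>t\<bar> ^ 3)" using fti_decay[OF g] by blast
  define h where "h = (\<lambda>t. \<bar>t\<bar> * (cmod (fti UNIV g t))\<^sup>2)"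
  have hc: "isCont h t" for t unfolding h_def by (intro continuous_intros fti_isCont[OF g])
  have hb: "\<bar>h t\<bar> \<le> 2 * A\<^sup>2 / (1 + t\<^sup>2)" for t unfolding h_def by (rule fti_square_decay[OF A])
  have "0 \<le> 2 * A\<^sup>2" by simp
  from riemann_sum_tendsto[OF hc hb this LS Linf] obtain v where
    v: "\<And>n. (\<lambda>N. \<Sum>k=1..N. h (real k / L (Suc n)) / L (Suc n)) \<longlonglongrightarrow> v n"
      "v \<longlonglongrightarrow> (LINT t:{0<..}|lborel. h t)" by blast
  have vlim: "(\<lambda>n. 1 / (2 * pi\<^sup>2) * v n) \<longlonglongrightarrow> limit_variance g"
    unfolding limit_variance_eq[OF g] using tendsto_mult_left[OF v(2), of "1 / (2 * pi\<^sup>2)"] by (simp only: h_def)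
  let ?c = "\<lambda>X n s. char (distr (H (Suc n)) borel (\<lambda>M. X (Suc n) M - (LINT M|H (Suc n). X (Suc n) M))) s"
  have cT: "(\<lambda>n. ?c T n s) \<longlonglongrightarrow> of_real (exp (- (limit_variance g * s\<^sup>2 / 2)))" for s
  proof -
    have "(\<lambda>n. ?c T n s - of_real (exp (- (1 / (2 * pi\<^sup>2) * v n * s\<^sup>2 / 2)))) \<longlonglongrightarrow> 0"
    proof (rule Lim_null_comparison)
      have "\<forall>\<^sub>F n in sequentially. 1 \<le> L (Suc n)" using Linf unfolding filterlim_at_top by blast
      thus "\<forall>\<^sub>F n in sequentially. norm (?c T n s - of_real (exp (- (1 / (2 * pi\<^sup>2) * v n * s\<^sup>2 / 2))))
        \<le> (\<bar>s\<bar> * (4 * A + \<bar>s\<bar> * (48 * A\<^sup>2))) * (L (Suc n) / real (Suc n))"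
      proof eventually_elim
        case (elim n)
        have "norm (?c T n s - of_real (exp (- (1 / (2 * pi\<^sup>2) * v n * s\<^sup>2 / 2))))
          \<le> \<bar>s\<bar> * (2 / real (Suc n) * (2 * A * L (Suc n)) + \<bar>s\<bar> * (2 / real (Suc n) * (24 * A\<^sup>2 * L (Suc n))))"
          unfolding T_def
          by (rule haar_eigen.dilate_char_bound[OF he g LS elim A v(1)[unfolded h_def]]) simp
        also have "\<dots> = (\<bar>s\<bar> * (4 * A + \<bar>s\<bar> * (48 * A\<^sup>2))) * (L (Suc n) / real (Suc n))"
          by (simp add: algebra_simps add_divide_distrib del: of_nat_Suc)
        finally show ?case .
      qed
      show "(\<lambda>n. (\<bar>s\<bar> * (4 * A + \<bar>s\<bar> * (48 * A\<^sup>2))) * (L (Suc n) / real (Suc n))) \<longlonglongrightarrow> 0"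
        by (rule tendsto_mult_right_zero[OF Ln])
    qed
    moreover have "(\<lambda>n. complex_of_real (exp (- (1 / (2 * pi\<^sup>2) * v n * s\<^sup>2 / 2)))) \<longlonglongrightarrow> of_real (exp (- (limit_variance g * s\<^sup>2 / 2)))"
      by (intro tendsto_of_real tendsto_exp tendsto_minus tendsto_divide tendsto_mult[of _ "limit_variance g"] vlim tendsto_const) simp
    ultimately show ?thesis using tendsto_add by fastforce
  qed
  have rT: "real_distribution (distr (H n) borel (\<lambda>M. T n M - (LINT M|H n. T n M)))"
    and iT: "integrable (H n) (T n)" if n: "1 \<le> n" for n
    using haar_unitary.real_statistic(1,3)[OF haar_eigen.axioms(1)[OF he[OF n]] haar_eigen.regular_dilate[OF he[OF n] g Lp[OF n]]]
    unfolding T_def by simp_all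
  have rS: "real_distribution (distr (H n) borel (\<lambda>M. S n M - (LINT M|H n. S n M)))"
    and iS: "integrable (H n) (S n)" if n: "1 \<le> n" for n
    using haar_unitary.real_statistic(1,3)[OF haar_eigen.axioms(1)[OF he[OF n]] haar_eigen.regular_window[OF he[OF n] g Lp[OF n]]]
    unfolding S_def by simp_all
  have "centred_tends_to_law H S (normal_law 0 (limit_variance g))"
    if jump: "(\<lambda>n. (g (pi * L n) - g (- pi * L n))\<^sup>2 * ln (real n)) \<longlonglongrightarrow> 0"
  proof (rule centred_tends_to_normal_law[OF rS limit_variance_nonneg])
    fix s
    obtain b where b: "0 < b" "\<And>L k. 0 < L \<Longrightarrow> k \<noteq> 0 \<Longrightarrow>
       cmod (fti {..<- (pi * L)} g (of_int k / L) + fti {pi * L<..} g (of_int k / L))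
        \<le> \<bar>g (pi * L) - g (- (pi * L))\<bar> * L / \<bar>of_int k\<bar> + b / (of_int k)\<^sup>2"
      by (rule fti_tails_bound[OF g]) blast
    define J where "J = (\<lambda>n. (g (pi * L (Suc n)) - g (- (pi * L (Suc n))))\<^sup>2)"
    have J: "(\<lambda>n. J n * ln (real (Suc n))) \<longlonglongrightarrow> 0" using LIMSEQ_Suc[OF jump] by (simp add: J_def)
    have "(\<lambda>n. ?c S n s - ?c T n s) \<longlonglongrightarrow> 0"
    proof (rule Lim_null_comparison)
      have "\<forall>\<^sub>F n in sequentially. 1 \<le> ln (real (Suc n))" by real_asymp
      thus "\<forall>\<^sub>F n in sequentially. norm (?c S n s - ?c T n s)
         \<le> \<bar>s\<bar> * sqrt (12 * (J n * ln (real (Suc n))) + 8 * (b / L (Suc n))\<^sup>2)"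
      proof eventually_elim
        case (elim n)
        have "norm (?c S n s - ?c T n s) \<le> \<bar>s\<bar> * sqrt (4 * J n * (2 + ln (real (Suc n))) + 8 * (b / L (Suc n))\<^sup>2)"
          unfolding S_def T_def J_def
          by (rule haar_eigen.window_char_bound[OF he g LS less_imp_le[OF b(1)] b(2)[OF LS]]) simp_all
        also have "\<dots> \<le> \<bar>s\<bar> * sqrt (12 * (J n * ln (real (Suc n))) + 8 * (b / L (Suc n))\<^sup>2)"
        proof (intro mult_left_mono real_sqrt_le_mono add_right_mono)
          have "4 * J n * (2 + ln (real (Suc n))) \<le> 4 * J n * (3 * ln (real (Suc n)))"
            using elim by (intro mult_left_mono) (auto simp: J_def)
          thus "4 * J n * (2 + ln (real (Suc n))) \<le> 12 * (J n * ln (real (Suc n)))" by simp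
        qed auto
        finally show ?case .
      qed
      have "(\<lambda>n. b / L (Suc n)) \<longlonglongrightarrow> 0"
        by (rule tendsto_divide_0[OF tendsto_const filterlim_at_top_imp_at_infinity[OF Linf]])
      hence "(\<lambda>n. \<bar>s\<bar> * sqrt (12 * (J n * ln (real (Suc n))) + 8 * (b / L (Suc n))\<^sup>2)) \<longlonglongrightarrow> \<bar>s\<bar> * sqrt (12 * 0 + 8 * 0\<^sup>2)"
        by (intro tendsto_mult tendsto_const tendsto_real_sqrt tendsto_add tendsto_power J)
      thus "(\<lambda>n. \<bar>s\<bar> * sqrt (12 * (J n * ln (real (Suc n))) + 8 * (b / L (Suc n))\<^sup>2)) \<longlonglongrightarrow> 0" by simp
    qed
    from tendsto_add[OF this cT[of s]] show "(\<lambda>n. ?c S n s) \<longlonglongrightarrow> of_real (exp (- (limit_variance g * s\<^sup>2 / 2)))"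
      by simp
  qed simp
  moreover have "centred_tends_to_law H T (normal_law 0 (limit_variance g))"
    by (rule centred_tends_to_normal_law[OF rT limit_variance_nonneg cT]) simp
  moreover have "(LINT M|H n. T n M) = real n / (2 * pi * L n) * (LINT x|lborel. g x)" if "1 \<le> n" for n
    unfolding T_def by (rule haar_eigen.dilate_expectation[OF he[OF that] g Lp[OF that]])
  moreover have "(LINT M|H n. S n M) = real n / (2 * pi * L n) *
     ((LINT x|lborel. g x) - (LINT x:{x. pi * L n < \<bar>x\<bar>}|lborel. g x))" if "1 \<le> n" for n
    unfolding S_def by (rule haar_eigen.window_expectation[OF he[OF that] g Lp[OF that]])
  ultimately show ?thesis using iT iS by blast
qed

end
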